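(* Let $\mathcal{S}$ be an $N_{\mathcal{S}}$-subhomogeneous operator system and $\mathcal{R}$ an $N_{\mathcal{R}}$-subhomogeneous operator system, and set $N=\max\{N_{\mathcal{S}},N_{\mathcal{R}}\}$. Then $\mathcal{S}$ and $\mathcal{R}$ are completely order isomorphic if and only if they are $N$-order isomorphic.
   Context: An operator system is a unital self-adjoint linear subspace of a unital $C^*$-algebra. $\mathbb{M}_n$ denotes the complex $n\times n$ matrices and $\mathbb{M}_{m,n}$ the complex $m\times n$ matrices. A linear map $\phi:\mathcal{S}\to\mathcal{R}$ is $n$-positive if the entrywise map $\phi_n:\mathbb{M}_n(\mathcal{S})\to\mathbb{M}_n(\mathcal{R})$ is positive. A unital linear bijection $\phi:\mathcal{S}\to\mathcal{R}$ is an $n$-order isomorphism if $\phi$ and $\phi^{-1}$ are $n$-positive, and a complete order isomorphism if it is an $n$-order isomorphism for all $n$. $\mathcal{S},\mathcal{R}$ are $n$-order (resp. completely order) isomorphic if there is an $n$-order (resp. complete order) isomorphism between them. $\mathrm{UCP}(\mathcal{S},\mathbb{M}_n)$ is the set of unital completely positive maps $\mathcal{S}\to\mathbb{M}_n$. A point $\phi\in \mathrm{UCP}(\mathcal{S},\mathbb{M}_n)$ is matrix extreme if whenever $\phi=\sum_{i=1}^k\gamma_i^*\phi_i\gamma_i$ with $\phi_i\in \mathrm{UCP}(\mathcal{S},\mathbb{M}_{n_i})$, each $\gamma_i\in\mathbb{M}_{n_i,n}$ surjective, and $\sum_i\gamma_i^*\gamma_i=1_n$, then for all $i$, $n_i=n$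 and $\phi=u_i^*\phi_iu_i$ for some unitary $u_i\in\mathbb{M}_n$. $\partial\,\mathrm{UCP}(\mathcal{S},\mathbb{M}_n)$ is the set of matrix extreme points at level $n$. $\mathcal{S}$ is subhomogeneous if there is $N\in\mathbb{N}$ with $\partial\,\mathrm{UCP}(\mathcal{S},\mathbb{M}_n)=\emptyset$ for all $n>N$, and $N$-subhomogeneous if $N$ is the smallest such integer. *)

theory Defs
  imports "HOL-Analysis.Analysis" "Jordan_Normal_Form.Matrix"
begin

class star =
  fixes star :: "'a \<Rightarrow> 'a"

class scaleC =
  fixes scaleC :: "complex \<Rightarrow> 'a \<Rightarrow> 'a" (infixr "*\<^sub>C" 75)

text \<open>
  Unital complex \<open>C\<close>*-algebras, with \<open>1 \<noteq> 0\<close> as usual. The real structure, submultiplicativity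
  and completeness come from the superclasses; the axioms add the compatible complex scalar
  multiplication, the involution and the \<open>C\<close>*-identity.
\<close>
class unital_cstar_algebra = real_normed_algebra_1 + banach + scaleC + star +
  assumes scaleC_add_right: "c *\<^sub>C (x + y) = c *\<^sub>C x + c *\<^sub>C y"
    and scaleC_add_left: "(c + d) *\<^sub>C x = c *\<^sub>C x + d *\<^sub>C x"
    and scaleC_scaleC: "c *\<^sub>C (d *\<^sub>C x) = (c * d) *\<^sub>C x"
    and scaleC_complex_of_real: "complex_of_real r *\<^sub>C x = r *\<^sub>R x"
    and mult_scaleC_left: "(c *\<^sub>C x) * y = c *\<^sub>C (x * y)"
    and mult_scaleC_right: "x * (c *\<^sub>C y) = c *\<^sub>C (x * y)"
    and norm_scaleC: "norm (c *\<^sub>C x) = cmod c * norm x"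
    and star_star: "star (star x) = x"
    and star_add: "star (x + y) = star x + star y"
    and star_scaleC: "star (c *\<^sub>C x) = cnj c *\<^sub>C star x"
    and star_mult: "star (x * y) = star y * star x"
    and cstar_identity: "norm (star x * x) = (norm x)\<^sup>2"

instantiation complex :: unital_cstar_algebra
begin

definition scaleC_complex :: "complex \<Rightarrow> complex \<Rightarrow> complex"
  where "scaleC_complex = (*)"

definition star_complex :: "complex \<Rightarrow> complex"
  where "star_complex = cnj"

instance
  by standard
    (simp_all add: scaleC_complex_def star_complex_def algebra_simps norm_mult power2_eq_square
      scaleR_conv_of_real)

end

definition operator_system :: "'a::unital_cstar_algebra set \<Rightarrow> bool" where
  "operator_system S \<longleftrightarrow>
     1 \<in> S \<and> (\<forall>x\<in>S. \<forall>y\<in>S. x + y \<in> S) \<and> (\<forall>c. \<forall>x\<in>S. c *\<^sub>C x \<in> S) \<and> (\<forall>x\<in>S. star x \<in> S)"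

definition mat_star :: "'a::star mat \<Rightarrow> 'a mat" where
  "mat_star X = mat (dim_col X) (dim_row X) (\<lambda>(i, j). star (X $$ (j, i)))"

text \<open>
  \<open>X\<close> is a positive element of the \<open>C\<close>*-algebra of \<open>n \<times> n\<close> matrices over \<open>'a\<close>, i.e. of the form
  \<open>Y* Y\<close>. For \<open>'a = complex\<close> these are the positive semidefinite matrices.
\<close>
definition mat_positive :: "nat \<Rightarrow> 'a::unital_cstar_algebra mat \<Rightarrow> bool" where
  "mat_positive n X \<longleftrightarrow> (\<exists>Y\<in>carrier_mat n n. X = mat_star Y * Y)"

definition mats_over :: "nat \<Rightarrow> 'a set \<Rightarrow> 'a mat set" where
  "mats_over n S = {X \<in> carrier_mat n n. \<forall>i<n. \<forall>j<n. X $$ (i, j) \<in> S}"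


subsection \<open>Order isomorphisms\<close>

definition linear_map_on ::
    "'a::unital_cstar_algebra set \<Rightarrow> ('a \<Rightarrow> 'b::unital_cstar_algebra) \<Rightarrow> bool" where
  "linear_map_on S f \<longleftrightarrow>
     (\<forall>x\<in>S. \<forall>y\<in>S. f (x + y) = f x + f y) \<and> (\<forall>c. \<forall>x\<in>S. f (c *\<^sub>C x) = c *\<^sub>C f x)"

definition n_positive ::
    "nat \<Rightarrow> 'a::unital_cstar_algebra set \<Rightarrow> ('a \<Rightarrow> 'b::unital_cstar_algebra) \<Rightarrow> bool" where
  "n_positive n S f \<longleftrightarrow>
     (\<forall>X\<in>mats_over n S. mat_positive n X \<longrightarrow> mat_positive n (map_mat f X))"

definition n_order_isomorphism ::
    "nat \<Rightarrow> 'a::unital_cstar_algebra set \<Rightarrow> 'b::unital_cstar_algebra set \<Rightarrow> ('a \<Rightarrow> 'b) \<Rightarrow> bool" where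
  "n_order_isomorphism n S R f \<longleftrightarrow>
     linear_map_on S f \<and> f 1 = 1 \<and> bij_betw f S R \<and>
     n_positive n S f \<and> n_positive n R (inv_into S f)"

definition complete_order_isomorphism ::
    "'a::unital_cstar_algebra set \<Rightarrow> 'b::unital_cstar_algebra set \<Rightarrow> ('a \<Rightarrow> 'b) \<Rightarrow> bool" where
  "complete_order_isomorphism S R f \<longleftrightarrow> (\<forall>n. n_order_isomorphism n S R f)"

definition n_order_isomorphic ::
    "nat \<Rightarrow> 'a::unital_cstar_algebra set \<Rightarrow> 'b::unital_cstar_algebra set \<Rightarrow> bool" where
  "n_order_isomorphic n S R \<longleftrightarrow> (\<exists>f. n_order_isomorphism n S R f)"

definition completely_order_isomorphic ::
    "'a::unital_cstar_algebra set \<Rightarrow> 'b::unital_cstar_algebra set \<Rightarrow> bool" where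
  "completely_order_isomorphic S R \<longleftrightarrow> (\<exists>f. complete_order_isomorphism S R f)"


subsection \<open>Matrix states and matrix extreme points\<close>

text \<open>
  The amplification \<open>\<phi>\<^sub>n\<close> of a map \<open>\<phi>\<close> into the \<open>k \<times> k\<close> complex matrices, with the \<open>n \<times> n\<close>
  matrices over the \<open>k \<times> k\<close> matrices identified with \<open>nk \<times> nk\<close> matrices as usual: the
  \<open>(p, q)\<close> block is \<open>\<phi> (X $$ (p, q))\<close>.
\<close>
definition amplify :: "nat \<Rightarrow> nat \<Rightarrow> ('a \<Rightarrow> complex mat) \<Rightarrow> 'a mat \<Rightarrow> complex mat" where
  "amplify n k \<phi> X =
     mat (n * k) (n * k) (\<lambda>(i, j). \<phi> (X $$ (i div k, j div k)) $$ (i mod k, j mod k))"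

text \<open>
  Maps are total functions of which only the values on \<open>S\<close> matter; below, equality of maps is
  always equality on \<open>S\<close>.
\<close>
definition UCP :: "'a::unital_cstar_algebra set \<Rightarrow> nat \<Rightarrow> ('a \<Rightarrow> complex mat) set" where
  "UCP S k = {\<phi>.
     (\<forall>x\<in>S. \<phi> x \<in> carrier_mat k k) \<and>
     (\<forall>x\<in>S. \<forall>y\<in>S. \<phi> (x + y) = \<phi> x + \<phi> y) \<and>
     (\<forall>c. \<forall>x\<in>S. \<phi> (c *\<^sub>C x) = c \<cdot>\<^sub>m \<phi> x) \<and>
     \<phi> 1 = 1\<^sub>m k \<and>
     (\<forall>n. \<forall>X\<in>mats_over n S. mat_positive n X \<longrightarrow> mat_positive (n * k) (amplify n k \<phi> X))}"

definition surjective_mat :: "nat \<Rightarrow> nat \<Rightarrow> complex mat \<Rightarrow> bool" where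
  "surjective_mat m n \<gamma> \<longleftrightarrow>
     \<gamma> \<in> carrier_mat m n \<and> (\<lambda>v. \<gamma> *\<^sub>v v) ` carrier_vec n = carrier_vec m"

definition unitary_mat :: "nat \<Rightarrow> complex mat \<Rightarrow> bool" where
  "unitary_mat n u \<longleftrightarrow> u \<in> carrier_mat n n \<and> mat_star u * u = 1\<^sub>m n \<and> u * mat_star u = 1\<^sub>m n"

text \<open>The sum of the \<open>n \<times> n\<close> matrices \<open>F 0, \<dots>, F (k - 1)\<close>.\<close>
definition msum :: "nat \<Rightarrow> nat \<Rightarrow> (nat \<Rightarrow> complex mat) \<Rightarrow> complex mat" where
  "msum n k F = mat n n (\<lambda>ij. \<Sum>i<k. F i $$ ij)"

text \<open>
  The levels \<open>m i\<close> have to be positive: otherwise a vacuous summand with \<open>m i = 0\<close> could be added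
  to every decomposition and no point would be matrix extreme.
\<close>
definition matrix_extreme ::
    "'a::unital_cstar_algebra set \<Rightarrow> nat \<Rightarrow> ('a \<Rightarrow> complex mat) \<Rightarrow> bool" where
  "matrix_extreme S n \<phi> \<longleftrightarrow>
     \<phi> \<in> UCP S n \<and>
     (\<forall>k m \<psi> \<gamma>.
        (\<forall>i<k. 0 < m i \<and> \<psi> i \<in> UCP S (m i) \<and> surjective_mat (m i) n (\<gamma> i)) \<and>
        msum n k (\<lambda>i. mat_star (\<gamma> i) * \<gamma> i) = 1\<^sub>m n \<and>
        (\<forall>x\<in>S. \<phi> x = msum n k (\<lambda>i. mat_star (\<gamma> i) * \<psi> i x * \<gamma> i))
        \<longrightarrow> (\<forall>i<k. m i = n \<and>
               (\<exists>u. unitary_mat n u \<and> (\<forall>x\<in>S. \<phi> x = mat_star u * \<psi> i x * u))))"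

definition matrix_extreme_points ::
    "'a::unital_cstar_algebra set \<Rightarrow> nat \<Rightarrow> ('a \<Rightarrow> complex mat) set" where
  "matrix_extreme_points S n = {\<phi>. matrix_extreme S n \<phi>}"

definition subhomogeneity_bound :: "'a::unital_cstar_algebra set \<Rightarrow> nat \<Rightarrow> bool" where
  "subhomogeneity_bound S N \<longleftrightarrow> (\<forall>n>N. matrix_extreme_points S n = {})"

definition N_subhomogeneous :: "nat \<Rightarrow> 'a::unital_cstar_algebra set \<Rightarrow> bool" where
  "N_subhomogeneous N S \<longleftrightarrow>
     subhomogeneity_bound S N \<and> (\<forall>M. subhomogeneity_bound S M \<longrightarrow> N \<le> M)"

end

theory Submission
  imports Defs "HOL-Library.Function_Algebras" "Jordan_Normal_Form.Determinant"
begin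

text \<open>
  Suppose \<open>h : S \<rightarrow> R\<close> is \<open>N\<close>-positive, \<open>X\<close> is a positive matrix over \<open>S\<close> and \<open>h X\<close> is not positive.
  Choose \<open>k\<close> minimal such that \<open>W\<^sup>* (h X) W\<close> is not positive for some scalar matrix \<open>W\<close> with \<open>k\<close>
  columns, and a pure positive functional on the \<open>k \<times> k\<close> matrices over \<open>R\<close> that is negative there.
  Under the duality between functionals on \<open>k \<times> k\<close> matrices over \<open>R\<close> and maps from \<open>R\<close> into the
  \<open>k \<times> k\<close> matrices it corresponds to a completely positive map which, \<open>k\<close> being minimal, is
  invertible at \<open>1\<close>; normalized there, it becomes a matrix extreme point \<open>\<theta>\<close> that is not
  positive at \<open>h X\<close>. Subhomogeneity gives \<open>k \<le> N\<close>, and then \<open>\<theta> \<circ> h\<close> is \<open>k\<close>-positive with values in the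
  \<open>k \<times> k\<close> matrices, hence completely positive: a contradiction.

  Two tools make this elementary. A matrix over a \<open>C\<close>*-algebra is of the form \<open>Y\<^sup>* Y\<close> iff its quadratic
  form on columns takes positive values, by the power series of the square root; and pure
  functionals are minimal among the sublinear functionals that support a face of the state space,
  so that Zorn's lemma replaces the Krein--Milman theorem.
\<close>

subsection \<open>The power series of the square root\<close>

text \<open>The functionals are real-linear on the space of all \<open>k \<times> k\<close>
  matrices, and the cone consists of the matrices with positive real part (\<open>re_pos\<close>).
  Real scalars suit gauges and Zorn's lemma, and no subspace of self-adjoint matrices has to be
  carried along. Nothing is lost, since \<open>X\<close> is positive iff \<open>X\<close>,
  \<open>i X\<close> and \<open>- i X\<close> all have positive real part. The minimality of
  \<open>k\<close> is what links pure functionals to matrix extreme points: purity alone gives a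
  completely positive map whose value at 1 may be singular, and such a map cannot be normalized to a
  unital one at the same level. Neither Hilbert spaces nor spectra occur. The positive cone is
  described by norms, through the ball condition of Kelley and Vaught. Its theory rests on the
  square root series converging up to the boundary of the unit ball; the bound 1 on the absolute sum
  of the nonconstant coefficients also keeps the root inside the cone.\<close>

definition sqrt_coeff :: "nat \<Rightarrow> real" where
  "sqrt_coeff j = (-1) ^ j * ((1/2) gchoose j)"

lemma sqrt_coeff_0 [simp]: "sqrt_coeff 0 = 1"
  by (simp add: sqrt_coeff_def)

text \<open>Passing from \<open>k\<close> to \<open>k + 1\<close> multiplies the value by
  \<open>(k + 1/2) / (k + 1)\<close>. These numbers are the coefficients of the inverse square root
  of 1 - x; they control both the signs and the partial sums of \<open>sqrt_coeff\<close>.\<close>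

lemma minus_half_gbinomial_sign: "0 \<le> (-1) ^ k * ((-1/2 :: real) gchoose k)"
proof (induction k)
  case (Suc k)
  have "real (Suc k) * ((-1/2 :: real) gchoose Suc k) = - (1/2 + real k) * ((-1/2) gchoose k)"
    using gbinomial_mult_1[of "-1/2::real" k] by (simp add: algebra_simps)
  then have "real (Suc k) * ((-1) ^ Suc k * ((-1/2 :: real) gchoose Suc k))
      = - ((-1) ^ k) * (- (1/2 + real k) * ((-1/2) gchoose k))"
    by (metis mult.left_commute mult_minus1 power_Suc)
  also have "\<dots> = (1/2 + real k) * ((-1) ^ k * ((-1/2 :: real) gchoose k))"
    by (simp add: algebra_simps)
  also have "\<dots> \<ge> 0"
    by (rule mult_nonneg_nonneg[OF _ Suc.IH]) simp
  finally show ?case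
    using mult_le_cancel_left_pos[of "real (Suc k)" 0 "(-1) ^ Suc k * ((-1/2 :: real) gchoose Suc k)"]
    by (simp only: mult_zero_right of_nat_0_less_iff zero_less_Suc)
qed simp

text \<open>Absorption turns the coefficient at \<open>Suc k\<close> into a negative multiple of the
  inverse square root coefficient at \<open>k\<close>.\<close>

lemma sqrt_coeff_nonpos:
  assumes "0 < j" shows "sqrt_coeff j \<le> 0"
proof -
  obtain k where j: "j = Suc k"
    using assms by (cases j) auto
  have "real (Suc k) * ((1/2 :: real) gchoose Suc k) = 1/2 * ((-1/2) gchoose k)"
    using gbinomial_absorption[of k "1/2::real"] by simp
  then have "real (Suc k) * sqrt_coeff (Suc k) = - ((-1) ^ k) * (1/2 * ((-1/2 :: real) gchoose k))"
    unfolding sqrt_coeff_def by (metis mult.left_commute mult_minus1 power_Suc)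
  also have "\<dots> = - (1/2) * ((-1) ^ k * ((-1/2 :: real) gchoose k))"
    by simp
  also have "\<dots> \<le> 0"
    using minus_half_gbinomial_sign[of k] by simp
  finally show ?thesis
    unfolding j using mult_le_cancel_left_pos[of "real (Suc k)" "sqrt_coeff (Suc k)" 0]
    by (simp only: mult_zero_right of_nat_0_less_iff zero_less_Suc)
qed

lemma sum_sqrt_coeff: "(\<Sum>j\<le>m. sqrt_coeff j) = (-1) ^ m * ((-1/2) gchoose m)"
  using gbinomial_sum_lower_neg[of "1/2::real" m] by (simp add: sqrt_coeff_def mult.commute)

text \<open>All terms beyond index 0 have the same sign, so the sum is 1 minus a partial sum of
  \<open>sqrt_coeff\<close>, and those partial sums are nonnegative.\<close>

lemma sum_abs_sqrt_coeff: "(\<Sum>j<m. \<bar>sqrt_coeff (Suc j)\<bar>) \<le> 1"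
proof -
  have "(\<Sum>j<m. \<bar>sqrt_coeff (Suc j)\<bar>) = - (\<Sum>j<m. sqrt_coeff (Suc j))"
    using sqrt_coeff_nonpos by (subst sum_negf[symmetric]) (intro sum.cong, auto)
  also have "(\<Sum>j<m. sqrt_coeff (Suc j)) = (\<Sum>j\<le>m. sqrt_coeff j) - 1"
    by (simp add: sum.atMost_shift)
  finally show ?thesis
    using minus_half_gbinomial_sign[of m] by (simp add: sum_sqrt_coeff)
qed

lemma summable_abs_sqrt_coeff_Suc: "summable (\<lambda>j. \<bar>sqrt_coeff (Suc j)\<bar>)"
  using sum_abs_sqrt_coeff by (intro summableI_nonneg_bounded[where x = 1]) auto

lemma summable_abs_sqrt_coeff: "summable (\<lambda>j. \<bar>sqrt_coeff j\<bar>)"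
  using summable_abs_sqrt_coeff_Suc summable_Suc_iff[of "\<lambda>j. \<bar>sqrt_coeff j\<bar>"] by simp

text \<open>Vandermonde with 1/2 + 1/2 = 1: the series squares to 1 - x.\<close>

lemma sqrt_coeff_convolution:
  "(\<Sum>i\<le>m. sqrt_coeff i * sqrt_coeff (m - i)) = (if m = 0 then 1 else if m = 1 then -1 else 0)"
proof -
  have "(\<Sum>i\<le>m. sqrt_coeff i * sqrt_coeff (m - i))
      = (\<Sum>i\<le>m. (-1) ^ m * (((1/2) gchoose i) * ((1/2) gchoose (m - i))))"
  proof (rule sum.cong)
    fix i assume "i \<in> {..m}"
    then have "(-1::real) ^ m = (-1) ^ i * (-1) ^ (m - i)"
      by (simp flip: power_add)
    then show "sqrt_coeff i * sqrt_coeff (m - i)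
        = (-1) ^ m * (((1/2) gchoose i) * ((1/2) gchoose (m - i)))"
      by (simp add: sqrt_coeff_def)
  qed simp
  also have "\<dots> = (-1) ^ m * ((1::real) gchoose m)"
    using gbinomial_Vandermonde[of "1/2::real" "1/2" m]
    by (simp add: atMost_atLeast0 flip: sum_distrib_left)
  also have "(1::real) gchoose m = of_nat (1 choose m)"
    by (metis binomial_gbinomial of_nat_1)
  finally show ?thesis
    by (cases m) (auto simp: binomial_eq_0)
qed

section \<open>The square root of 1 - c in a unital Banach algebra\<close>

context
  fixes c :: "'a::{real_normed_algebra_1,banach}"
  assumes norm_c: "norm c \<le> 1"
begin

lemma summable_norm_sqrt_series: "summable (\<lambda>j. norm (sqrt_coeff j *\<^sub>R c ^ j))"
proof (rule summable_comparison_test'[OF summable_abs_sqrt_coeff, of 0])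
  fix n :: nat
  have "norm (c ^ n) \<le> 1"
    using norm_power_ineq[of c n] norm_c power_le_one[of "norm c" n] by simp
  then show "norm (norm (sqrt_coeff n *\<^sub>R c ^ n)) \<le> \<bar>sqrt_coeff n\<bar>"
    by (simp add: mult_left_le)
qed

definition sqrt_one_minus :: 'a where
  "sqrt_one_minus = (\<Sum>j. sqrt_coeff j *\<^sub>R c ^ j)"

lemma sqrt_one_minus_sums: "(\<lambda>j. sqrt_coeff j *\<^sub>R c ^ j) sums sqrt_one_minus"
  unfolding sqrt_one_minus_def
  by (rule summable_sums[OF summable_norm_cancel[OF summable_norm_sqrt_series]])

lemma sqrt_one_minus_square: "sqrt_one_minus * sqrt_one_minus = 1 - c"
proof -
  have "(\<Sum>i\<le>m. sqrt_coeff i *\<^sub>R c ^ i * sqrt_coeff (m - i) *\<^sub>R c ^ (m - i))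
     = (if m = 0 then 1 else if m = 1 then - c else 0)" (is "?l = ?r") for m
  proof -
    have "?l = (\<Sum>i\<le>m. sqrt_coeff i * sqrt_coeff (m - i)) *\<^sub>R c ^ m"
      by (simp add: scaleR_sum_left mult.commute flip: power_add)
    then show ?thesis
      by (simp add: sqrt_coeff_convolution)
  qed
  then have "(\<lambda>m. if m = 0 then 1 else if m = 1 then - c else 0) sums
      (sqrt_one_minus * sqrt_one_minus)"
    using Cauchy_product_sums[OF summable_norm_sqrt_series summable_norm_sqrt_series]
    by (simp add: sqrt_one_minus_def)
  moreover have "(\<lambda>m. if m = 0 then 1 else if m = 1 then - c else 0) sums (\<Sum>m\<in>{0,1}. if m = 0 then 1 else if m = (1::nat) then - c else 0)"
    by (rule sums_finite) auto
  ultimately have "sqrt_one_minus * sqrt_one_minus = (\<Sum>m\<in>{0,1}. if m = 0 then 1 else if m = (1::nat) then - c else 0)"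
    by (rule sums_unique2)
  then show ?thesis
    by simp
qed

text \<open>This keeps the root in the unit ball around 1, which is why square roots of positive
  elements turn out positive in the sense of \<open>cstar_pos\<close>.\<close>

lemma norm_one_minus_sqrt: "norm (1 - sqrt_one_minus) \<le> 1"
proof -
  let ?f = "\<lambda>j. sqrt_coeff (Suc j) *\<^sub>R c ^ Suc j"
  have s: "summable (\<lambda>j. norm (?f j))"
    using summable_norm_sqrt_series summable_Suc_iff[of "\<lambda>j. norm (sqrt_coeff j *\<^sub>R c ^ j)"]
    by blast
  have "?f sums (sqrt_one_minus - 1)"
    using sums_Suc_iff[THEN iffD2, of "\<lambda>j. sqrt_coeff j *\<^sub>R c ^ j"] sqrt_one_minus_sums
      sums_split_initial_segment[OF sqrt_one_minus_sums, of 1]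
    by simp
  then have "norm (sqrt_one_minus - 1) \<le> (\<Sum>j. norm (?f j))"
    using summable_norm[OF s] by (simp add: sums_iff)
  also have "\<dots> \<le> (\<Sum>j. \<bar>sqrt_coeff (Suc j)\<bar>)"
  proof (rule suminf_le[OF _ s summable_abs_sqrt_coeff_Suc])
    fix n
    have "norm (c ^ Suc n) \<le> 1"
      using norm_power_ineq[of c "Suc n"] norm_c power_le_one[of "norm c" "Suc n"] by simp
    then show "norm (?f n) \<le> \<bar>sqrt_coeff (Suc n)\<bar>"
      by (simp add: mult_left_le)
  qed
  also have "\<dots> \<le> 1"
    by (rule suminf_le_const[OF summable_abs_sqrt_coeff_Suc sum_abs_sqrt_coeff])
  finally show ?thesis
    by (simp add: norm_minus_commute)
qed

lemma sqrt_one_minus_commute: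
  assumes "z * c = c * z" shows "z * sqrt_one_minus = sqrt_one_minus * z"
proof -
  have "z * (sqrt_coeff j *\<^sub>R c ^ j) = (sqrt_coeff j *\<^sub>R c ^ j) * z" for j
    using power_commuting_commutes[OF assms[symmetric], of j] by simp
  then have "(\<lambda>j. (sqrt_coeff j *\<^sub>R c ^ j) * z) sums (z * sqrt_one_minus)"
    using sums_mult[OF sqrt_one_minus_sums, of z] by (simp only:)
  then show ?thesis
    using sums_mult2[OF sqrt_one_minus_sums, of z] by (rule sums_unique2)
qed

end

subsection \<open>\<open>C\<close>*-algebras\<close>

lemma scaleC_zero_left [simp]:
  fixes x :: "'a::unital_cstar_algebra"
  shows "0 *\<^sub>C x = 0"
  using scaleC_add_left[of 0 0 x] by simp

lemma scaleC_zero_right [simp]: "c *\<^sub>C 0 = (0::'a::unital_cstar_algebra)"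
  using scaleC_add_right[of c 0 0] by simp

lemma scaleC_one [simp]:
  fixes x :: "'a::unital_cstar_algebra"
  shows "1 *\<^sub>C x = x"
  using scaleC_complex_of_real[of 1 x] by simp

lemma scaleC_minus_left:
  fixes x :: "'a::unital_cstar_algebra"
  shows "(- c) *\<^sub>C x = - (c *\<^sub>C x)"
  using scaleC_add_left[of c "- c" x] by (simp add: eq_neg_iff_add_eq_0 add.commute)

lemma scaleC_minus_right:
  fixes x :: "'a::unital_cstar_algebra"
  shows "c *\<^sub>C (- x) = - (c *\<^sub>C x)"
  using scaleC_add_right[of c x "- x"] by (simp add: eq_neg_iff_add_eq_0 add.commute)

lemma scaleC_diff_right:
  fixes x :: "'a::unital_cstar_algebra"
  shows "c *\<^sub>C (x - y) = c *\<^sub>C x - c *\<^sub>C y"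
  using scaleC_add_right[of c x "- y"] by (simp add: scaleC_minus_right)

lemma star_zero [simp]: "star 0 = (0::'a::unital_cstar_algebra)"
  using star_add[of 0 0] by simp

lemma star_one [simp]: "star 1 = (1::'a::unital_cstar_algebra)"
  by (metis mult_1_left mult_1_right star_mult star_star)

lemma star_minus:
  fixes x :: "'a::unital_cstar_algebra"
  shows "star (- x) = - star x"
  using star_add[of x "- x"] by (simp add: eq_neg_iff_add_eq_0 add.commute)

lemma star_diff:
  fixes x :: "'a::unital_cstar_algebra"
  shows "star (x - y) = star x - star y"
  using star_add[of x "- y"] by (simp add: star_minus)

lemma star_scaleR:
  fixes x :: "'a::unital_cstar_algebra"
  shows "star (r *\<^sub>R x) = r *\<^sub>R star x"
  using star_scaleC[of "complex_of_real r" x] by (simp add: scaleC_complex_of_real)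

lemma scaleC_sum_right:
  fixes f :: "'i \<Rightarrow> 'a::unital_cstar_algebra"
  shows "c *\<^sub>C sum f A = (\<Sum>i\<in>A. c *\<^sub>C f i)"
  by (induction A rule: infinite_finite_induct) (auto simp: scaleC_add_right)

lemma star_sum:
  fixes f :: "'i \<Rightarrow> 'a::unital_cstar_algebra"
  shows "star (sum f A) = (\<Sum>i\<in>A. star (f i))"
  by (induction A rule: infinite_finite_induct) (auto simp: star_add)

lemma norm_star [simp]:
  fixes x :: "'a::unital_cstar_algebra"
  shows "norm (star x) = norm x"
proof -
  have *: "norm x \<le> norm (star x)" for x :: 'a
  proof (cases "x = 0")
    case False
    have "norm x * norm x \<le> norm (star x) * norm x"
      using cstar_identity[of x] norm_mult_ineq[of "star x" x] by (metis power2_eq_square)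
    then show ?thesis
      using False by simp
  qed simp
  show ?thesis
    using *[of x] *[of "star x"] by (simp add: star_star)
qed

lemma norm_selfadjoint_square:
  fixes x :: "'a::unital_cstar_algebra"
  shows "star x = x \<Longrightarrow> norm (x * x) = (norm x)\<^sup>2"
  using cstar_identity[of x] by simp

lemma bounded_linear_star: "bounded_linear (star :: 'a::unital_cstar_algebra \<Rightarrow> 'a)"
  by (intro bounded_linear_intro[where K = 1]) (auto simp: star_add star_scaleR)

lemma scaleC_ii_scaleC_ii [simp]:
  fixes x :: "'a::unital_cstar_algebra"
  shows "\<i> *\<^sub>C (\<i> *\<^sub>C x) = - x"
  by (simp add: scaleC_scaleC scaleC_minus_left)

lemma sqrt_one_minus_star:
  fixes c :: "'a::unital_cstar_algebra"
  assumes "norm c \<le> 1" "star c = c"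
  shows "star (sqrt_one_minus c) = sqrt_one_minus c"
proof -
  have "star (c ^ j) = c ^ j" for j
    by (induction j) (simp_all add: star_mult assms power_commutes)
  then have "(\<lambda>j. sqrt_coeff j *\<^sub>R c ^ j) sums star (sqrt_one_minus c)"
    using bounded_linear.sums[OF bounded_linear_star sqrt_one_minus_sums[OF assms(1)]]
    by (simp add: star_scaleR)
  then show ?thesis
    using sqrt_one_minus_sums[OF assms(1)] by (rule sums_unique2)
qed

text \<open>
  The Kelley--Vaught description of the positive cone: for large \<open>t\<close>, a self-adjoint \<open>x\<close> is positive
  iff it lies in the ball of radius \<open>t\<close> around \<open>t\<close>.
\<close>
definition cstar_pos :: "'a::unital_cstar_algebra \<Rightarrow> bool" where
  "cstar_pos x \<longleftrightarrow> star x = x \<and> (\<exists>t. norm (t *\<^sub>R 1 - x) \<le> t)"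

lemma cstar_pos_star: "cstar_pos x \<Longrightarrow> star x = x"
  by (simp add: cstar_pos_def)

text \<open>With \<open>t\<close> from the definition, \<open>c = 1 - x / t\<close> lies in the unit
  ball, and the root of \<open>1 - c\<close> is rescaled by \<open>sqrt t\<close>. It is a power
  series in \<open>c\<close>, hence commutes with whatever commutes with \<open>x\<close>; this is
  how roots of commuting elements are made to commute later.\<close>

lemma cstar_pos_root:
  fixes x :: "'a::unital_cstar_algebra"
  assumes "cstar_pos x"
  obtains m where "star m = m" "m * m = x" "cstar_pos m" "\<And>z. z * x = x * z \<Longrightarrow> z * m = m * z"
proof -
  obtain t where t: "norm (t *\<^sub>R 1 - x) \<le> t" and sx: "star x = x"
    using assms by (auto simp: cstar_pos_def)
  show thesis
  proof (cases "t = 0")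
    case True
    then have "x = 0" using t by simp
    then show thesis
      using that[of 0] assms by simp
  next
    case False
    then have "t > 0"
      using t norm_ge_zero[of "t *\<^sub>R 1 - x"] by linarith
    define c where "c = 1 - x /\<^sub>R t"
    have "c = (1/t) *\<^sub>R (t *\<^sub>R 1 - x)"
      using \<open>t > 0\<close> by (simp add: c_def scaleR_diff_right divide_inverse)
    then have nc: "norm c \<le> 1"
      using t \<open>t > 0\<close> by simp
    have sc: "star c = c"
      by (simp add: c_def star_diff star_scaleR sx)
    define r where "r = sqrt_one_minus c"
    have rr: "r * r = x /\<^sub>R t" and nr: "norm (1 - r) \<le> 1" and sr: "star r = r"
      unfolding r_def using sqrt_one_minus_square[OF nc] norm_one_minus_sqrt[OF nc]
        sqrt_one_minus_star[OF nc sc] by (simp_all add: c_def)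
    show thesis
    proof (rule that[of "sqrt t *\<^sub>R r"])
      show "star (sqrt t *\<^sub>R r) = sqrt t *\<^sub>R r"
        by (simp add: star_scaleR sr)
      show "sqrt t *\<^sub>R r * sqrt t *\<^sub>R r = x"
        using \<open>t > 0\<close> by (simp add: rr flip: mult.assoc)
      have "norm (sqrt t *\<^sub>R 1 - sqrt t *\<^sub>R r) \<le> sqrt t"
        using nr \<open>t > 0\<close> by (simp add: mult_left_le flip: scaleR_diff_right)
      then show "cstar_pos (sqrt t *\<^sub>R r)"
        by (auto simp: cstar_pos_def star_scaleR sr)
      fix z assume "z * x = x * z"
      then have "z * c = c * z"
        by (simp add: c_def algebra_simps)
      then have "z * r = r * z"
        unfolding r_def by (rule sqrt_one_minus_commute[OF nc])
      then show "z * sqrt t *\<^sub>R r = sqrt t *\<^sub>R r * z"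
        by simp
    qed
  qed
qed

text \<open>If \<open>m\<close> and \<open>l\<close> commute then \<open>(m + i l)\<^sup>* (m + i l) = m\<^sup>2 + l\<^sup>2\<close>.\<close>
lemma norm_le_of_sum_squares:
  fixes m l :: "'a::unital_cstar_algebra"
  assumes "star m = m" "star l = l" "m * l = l * m" "m * m + l * l = t *\<^sub>R 1" "t \<ge> 0"
  shows "norm m \<le> sqrt t"
proof -
  define u where "u = m + \<i> *\<^sub>C l"
  have su: "star u = m - \<i> *\<^sub>C l"
    by (simp add: u_def star_add star_scaleC assms scaleC_minus_left)
  have "star u * u = m * m + l * l"
    unfolding su unfolding u_def
    by (simp add: algebra_simps mult_scaleC_left mult_scaleC_right scaleC_diff_right assms(3))
  then have "(norm u)\<^sup>2 = t"
    using cstar_identity[of u] assms by simp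
  then have nu: "norm u = sqrt t"
    by (simp add: real_sqrt_unique)
  have "2 *\<^sub>R m = u + star u"
    unfolding su by (simp add: u_def scaleR_2)
  then have "2 * norm m \<le> norm u + norm (star u)"
    by (metis norm_triangle_ineq norm_scaleR abs_numeral)
  then show ?thesis
    by (simp add: nu)
qed

text \<open>Put \<open>c = k * k / t\<close> and let \<open>r\<close> be the root of
  \<open>1 - c\<close>. Then \<open>r\<close> and \<open>k / sqrt t\<close> commute and their
  squares add up to 1, so \<open>norm_le_of_sum_squares\<close> bounds \<open>r\<close> by 1, and
  with it \<open>1 - c = r * r\<close>.\<close>

lemma norm_diff_square_le:
  fixes k :: "'a::unital_cstar_algebra"
  assumes "star k = k" "(norm k)\<^sup>2 \<le> t"
  shows "norm (t *\<^sub>R 1 - k * k) \<le> t"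
proof (cases "t = 0")
  case False
  then have "t > 0"
    using assms(2) by (metis less_eq_real_def order_trans zero_le_power2)
  define c where "c = (k * k) /\<^sub>R t"
  have sc: "star c = c"
    by (simp add: c_def star_scaleR star_mult assms)
  have nc: "norm c \<le> 1"
    using assms \<open>t > 0\<close> by (simp add: c_def norm_selfadjoint_square field_simps)
  define r where "r = sqrt_one_minus c"
  have rr: "r * r = 1 - c" and sr: "star r = r"
    unfolding r_def using sqrt_one_minus_square[OF nc] sqrt_one_minus_star[OF nc sc] by simp_all
  have "k * c = c * k"
    by (simp add: c_def mult.assoc)
  then have kr: "k * r = r * k"
    unfolding r_def by (rule sqrt_one_minus_commute[OF nc])
  have "norm r \<le> sqrt 1"
  proof (rule norm_le_of_sum_squares[where l = "k /\<^sub>R sqrt t"])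
    show "r * r + (k /\<^sub>R sqrt t) * (k /\<^sub>R sqrt t) = 1 *\<^sub>R 1"
      using \<open>t > 0\<close> by (simp add: rr c_def flip: inverse_mult_distrib)
  qed (simp_all add: star_scaleR assms sr kr)
  then have "norm (1 - c) \<le> 1"
    using norm_selfadjoint_square[OF sr] by (simp add: rr power_le_one)
  moreover have "t *\<^sub>R 1 - k * k = t *\<^sub>R (1 - c)"
    using \<open>t > 0\<close> by (simp add: c_def scaleR_diff_right)
  ultimately show ?thesis
    using \<open>t > 0\<close> by (simp add: mult_left_le)
qed (use assms in simp)

lemma cstar_pos_square:
  fixes k :: "'a::unital_cstar_algebra"
  shows "star k = k \<Longrightarrow> cstar_pos (k * k)"
  unfolding cstar_pos_def using norm_diff_square_le[of k "(norm k)\<^sup>2"] by (auto simp: star_mult)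

text \<open>The radius in the definition of \<open>cstar_pos\<close> may thus be any number above
  the norm: write \<open>x\<close> as the square of its root and use
  \<open>norm_diff_square_le\<close>.\<close>

lemma cstar_pos_norm_le:
  fixes x :: "'a::unital_cstar_algebra"
  assumes "cstar_pos x" "norm x \<le> t"
  shows "norm (t *\<^sub>R 1 - x) \<le> t"
proof -
  obtain m where m: "star m = m" "m * m = x"
    using cstar_pos_root[OF assms(1)] by metis
  then have "(norm m)\<^sup>2 \<le> t"
    using norm_selfadjoint_square[OF m(1)] assms(2) by simp
  from norm_diff_square_le[OF m(1) this] show ?thesis
    by (simp add: m)
qed

lemma cstar_pos_0 [simp]: "cstar_pos (0 :: 'a::unital_cstar_algebra)"
  unfolding cstar_pos_def by (auto intro!: exI[of _ 0])

lemma cstar_pos_add: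
  fixes x y :: "'a::unital_cstar_algebra"
  assumes "cstar_pos x" "cstar_pos y"
  shows "cstar_pos (x + y)"
proof -
  obtain s t where st: "norm (s *\<^sub>R 1 - x) \<le> s" "norm (t *\<^sub>R 1 - y) \<le> t"
    using assms by (auto simp: cstar_pos_def)
  have "(s + t) *\<^sub>R 1 - (x + y) = (s *\<^sub>R 1 - x) + (t *\<^sub>R 1 - y)"
    by (simp add: scaleR_add_left)
  then have "norm ((s + t) *\<^sub>R 1 - (x + y)) \<le> s + t"
    using st norm_add_rule_thm by metis
  then show ?thesis
    using assms by (auto simp: cstar_pos_def star_add)
qed

lemma cstar_pos_scaleR:
  fixes x :: "'a::unital_cstar_algebra"
  assumes "cstar_pos x" "0 \<le> r"
  shows "cstar_pos (r *\<^sub>R x)"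
proof -
  obtain t where t: "norm (t *\<^sub>R 1 - x) \<le> t"
    using assms by (auto simp: cstar_pos_def)
  have "(r * t) *\<^sub>R 1 - r *\<^sub>R x = r *\<^sub>R (t *\<^sub>R 1 - x)"
    by (simp add: algebra_simps)
  then have "norm ((r * t) *\<^sub>R 1 - r *\<^sub>R x) \<le> r * t"
    using t assms(2) by (simp add: mult_left_mono)
  then show ?thesis
    using assms by (auto simp: cstar_pos_def star_scaleR)
qed

lemma cstar_pos_sum:
  fixes f :: "'i \<Rightarrow> 'a::unital_cstar_algebra"
  shows "(\<And>i. i \<in> A \<Longrightarrow> cstar_pos (f i)) \<Longrightarrow> cstar_pos (sum f A)"
  by (induction A rule: infinite_finite_induct) (auto intro: cstar_pos_add)

text \<open>One radius, \<open>norm x + norm y\<close>, serves all perturbations with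
  \<open>e\<close> at most 1 by \<open>cstar_pos_norm_le\<close>, so the ball condition survives the
  limit.\<close>

lemma cstar_pos_archimedean:
  fixes x y :: "'a::unital_cstar_algebra"
  assumes "\<And>e. e > 0 \<Longrightarrow> cstar_pos (x + e *\<^sub>R y)"
  shows "cstar_pos x"
proof -
  have lim: "(\<lambda>n. x + inverse (real (Suc n)) *\<^sub>R y) \<longlonglongrightarrow> x"
    using tendsto_add[OF tendsto_const[of x] tendsto_scaleR[OF LIMSEQ_inverse_real_of_nat tendsto_const[of y]]]
    by simp
  have "(\<lambda>n. star (x + inverse (real (Suc n)) *\<^sub>R y)) \<longlonglongrightarrow> star x"
    by (rule bounded_linear.tendsto[OF bounded_linear_star lim])
  moreover have "star (x + inverse (real (Suc n)) *\<^sub>R y) = x + inverse (real (Suc n)) *\<^sub>R y" for n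
    by (intro cstar_pos_star assms) simp
  ultimately have sx: "star x = x"
    using LIMSEQ_unique[OF _ lim] by (simp only:)
  define t where "t = norm x + norm y"
  have "norm (t *\<^sub>R 1 - (x + inverse (real (Suc n)) *\<^sub>R y)) \<le> t" for n
  proof (rule cstar_pos_norm_le)
    have "norm (inverse (real (Suc n)) *\<^sub>R y) \<le> norm y"
      by (simp add: field_simps mult_left_mono)
    then show "norm (x + inverse (real (Suc n)) *\<^sub>R y) \<le> t"
      unfolding t_def using norm_triangle_ineq[of x "inverse (real (Suc n)) *\<^sub>R y"] by linarith
  qed (intro assms, simp)
  then have "norm (t *\<^sub>R 1 - x) \<le> t"
    using tendsto_norm[OF tendsto_diff[OF tendsto_const[of "t *\<^sub>R 1"] lim]]
    by (intro Lim_bounded[of _ _ 0]) auto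
  with sx show ?thesis
    by (auto simp: cstar_pos_def)
qed

text \<open>The roots of \<open>x\<close> and of \<open>t - x\<close> commute and their squares add
  up to \<open>t\<close>, which bounds the root of \<open>x\<close> by
  \<open>sqrt t\<close>.\<close>

lemma norm_le_of_cstar_pos:
  fixes x :: "'a::unital_cstar_algebra"
  assumes "cstar_pos x" "cstar_pos (t *\<^sub>R 1 - x)" "t \<ge> 0"
  shows "norm x \<le> t"
proof -
  obtain m where m: "star m = m" "m * m = x" "\<And>z. z * x = x * z \<Longrightarrow> z * m = m * z"
    using cstar_pos_root[OF assms(1)] by metis
  obtain l where l: "star l = l" "l * l = t *\<^sub>R 1 - x"
      "\<And>z. z * (t *\<^sub>R 1 - x) = (t *\<^sub>R 1 - x) * z \<Longrightarrow> z * l = l * z"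
    using cstar_pos_root[OF assms(2)] by metis
  have "m * x = x * m"
    by (simp add: m(2)[symmetric] mult.assoc)
  then have "m * l = l * m"
    by (intro l) (simp add: algebra_simps)
  then have "norm m \<le> sqrt t"
    using assms by (intro norm_le_of_sum_squares[of m l]) (simp_all add: m l)
  then have "(norm m)\<^sup>2 \<le> t"
    using assms(3) by (metis norm_ge_zero power_mono real_sqrt_pow2)
  then show ?thesis
    using norm_selfadjoint_square[OF m(1)] m(2) by simp
qed

lemma cstar_pos_antisym:
  fixes x :: "'a::unital_cstar_algebra"
  shows "cstar_pos x \<Longrightarrow> cstar_pos (- x) \<Longrightarrow> x = 0"
  using norm_le_of_cstar_pos[of x 0] by simp

lemma cstar_pos_norm_diff:
  fixes x :: "'a::unital_cstar_algebra"
  shows "star x = x \<Longrightarrow> cstar_pos (norm x *\<^sub>R 1 - x)"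
  by (auto simp: cstar_pos_def star_diff star_scaleR intro!: exI[of _ "norm x"])

text \<open>The spectral radius of a self-adjoint element is its norm.\<close>
lemma norm_le_one_of_linear_growth:
  fixes x :: "'a::unital_cstar_algebra"
  assumes "star x = x" "\<And>j. norm (x ^ j) \<le> 1 + real j * b"
  shows "norm x \<le> 1"
proof (rule ccontr)
  assume "\<not> norm x \<le> 1"
  have sa: "star (x ^ j) = x ^ j" for j
    by (induction j) (simp_all add: star_mult assms power_commutes)
  have pw: "norm (x ^ (2 ^ n)) = norm x ^ (2 ^ n)" for n
  proof (induction n)
    case (Suc n)
    have "x ^ (2 ^ Suc n) = x ^ (2 ^ n) * x ^ (2 ^ n)"
      by (simp add: mult_2 power_add)
    then have "norm (x ^ (2 ^ Suc n)) = (norm x ^ (2 ^ n))\<^sup>2"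
      using norm_selfadjoint_square[OF sa] Suc by simp
    then show ?case
      by (simp add: mult.commute flip: power_mult)
  qed simp
  define d where "d = norm x - 1"
  have d: "d > 0"
    using \<open>\<not> norm x \<le> 1\<close> by (simp add: d_def)
  \<comment> \<open>Bernoulli is applied at exponent \<open>2 ^ n\<close> and then squared, so the
    left side is quadratic in \<open>2 ^ n\<close> while the hypothesis at exponent
    \<open>2 ^ Suc n\<close> is only linear.\<close>
  have bound: "(real (2 ^ n) * d)\<^sup>2 \<le> 1 + 2 * real (2 ^ n) * b" for n
  proof -
    have "(real (2 ^ n) * d)\<^sup>2 \<le> (1 + real (2 ^ n) * d)\<^sup>2"
      using d by (intro power_mono) auto
    also have "\<dots> \<le> ((1 + d) ^ (2 ^ n))\<^sup>2"
      using d Bernoulli_inequality[of d "2 ^ n"] by (intro power_mono) auto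
    also have "\<dots> = norm x ^ (2 ^ Suc n)"
      by (simp add: d_def mult.commute flip: power_mult)
    also have "\<dots> \<le> 1 + 2 * real (2 ^ n) * b"
      using assms(2)[of "2 ^ Suc n"] pw[of "Suc n"] by simp
    finally show ?thesis .
  qed
  obtain n where n: "real n > (1 + 2 * \<bar>b\<bar>) / d\<^sup>2"
    using reals_Archimedean2 by blast
  define M where "M = real (2 ^ n)"
  have M: "M \<ge> 1" "M > (1 + 2 * \<bar>b\<bar>) / d\<^sup>2"
    using n less_trans[OF n, of M] of_nat_less_iff[of n "2 ^ n", where ?'a = real] less_exp[of n]
    by (simp_all add: M_def)
  have "M * (1 + 2 * \<bar>b\<bar>) < M * (M * d\<^sup>2)"
    using M d by (intro mult_strict_left_mono) (auto simp: field_simps)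
  also have "\<dots> \<le> 1 + 2 * M * b"
    using bound[of n] by (simp add: M_def power_mult_distrib power2_eq_square mult_ac)
  also have "\<dots> \<le> M + 2 * M * \<bar>b\<bar>"
    using M by (intro add_mono mult_left_mono) auto
  finally show False
    by (simp add: algebra_simps)
qed

text \<open>
  If \<open>k l = 0\<close> then \<open>k (1 - k - l)\<^sup>j = k (1 - k)\<^sup>j\<close>, so the powers of \<open>1 - k\<close> grow at most linearly.
\<close>
lemma cstar_pos_of_orthogonal:
  fixes k l :: "'a::unital_cstar_algebra"
  assumes sk: "star k = k" and kl: "k * l = 0"
    and pos: "cstar_pos (k + l)" and small: "norm (k + l) \<le> 1"
  shows "cstar_pos k"
proof -
  define y where "y = 1 - (k + l)"
  have ny: "norm y \<le> 1"
    using cstar_pos_norm_le[OF pos, of 1] small by (simp add: y_def)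
  have ky: "k * y ^ j = k * (1 - k) ^ j" for j
  proof (induction j)
    case (Suc j)
    have y: "k * y = (1 - k) * k"
      by (simp add: y_def algebra_simps kl)
    have "k * y ^ Suc j = (1 - k) * (k * y ^ j)"
      by (simp add: y flip: mult.assoc)
    also have "\<dots> = k * (1 - k) ^ Suc j"
      unfolding Suc by (simp add: algebra_simps)
    finally show ?case .
  qed simp
  have "norm ((1 - k) ^ j) \<le> 1 + real j * norm k" for j
  proof (induction j)
    case (Suc j)
    \<comment> \<open>Each step subtracts \<open>k * (1 - k) ^ j = k * y ^ j\<close>, whose norm is
      at most \<open>norm k\<close> because \<open>y\<close> lies in the unit ball.\<close>
    have "(1 - k) ^ Suc j = (1 - k) ^ j - k * y ^ j"
      by (simp add: ky algebra_simps)
    moreover have "norm (k * y ^ j) \<le> norm k * 1"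
      using ny norm_power_ineq[of y j] power_le_one[of "norm y" j]
      by (intro order_trans[OF norm_mult_ineq] mult_left_mono) auto
    ultimately show ?case
      using Suc norm_triangle_ineq4[of "(1 - k) ^ j" "k * y ^ j"]
      by (simp add: algebra_simps)
  qed simp
  then have "norm (1 - k) \<le> 1"
    by (intro norm_le_one_of_linear_growth) (simp_all add: star_diff sk)
  then show ?thesis
    by (auto simp: cstar_pos_def sk intro!: exI[of _ 1])
qed

text \<open>\<open>a\<close> and \<open>b\<close> are twice the real and imaginary parts of
  \<open>w\<close>; in the sum of the two products the mixed terms cancel and half of
  \<open>a * a + b * b\<close> remains.\<close>

lemma sum_star_mult_decomposition:
  fixes w :: "'a::unital_cstar_algebra"
  shows "cstar_pos (star w * w + w * star w)"
proof -
  define a b where "a = w + star w" and "b = \<i> *\<^sub>C (star w - w)"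
  have sa: "star a = a" "star b = b"
    by (simp_all add: a_def b_def star_add star_scaleC star_diff star_star add.commute
        scaleC_minus_left flip: scaleC_minus_right)
  have "a * a + b * b = 2 *\<^sub>R (star w * w + w * star w)"
    by (simp add: a_def b_def mult_scaleC_left mult_scaleC_right algebra_simps scaleC_diff_right
        scaleR_2)
  then have "star w * w + w * star w = (1/2) *\<^sub>R (a * a + b * b)"
    by simp
  then show ?thesis
    using sa by (auto intro!: cstar_pos_scaleR cstar_pos_add cstar_pos_square)
qed

text \<open>
  Kaplansky's argument without spectra: if \<open>z\<^sup>* z = - p\<close> with \<open>p = l\<^sup>2 \<ge> 0\<close> and \<open>w = z l\<close>, then
  \<open>w\<^sup>* w = - p\<^sup>2\<close> and \<open>w w\<^sup>* = - (z z\<^sup>*)\<^sup>2\<close> are both negative, whereas their sum is positive.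
\<close>
lemma star_mult_self_negative:
  fixes z :: "'a::unital_cstar_algebra"
  assumes "cstar_pos (- (star z * z))"
  shows "star z * z = 0"
proof -
  define p where "p = - (star z * z)"
  obtain l where l: "star l = l" "l * l = p"
    using cstar_pos_root[of p] assms unfolding p_def by metis
  have sp: "star p = p"
    by (simp add: p_def star_minus star_mult star_star)
  define w where "w = z * l"
  have "l * p = p * l"
    by (simp add: l(2)[symmetric] mult.assoc)
  have "star w * w = l * (star z * z) * l"
    by (simp add: w_def star_mult l mult.assoc)
  also have "\<dots> = - (p * p)"
    by (simp add: p_def l mult.assoc[symmetric] flip: l(2)) 
      (metis (no_types, lifting) \<open>l * p = p * l\<close> l(2) minus_mult_commute minus_mult_minus mult.assoc mult_minus_right p_def minus_minus)
  finally have ww: "star w * w = - (p * p)" .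
  have "w * star w = z * (l * l) * star z"
    by (simp add: w_def star_mult l(1) mult.assoc)
  also have "\<dots> = - ((z * star z) * (z * star z))"
    unfolding l(2) p_def by (simp add: mult.assoc)
  finally have "cstar_pos (- (w * star w))"
    by (simp add: cstar_pos_square star_mult star_star)
  then have "cstar_pos (star w * w)"
    using cstar_pos_add[OF _ sum_star_mult_decomposition[of w]] by fastforce
  moreover have "cstar_pos (- (star w * w))"
    using ww by (simp add: cstar_pos_square sp)
  ultimately have "p * p = 0"
    using cstar_pos_antisym ww by fastforce
  then have "p = 0"
    using norm_selfadjoint_square[OF sp] by simp
  then show ?thesis
    by (simp add: p_def)
qed

text \<open>\<open>m\<close> is the absolute value of \<open>h\<close>, and \<open>k\<close>,
  \<open>l\<close> are the negative and positive parts of \<open>h\<close>. They are orthogonal and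
  their sum is positive, so \<open>k\<close> is positive by \<open>cstar_pos_of_orthogonal\<close>.
  For \<open>z = y k\<close> this makes \<open>z* z = k h k = - k k k\<close> negative, hence zero
  by \<open>star_mult_self_negative\<close>. So \<open>k = 0\<close> and
  \<open>h = m\<close>.\<close>

lemma cstar_pos_star_mult_self_small:
  fixes y :: "'a::unital_cstar_algebra"
  assumes small: "norm y \<le> 1"
  shows "cstar_pos (star y * y)"
proof -
  define h where "h = star y * y"
  have sh: "star h = h"
    by (simp add: h_def star_mult star_star)
  have nh: "norm h \<le> 1"
    using small by (simp add: h_def cstar_identity power_le_one)
  obtain m where m: "star m = m" "m * m = h * h" "cstar_pos m" "\<And>z. z * (h * h) = h * h * z \<Longrightarrow> z * m = m * z"
    using cstar_pos_root[OF cstar_pos_square[OF sh]] by metis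
  have hm: "h * m = m * h"
    by (intro m) (simp add: mult.assoc)
  have nm: "norm m \<le> 1"
    using norm_selfadjoint_square[OF m(1)] norm_selfadjoint_square[OF sh] nh
    by (simp add: m(2))
  define k l where "k = (1/2) *\<^sub>R (m - h)" and "l = (1/2) *\<^sub>R (m + h)"
  have kl: "k * l = 0" "l * k = 0"
    by (simp_all add: k_def l_def algebra_simps hm m(2))
  have sk: "star k = k"
    by (simp add: k_def star_scaleR star_diff m sh)
  have "k + l = m"
    by (simp add: k_def l_def flip: scaleR_add_right scaleR_2)
  then have posk: "cstar_pos k"
    using m(3) nm by (intro cstar_pos_of_orthogonal[OF sk kl(1)]) (simp_all add: kl)
  have hlk: "h = l - k"
    by (simp add: k_def l_def flip: scaleR_diff_right scaleR_2)
  obtain s where s: "star s = s" "s * s = k" "\<And>z. z * k = k * z \<Longrightarrow> z * s = s * z"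
    using cstar_pos_root[OF posk] by metis
  have sk_comm: "k * s = s * k"
    by (intro s) simp
  define z where "z = y * k"
  have "star z * z = k * h * k"
    by (simp add: z_def h_def star_mult sk mult.assoc)
  also have "\<dots> = - (k * k * k)"
    by (simp add: hlk algebra_simps kl)
  also have "k * k * k = (k * s) * (k * s)"
    by (metis mult.assoc s(2) sk_comm)
  finally have zz: "star z * z = - ((k * s) * (k * s))" .
  moreover have "star (k * s) = k * s"
    by (simp add: star_mult s sk sk_comm)
  ultimately have "cstar_pos (- (star z * z))"
    by (simp add: cstar_pos_square)
  then have "star z * z = 0"
    by (rule star_mult_self_negative)
  then have "k * k * k = 0"
    using \<open>k * k * k = (k * s) * (k * s)\<close> zz by simp
  then have "(k * k) * (k * k) = 0"
    by (simp add: mult.assoc)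
  then have "k * k = 0"
    using norm_selfadjoint_square[of "k * k"] by (simp add: star_mult sk)
  then have "k = 0"
    using norm_selfadjoint_square[of k] by (simp add: sk)
  then have "h = m"
    by (simp add: k_def)
  then show ?thesis
    using m(3) by (simp add: h_def)
qed

lemma cstar_pos_star_mult_self:
  fixes y :: "'a::unital_cstar_algebra"
  shows "cstar_pos (star y * y)"
proof (cases "y = 0")
  case False
  have "cstar_pos (star (y /\<^sub>R norm y) * (y /\<^sub>R norm y))"
    using False by (intro cstar_pos_star_mult_self_small) simp
  then have "cstar_pos ((norm y)\<^sup>2 *\<^sub>R (star (y /\<^sub>R norm y) * (y /\<^sub>R norm y)))"
    by (intro cstar_pos_scaleR) auto
  moreover have "norm y * norm y * (inverse (norm y) * inverse (norm y)) = 1"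
    using False by (simp add: field_simps)
  ultimately show ?thesis
    by (simp add: star_scaleR power2_eq_square)
qed simp

lemma cstar_pos_iff:
  fixes x :: "'a::unital_cstar_algebra"
  shows "cstar_pos x \<longleftrightarrow> (\<exists>y. x = star y * y)"
  by (metis cstar_pos_root cstar_pos_star_mult_self)

lemma cstar_pos_conj:
  fixes x a :: "'a::unital_cstar_algebra"
  assumes "cstar_pos x"
  shows "cstar_pos (star a * x * a)"
proof -
  obtain y where "x = star y * y"
    using assms cstar_pos_iff by auto
  then have "star a * x * a = star (y * a) * (y * a)"
    by (simp add: star_mult mult.assoc)
  then show ?thesis
    by (simp only: cstar_pos_star_mult_self)
qed

subsection \<open>Positivity of matrices over a \<open>C\<close>*-algebra\<close>

text \<open>The inner product of the standard Hilbert module of columns over the algebra, on which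
  \<open>mv\<close> is the action of a matrix. Matrices and columns are plain functions; values at
  indices from \<open>n\<close> on are ignored.\<close>

definition ip :: "nat \<Rightarrow> (nat \<Rightarrow> 'a::unital_cstar_algebra) \<Rightarrow> (nat \<Rightarrow> 'a) \<Rightarrow> 'a" where
  "ip n a b = (\<Sum>i<n. star (a i) * b i)"

definition mv :: "nat \<Rightarrow> (nat \<Rightarrow> nat \<Rightarrow> 'a::unital_cstar_algebra) \<Rightarrow> (nat \<Rightarrow> 'a) \<Rightarrow> nat \<Rightarrow> 'a" where
  "mv n X a = (\<lambda>i. \<Sum>j<n. X i j * a j)"

definition qform :: "nat \<Rightarrow> (nat \<Rightarrow> nat \<Rightarrow> 'a::unital_cstar_algebra) \<Rightarrow> (nat \<Rightarrow> 'a) \<Rightarrow> 'a" where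
  "qform n X a = (\<Sum>i<n. \<Sum>j<n. star (a i) * X i j * a j)"

definition mpos :: "nat \<Rightarrow> (nat \<Rightarrow> nat \<Rightarrow> 'a::unital_cstar_algebra) \<Rightarrow> bool" where
  "mpos n X \<longleftrightarrow> (\<forall>a. cstar_pos (qform n X a))"

definition unit_fun :: "nat \<Rightarrow> nat \<Rightarrow> 'a::zero_neq_one" where
  "unit_fun q = (\<lambda>i. if i = q then 1 else 0)"

lemma qform_ip: "qform n X a = ip n a (mv n X a)"
  by (simp add: qform_def ip_def mv_def sum_distrib_left mult.assoc)

lemma ip_diff_left: "ip n (a - b) c = ip n a c - ip n b c"
  and ip_diff_right: "ip n c (a - b) = ip n c a - ip n c b"
  by (simp_all add: ip_def star_diff algebra_simps sum_subtractf)

lemma mv_diff: "mv n X (a - b) = mv n X a - mv n X b"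
  by (simp add: mv_def fun_eq_iff algebra_simps sum_subtractf)

lemma ip_unit_fun_left: "p < n \<Longrightarrow> ip n (unit_fun p) b = b p"
  by (simp add: ip_def unit_fun_def if_distrib if_distribR sum.delta' cong: if_cong)

lemma mv_unit_fun: "q < n \<Longrightarrow> mv n X (unit_fun q) p = X p q"
  by (simp add: mv_def unit_fun_def if_distrib if_distribR sum.delta' cong: if_cong)

lemma cstar_pos_ip_self: "cstar_pos (ip n a a)"
  by (simp add: ip_def cstar_pos_sum cstar_pos_star_mult_self)

lemma cstar_pos_ip_self_diff:
  assumes "i < n" shows "cstar_pos (ip n a a - star (a i) * a i)"
proof -
  have "ip n a a = star (a i) * a i + (\<Sum>l\<in>{..<n} - {i}. star (a l) * a l)"
    unfolding ip_def using assms by (intro sum.remove) auto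
  then show ?thesis
    by (simp add: cstar_pos_sum cstar_pos_star_mult_self)
qed

lemma cstar_pos_trans:
  fixes x :: "'a::unital_cstar_algebra"
  assumes "cstar_pos (x - y)" "cstar_pos (y - z)" shows "cstar_pos (x - z)"
  using cstar_pos_add[OF assms] by simp

text \<open>The inequality of the arithmetic and geometric means: expand the square of
  \<open>a - x b\<close> and bound \<open>star x * x\<close> by its norm.\<close>

lemma real_part_le_squares:
  fixes a x b :: "'a::unital_cstar_algebra"
  shows "cstar_pos (star a * a + (norm x)\<^sup>2 *\<^sub>R (star b * b) - (star a * x * b + star (star a * x * b)))"
proof -
  have 1: "cstar_pos (star (a - x * b) * (a - x * b))"
    by (rule cstar_pos_star_mult_self)
  have "cstar_pos (norm (star x * x) *\<^sub>R 1 - star x * x)"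
    by (rule cstar_pos_norm_diff) (simp add: star_mult star_star)
  from cstar_pos_conj[OF this, of b]
  have 2: "cstar_pos ((norm x)\<^sup>2 *\<^sub>R (star b * b) - star b * star x * (x * b))"
    by (simp add: algebra_simps cstar_identity)
  show ?thesis
    using cstar_pos_add[OF 1 2] by (simp add: star_diff star_mult star_star algebra_simps)
qed

text \<open>\<open>real_part_le_squares\<close> handles each entry separately, and each
  \<open>star (a i) * a i\<close> is at most \<open>ip n a a\<close>. The extra 1 in
  \<open>T + 1\<close> makes the constant strictly positive also for \<open>n = 0\<close>.\<close>

lemma matrix_order_unit:
  fixes X :: "nat \<Rightarrow> nat \<Rightarrow> 'a::unital_cstar_algebra"
  obtains t :: real where "t > 0"
    "\<And>a. cstar_pos (t *\<^sub>R ip n a a - (qform n X a + star (qform n X a)))"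
proof -
  define T where "T = (\<Sum>i<n. \<Sum>j<n. 1 + (norm (X i j))\<^sup>2)"
  have T: "T \<ge> 0"
    by (auto simp: T_def intro!: sum_nonneg)
  have "cstar_pos ((T + 1) *\<^sub>R ip n a a - (qform n X a + star (qform n X a)))" for a
  proof -
    define s where "s i j = star (a i) * X i j * a j" for i j
    have "cstar_pos ((1 + (norm (X i j))\<^sup>2) *\<^sub>R ip n a a - (s i j + star (s i j)))"
      if "i < n" "j < n" for i j
    proof -
      have "cstar_pos (ip n a a - star (a i) * a i)"
        and "cstar_pos ((norm (X i j))\<^sup>2 *\<^sub>R (ip n a a - star (a j) * a j))"
        using that by (auto intro!: cstar_pos_ip_self_diff cstar_pos_scaleR)
      from cstar_pos_add[OF cstar_pos_add[OF this] real_part_le_squares[of "a i" "X i j" "a j"]]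
      show ?thesis
        by (simp add: s_def algebra_simps)
    qed
    then have "cstar_pos (\<Sum>i<n. \<Sum>j<n. (1 + (norm (X i j))\<^sup>2) *\<^sub>R ip n a a - (s i j + star (s i j)))"
      by (intro cstar_pos_sum) auto
    also have "(\<Sum>i<n. \<Sum>j<n. (1 + (norm (X i j))\<^sup>2) *\<^sub>R ip n a a - (s i j + star (s i j)))
       = T *\<^sub>R ip n a a - (qform n X a + star (qform n X a))"
    proof -
      have "T *\<^sub>R ip n a a = (\<Sum>i<n. \<Sum>j<n. (1 + (norm (X i j))\<^sup>2) *\<^sub>R ip n a a)"
        by (simp only: T_def scaleR_sum_left)
      then show ?thesis
        by (simp only: sum_subtractf sum.distrib qform_def s_def star_sum)
    qed
    finally show ?thesis
      using cstar_pos_add[OF _ cstar_pos_ip_self[of n a]] by (fastforce simp: algebra_simps)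
  qed
  then show thesis
    using that[of "T + 1"] T by simp
qed

lemma qform_pair:
  assumes "i < n" "j < n" "i \<noteq> j"
  shows "qform n X (\<lambda>l. if l = i then x else if l = j then y else 0)
    = star x * X i i * x + star x * X i j * y + star y * X j i * x + star y * X j j * y"
proof -
  let ?a = "\<lambda>l. if l = i then x else if l = j then y else 0"
  have *: "(\<Sum>l<n. f l (?a l)) = f i x + f j y" if "\<And>l. f l 0 = 0" for f :: "nat \<Rightarrow> 'a \<Rightarrow> 'a"
  proof -
    have "(\<Sum>l<n. f l (?a l)) = (\<Sum>l\<in>{i, j}. f l (?a l))"
      using assms that by (intro sum.mono_neutral_right) auto
    then show ?thesis
      using assms(3) by simp
  qed
  have "qform n X ?a = (\<Sum>l<n. star (?a l) * X l i * x + star (?a l) * X l j * y)"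
    unfolding qform_def by (intro sum.cong refl *) simp
  also have "\<dots> = (star x * X i i * x + star x * X i j * y) + (star y * X j i * x + star y * X j j * y)"
    by (rule *) simp
  finally show ?thesis
    by (simp add: add.assoc)
qed

lemma qform_single:
  assumes "i < n"
  shows "qform n X (unit_fun i) = X i i"
  using assms by (simp add: qform_ip ip_unit_fun_left mv_unit_fun)

text \<open>Polarization: columns supported on two indices with entries 1, 1 and 1, i give the sum
  and the difference of the two identities wanted.\<close>

lemma hermitian_of_qform:
  fixes X :: "nat \<Rightarrow> nat \<Rightarrow> 'a::unital_cstar_algebra"
  assumes sa: "\<And>a. star (qform n X a) = qform n X a" and "i < n" "j < n"
  shows "star (X j i) = X i j"
proof (cases "i = j")
  case True
  then show ?thesis
    using sa[of "unit_fun i"] assms by (simp add: qform_single)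
next
  case False
  have d: "star (X l l) = X l l" if "l < n" for l
    using sa[of "unit_fun l"] that by (simp add: qform_single)
  have "star (X i j) + star (X j i) = X i j + X j i"
    using sa[of "\<lambda>l. if l = i then 1 else if l = j then 1 else 0"] assms False d
    by (simp add: qform_pair star_add)
  moreover have "qform n X (\<lambda>l. if l = i then 1 else if l = j then \<i> *\<^sub>C 1 else 0)
      = X i i + \<i> *\<^sub>C X i j - \<i> *\<^sub>C X j i + X j j"
    using assms False
    by (simp add: qform_pair star_scaleC mult_scaleC_left mult_scaleC_right scaleC_minus_left
        scaleC_minus_right)
  then have "\<i> *\<^sub>C (star (X j i) - star (X i j)) = \<i> *\<^sub>C (X i j - X j i)"
    using sa[of "\<lambda>l. if l = i then 1 else if l = j then \<i> *\<^sub>C 1 else 0"] assms d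
    by (simp add: star_add star_diff star_scaleC scaleC_minus_left scaleC_diff_right)
  then have "star (X j i) - star (X i j) = X i j - X j i"
    by (metis scaleC_ii_scaleC_ii minus_minus)
  ultimately have "(star (X i j) + star (X j i)) + (star (X j i) - star (X i j))
      = (X i j + X j i) + (X i j - X j i)"
    by (simp only:)
  then have "2 *\<^sub>R star (X j i) = 2 *\<^sub>R X i j"
    by (simp add: scaleR_2)
  then show ?thesis
    by simp
qed

lemma mpos_hermitian: "mpos n X \<Longrightarrow> i < n \<Longrightarrow> j < n \<Longrightarrow> star (X j i) = X i j"
  by (rule hermitian_of_qform) (auto simp: mpos_def cstar_pos_star)

lemma ip_mv_hermitian:
  assumes "\<And>i j. i < n \<Longrightarrow> j < n \<Longrightarrow> star (X j i) = X i j"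
  shows "ip n (mv n X a) b = ip n a (mv n X b)"
proof -
  have "ip n (mv n X a) b = (\<Sum>i<n. \<Sum>j<n. star (a j) * X j i * b i)"
    unfolding ip_def mv_def
    using assms by (auto intro!: sum.cong simp: star_sum star_mult sum_distrib_right)
  also have "\<dots> = (\<Sum>j<n. \<Sum>i<n. star (a j) * X j i * b i)"
    by (rule sum.swap)
  finally show ?thesis
    by (simp add: ip_def mv_def sum_distrib_left mult.assoc)
qed

section \<open>The square root of 1 - C for a matrix with 0 <= C <= 1\<close>

context
  fixes n :: nat and C :: "nat \<Rightarrow> nat \<Rightarrow> 'a::unital_cstar_algebra"
  assumes C_pos: "mpos n C"
    and C_le_1: "\<And>a. cstar_pos (ip n a a - qform n C a)"
begin

lemma ip_mv_C: "ip n (mv n C a) b = ip n a (mv n C b)"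
  by (rule ip_mv_hermitian) (rule mpos_hermitian[OF C_pos])

text \<open>Uses \<open>C - C\<^sup>2 = C (1 - C) C + (1 - C) C (1 - C)\<close>.\<close>
lemma contraction: "cstar_pos (ip n a a - ip n (mv n C a) (mv n C a))"
proof -
  define b where "b = mv n C a"
  have 1: "cstar_pos (ip n (a - b) (mv n C (a - b)))"
    using C_pos by (simp add: mpos_def qform_ip)
  have 2: "cstar_pos (ip n b b - ip n b (mv n C b))"
    using C_le_1[of b] by (simp add: qform_ip)
  have 3: "cstar_pos (ip n a a - ip n a b)"
    using C_le_1[of a] by (simp add: qform_ip b_def)
  have "ip n a (mv n C b) = ip n b b"
    by (simp add: b_def ip_mv_C)
  then have *: "ip n a a - ip n b b = ip n (a - b) (mv n C (a - b))
      + (ip n b b - ip n b (mv n C b)) + (ip n a a - ip n a b)"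
    by (simp add: mv_diff ip_diff_left ip_diff_right flip: b_def)
  show ?thesis
    unfolding b_def[symmetric] * by (intro cstar_pos_add 1 2 3)
qed

lemma contraction_power:
  "cstar_pos (ip n a a - ip n ((mv n C ^^ j) a) ((mv n C ^^ j) a))"
proof (induction j)
  case (Suc j)
  show ?case
    using cstar_pos_trans[OF Suc contraction] by simp
qed simp

lemma ip_power: "ip n ((mv n C ^^ j) a) b = ip n a ((mv n C ^^ j) b)"
  by (induction j arbitrary: a) (simp_all add: ip_mv_C funpow_swap1)

text \<open>The matrices carry no norm here. Bounded entries of all powers of \<open>C\<close> are
  what makes the square root series converge entry by entry; they hold because powers of
  \<open>C\<close> do not increase \<open>ip\<close>.\<close>

lemma norm_power_entry:
  assumes "p < n" "q < n"
  shows "norm ((mv n C ^^ j) (unit_fun q) p) \<le> 1"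
proof -
  define y where "y = (mv n C ^^ j) (unit_fun q)"
  have "cstar_pos (ip n (unit_fun q) (unit_fun q) - star (y p) * y p)"
    by (rule cstar_pos_trans[OF contraction_power[of "unit_fun q" j]])
      (simp add: y_def cstar_pos_ip_self_diff assms)
  then have "cstar_pos (1 *\<^sub>R 1 - star (y p) * y p)"
    using assms by (simp add: ip_unit_fun_left) (simp add: unit_fun_def)
  then have "norm (star (y p) * y p) \<le> 1"
    by (intro norm_le_of_cstar_pos cstar_pos_star_mult_self) auto
  then have "norm (y p) \<le> 1"
    by (simp add: cstar_identity abs_square_le_1)
  then show ?thesis
    by (simp add: y_def)
qed

text \<open>\<open>Y\<close> is the square root series applied to the unit columns. Since
  \<open>C\<close> is Hermitian, the inner product of the \<open>i\<close>-th and
  \<open>(m - i)\<close>-th terms only involves the power \<open>m\<close>, and the Cauchy product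
  collapses as in the scalar case.\<close>

lemma sqrt_matrix:
  obtains Y where "\<And>p q. p < n \<Longrightarrow> q < n \<Longrightarrow> (\<Sum>l<n. star (Y l p) * Y l q) = unit_fun q p - C p q"
proof -
  define g where "g q l j = sqrt_coeff j *\<^sub>R (mv n C ^^ j) (unit_fun q) l" for q l j
  define Y where "Y l q = (\<Sum>j. g q l j)" for l q
  have summ: "summable (\<lambda>j. norm (g q l j))" if "q < n" "l < n" for q l
  proof (rule summable_comparison_test'[OF summable_abs_sqrt_coeff, of 0])
    fix j :: nat
    show "norm (norm (g q l j)) \<le> \<bar>sqrt_coeff j\<bar>"
      using norm_power_entry[OF that(2,1), of j] by (simp add: g_def mult_left_le)
  qed
  have "(\<Sum>l<n. star (Y l p) * Y l q) = unit_fun q p - C p q" if pq: "p < n" "q < n" for p q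
  proof -
    have "(\<lambda>m. \<Sum>i\<le>m. star (g p l i) * g q l (m - i)) sums (star (Y l p) * Y l q)" if "l < n" for l
    proof -
      have "star (Y l p) = (\<Sum>j. star (g p l j))"
        using bounded_linear.suminf[OF bounded_linear_star summable_norm_cancel[OF summ[OF pq(1) that]]]
        by (simp add: Y_def)
      then show ?thesis
        using Cauchy_product_sums[of "\<lambda>j. star (g p l j)" "g q l"] summ pq that
        by (simp add: Y_def)
    qed
    then have "(\<lambda>m. \<Sum>l<n. \<Sum>i\<le>m. star (g p l i) * g q l (m - i)) sums (\<Sum>l<n. star (Y l p) * Y l q)"
      by (intro sums_sum) auto
    moreover have "(\<Sum>l<n. \<Sum>i\<le>m. star (g p l i) * g q l (m - i))
       = (if m = 0 then unit_fun q p else if m = 1 then - C p q else 0)" for m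
    proof -
      have "(\<Sum>l<n. \<Sum>i\<le>m. star (g p l i) * g q l (m - i))
         = (\<Sum>i\<le>m. \<Sum>l<n. star (g p l i) * g q l (m - i))"
        by (rule sum.swap)
      also have "\<dots> = (\<Sum>i\<le>m. (sqrt_coeff i * sqrt_coeff (m - i)) *\<^sub>R
          ip n ((mv n C ^^ i) (unit_fun p)) ((mv n C ^^ (m - i)) (unit_fun q)))"
        by (simp add: g_def ip_def star_scaleR scaleR_sum_right mult.commute)
      also have "\<dots> = (\<Sum>i\<le>m. (sqrt_coeff i * sqrt_coeff (m - i)) *\<^sub>R (mv n C ^^ m) (unit_fun q) p)"
      proof (intro sum.cong refl)
        fix i assume "i \<in> {..m}"
        then have "(mv n C ^^ i) ((mv n C ^^ (m - i)) (unit_fun q)) = (mv n C ^^ m) (unit_fun q)"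
          by (metis atMost_iff comp_apply funpow_add le_add_diff_inverse)
        then show "(sqrt_coeff i * sqrt_coeff (m - i)) *\<^sub>R
            ip n ((mv n C ^^ i) (unit_fun p)) ((mv n C ^^ (m - i)) (unit_fun q))
          = (sqrt_coeff i * sqrt_coeff (m - i)) *\<^sub>R (mv n C ^^ m) (unit_fun q) p"
          using pq by (simp add: ip_power ip_unit_fun_left)
      qed
      also have "\<dots> = (if m = 0 then 1 else if m = 1 then -1 else 0) *\<^sub>R (mv n C ^^ m) (unit_fun q) p"
        unfolding sqrt_coeff_convolution[symmetric] by (simp add: scaleR_sum_left)
      finally show ?thesis
        using pq by (auto simp: mv_unit_fun)
    qed
    ultimately have "(\<lambda>m. if m = 0 then unit_fun q p else if m = 1 then - C p q else 0) sums
        (\<Sum>l<n. star (Y l p) * Y l q)"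
      by simp
    moreover have "(\<lambda>m. if m = 0 then unit_fun q p else if m = 1 then - C p q else 0) sums
        (\<Sum>m\<in>{0,1}. if m = 0 then unit_fun q p else if m = (1::nat) then - C p q else 0)"
      by (rule sums_finite) auto
    ultimately have "(\<Sum>l<n. star (Y l p) * Y l q) = (\<Sum>m\<in>{0,1}. if m = 0 then unit_fun q p else if m = (1::nat) then - C p q else 0)"
      by (rule sums_unique2)
    then show ?thesis
      by simp
  qed
  then show thesis
    by (rule that)
qed

end

text \<open>The matrix \<open>C = 1 - X / t\<close> lies between 0 and 1 for \<open>t\<close> large,
  so \<open>sqrt_matrix\<close> factors \<open>X / t\<close>.\<close>

lemma mpos_factorization:
  assumes "mpos n X"
  obtains Y where "\<And>p q. p < n \<Longrightarrow> q < n \<Longrightarrow> (\<Sum>l<n. star (Y l p) * Y l q) = X p q"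
proof -
  obtain t where t: "t > 0" "\<And>a. cstar_pos (t *\<^sub>R ip n a a - (qform n X a + star (qform n X a)))"
    using matrix_order_unit[of n X] by blast
  have qX: "cstar_pos (qform n X a)" for a
    using assms by (simp add: mpos_def)
  define C where "C i j = unit_fun j i - X i j /\<^sub>R t" for i j
  have qC: "qform n C a = ip n a a - qform n X a /\<^sub>R t" for a
  proof -
    have "(\<Sum>j<n. star (a i) * unit_fun j i * a j) = star (a i) * a i" if "i < n" for i
      using that by (simp add: unit_fun_def if_distrib if_distribR sum.delta cong: if_cong)
    then show ?thesis
      by (simp add: qform_def C_def ip_def algebra_simps sum_subtractf scaleR_sum_right)
  qed
  have "mpos n C"
    unfolding mpos_def
  proof
    fix a
    \<comment> \<open>\<open>t\<close> dominates the sum of \<open>X\<close> and its adjoint, here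
      \<open>2 X\<close>; adding \<open>X\<close> back leaves \<open>t - X\<close>.\<close>
    have "cstar_pos ((t *\<^sub>R ip n a a - (qform n X a + star (qform n X a))) + qform n X a)"
      by (intro cstar_pos_add t qX)
    then have "cstar_pos (inverse t *\<^sub>R (t *\<^sub>R ip n a a - qform n X a))"
      using t(1) by (intro cstar_pos_scaleR) (simp_all add: cstar_pos_star[OF qX])
    then show "cstar_pos (qform n C a)"
      using t(1) by (simp add: qC scaleR_diff_right)
  qed
  moreover have "cstar_pos (ip n a a - qform n C a)" for a
    using cstar_pos_scaleR[OF qX, of "inverse t" a] t(1) by (simp add: qC)
  ultimately obtain Y where Y: "\<And>p q. p < n \<Longrightarrow> q < n \<Longrightarrow> (\<Sum>l<n. star (Y l p) * Y l q) = unit_fun q p - C p q"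
    using sqrt_matrix by blast
  show thesis
  proof (rule that[of "\<lambda>l p. sqrt t *\<^sub>R Y l p"])
    fix p q assume "p < n" "q < n"
    then show "(\<Sum>l<n. star (sqrt t *\<^sub>R Y l p) * sqrt t *\<^sub>R Y l q) = X p q"
      using t(1) Y[of p q] by (simp add: star_scaleR C_def flip: scaleR_sum_right)
  qed
qed

lemma mat_positive_iff_mpos:
  assumes X: "X \<in> carrier_mat n n"
  shows "mat_positive n X \<longleftrightarrow> mpos n (\<lambda>i j. X $$ (i, j))"
proof
  assume "mat_positive n X"
  then obtain Y where Y: "Y \<in> carrier_mat n n" "X = mat_star Y * Y"
    by (auto simp: mat_positive_def)
  have XY: "X $$ (i, j) = (\<Sum>l<n. star (Y $$ (l, i)) * Y $$ (l, j))" if "i < n" "j < n" for i j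
    using Y that by (simp add: mat_star_def scalar_prod_def atLeast0LessThan)
  have "qform n (\<lambda>i j. X $$ (i, j)) a
      = (\<Sum>l<n. star (\<Sum>i<n. Y $$ (l, i) * a i) * (\<Sum>j<n. Y $$ (l, j) * a j))" for a
  proof -
    have "qform n (\<lambda>i j. X $$ (i, j)) a
       = (\<Sum>i<n. \<Sum>j<n. \<Sum>l<n. star (a i) * star (Y $$ (l, i)) * (Y $$ (l, j) * a j))"
      by (simp add: qform_def XY sum_distrib_left sum_distrib_right mult.assoc)
    also have "\<dots> = (\<Sum>i<n. \<Sum>l<n. \<Sum>j<n. star (a i) * star (Y $$ (l, i)) * (Y $$ (l, j) * a j))"
      by (intro sum.cong refl sum.swap)
    also have "\<dots> = (\<Sum>l<n. \<Sum>i<n. \<Sum>j<n. star (a i) * star (Y $$ (l, i)) * (Y $$ (l, j) * a j))"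
      by (rule sum.swap)
    finally show ?thesis
      by (simp add: star_sum star_mult sum_product)
  qed
  then show "mpos n (\<lambda>i j. X $$ (i, j))"
    by (simp add: mpos_def cstar_pos_sum cstar_pos_star_mult_self)
next
  assume "mpos n (\<lambda>i j. X $$ (i, j))"
  then obtain Y where Y: "\<And>p q. p < n \<Longrightarrow> q < n \<Longrightarrow> (\<Sum>l<n. star (Y l p) * Y l q) = X $$ (p, q)"
    using mpos_factorization by blast
  define Y' where "Y' = mat n n (\<lambda>(l, p). Y l p)"
  have "X = mat_star Y' * Y'"
    using X Y by (intro eq_matI) (auto simp: Y'_def mat_star_def scalar_prod_def atLeast0LessThan)
  then show "mat_positive n X"
    unfolding mat_positive_def by (intro bexI[of _ Y']) (auto simp: Y'_def)
qed

subsection \<open>Pure functionals on ordered vector spaces\<close>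

text \<open>Applied twice, this makes matrices, as functions of two indices, a real vector
  space.\<close>

instantiation "fun" :: (type, real_vector) real_vector
begin

definition scaleR_fun :: "real \<Rightarrow> ('a \<Rightarrow> 'b) \<Rightarrow> 'a \<Rightarrow> 'b" where
  "scaleR_fun r f = (\<lambda>x. r *\<^sub>R f x)"

instance
  by standard (simp_all add: scaleR_fun_def fun_eq_iff scaleR_add_left scaleR_add_right)

end

lemma scaleR_fun_apply [simp]: "(r *\<^sub>R f) x = r *\<^sub>R f x"
  by (simp add: scaleR_fun_def)

definition linear_functional_on :: "'v::real_vector set \<Rightarrow> ('v \<Rightarrow> real) \<Rightarrow> bool" where
  "linear_functional_on V f \<longleftrightarrow>
     (\<forall>x\<in>V. \<forall>y\<in>V. f (x + y) = f x + f y) \<and> (\<forall>r. \<forall>x\<in>V. f (r *\<^sub>R x) = r * f x)"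

definition sublinear_on :: "'v::real_vector set \<Rightarrow> ('v \<Rightarrow> real) \<Rightarrow> bool" where
  "sublinear_on V q \<longleftrightarrow>
     (\<forall>x\<in>V. \<forall>y\<in>V. q (x + y) \<le> q x + q y) \<and> (\<forall>r\<ge>0. \<forall>x\<in>V. q (r *\<^sub>R x) = r * q x)"

lemma sublinear_onD:
  assumes "sublinear_on V q"
  shows "x \<in> V \<Longrightarrow> y \<in> V \<Longrightarrow> q (x + y) \<le> q x + q y"
    and "x \<in> V \<Longrightarrow> 0 \<le> r \<Longrightarrow> q (r *\<^sub>R x) = r * q x"
  using assms by (auto simp: sublinear_on_def)

lemma linear_functional_onD:
  assumes "linear_functional_on V f"
  shows "x \<in> V \<Longrightarrow> y \<in> V \<Longrightarrow> f (x + y) = f x + f y"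
    and "x \<in> V \<Longrightarrow> f (r *\<^sub>R x) = r * f x"
    and "x \<in> V \<Longrightarrow> f (- x) = - f x"
  using assms scaleR_minus_left[of 1 x] unfolding linear_functional_on_def
  by (auto, metis mult_minus1 scaleR_minus1_left)

text \<open>
  The greatest sublinear functional below \<open>q\<close> whose supporting linear functionals all attain \<open>q x\<close>
  at \<open>x\<close>: the support function of an exposed face of \<open>{f. f \<le> q}\<close>.
\<close>
definition exposed :: "'v::real_vector set \<Rightarrow> ('v \<Rightarrow> real) \<Rightarrow> 'v \<Rightarrow> 'v \<Rightarrow> real" where
  "exposed V q x y = (if y \<in> V then INF t\<in>{0..}. q (y + t *\<^sub>R x) - t * q x else 0)"

text \<open>\<open>proper\<close> bounds the gauge below. The cone may contain lines: the cone of
  matrices to which this is applied contains every skew-adjoint matrix together with its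
  negative.\<close>

locale order_unit_cone =
  fixes V C :: "'v::real_vector set" and e :: 'v
  assumes subspace_V: "subspace V"
    and C_sub: "C \<subseteq> V"
    and C_add: "\<And>x y. x \<in> C \<Longrightarrow> y \<in> C \<Longrightarrow> x + y \<in> C"
    and C_scale: "\<And>r x. 0 \<le> r \<Longrightarrow> x \<in> C \<Longrightarrow> r *\<^sub>R x \<in> C"
    and e_C: "e \<in> C"
    and order_unit: "\<And>x. x \<in> V \<Longrightarrow> \<exists>t. t *\<^sub>R e - x \<in> C"
    and proper: "- e \<notin> C"
begin

lemmas V_add = subspace_add[OF subspace_V]
  and V_scale = subspace_scale[OF subspace_V]
  and V_neg = subspace_neg[OF subspace_V]
  and V_0 = subspace_0[OF subspace_V]

lemma e_V: "e \<in> V"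
  using C_sub e_C by auto

lemma sublinear_0: "sublinear_on V q \<Longrightarrow> q 0 = 0"
  using sublinear_onD(2)[of V q 0 0] V_0 by simp

lemma sublinear_neg: "sublinear_on V q \<Longrightarrow> x \<in> V \<Longrightarrow> - q (- x) \<le> q x"
  using sublinear_onD(1)[of V q x "- x"] sublinear_0[of q] V_neg by simp

text \<open>The support function of the state space: the linear functionals below
  \<open>gauge\<close> are exactly the positive ones with value 1 at \<open>e\<close>.\<close>

definition gauge :: "'v \<Rightarrow> real" where
  "gauge x = Inf {t. t *\<^sub>R e - x \<in> C}"

lemma C_multiple_e: "r *\<^sub>R e \<in> C \<Longrightarrow> 0 \<le> r"
proof (rule ccontr)
  assume "r *\<^sub>R e \<in> C" "\<not> 0 \<le> r"
  then have "(1 / (- r)) *\<^sub>R (r *\<^sub>R e) \<in> C"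
    using C_scale[of "1 / (- r)" "r *\<^sub>R e"] by (simp del: scaleR_scaleR)
  then show False
    using proper \<open>\<not> 0 \<le> r\<close> by simp
qed

lemma gauge_bdd:
  assumes "x \<in> V" shows "bdd_below {t. t *\<^sub>R e - x \<in> C}"
proof -
  obtain s where s: "s *\<^sub>R e - (- x) \<in> C"
    using order_unit[OF V_neg[OF assms]] by blast
  show ?thesis
  proof (rule bdd_belowI[of _ "- s"])
    fix t assume "t \<in> {t. t *\<^sub>R e - x \<in> C}"
    then have "(t + s) *\<^sub>R e \<in> C"
      using C_add[OF _ s, of "t *\<^sub>R e - x"] by (simp add: algebra_simps)
    then show "- s \<le> t"
      using C_multiple_e by fastforce
  qed
qed

lemma gauge_le: "x \<in> V \<Longrightarrow> t *\<^sub>R e - x \<in> C \<Longrightarrow> gauge x \<le> t"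
  unfolding gauge_def by (rule cInf_lower) (auto intro: gauge_bdd)

lemma gauge_greatest:
  "x \<in> V \<Longrightarrow> (\<And>t. t *\<^sub>R e - x \<in> C \<Longrightarrow> z \<le> t) \<Longrightarrow> z \<le> gauge x"
  unfolding gauge_def using order_unit by (intro cInf_greatest) auto

lemma gauge_sublinear: "sublinear_on V gauge"
proof -
  have add: "gauge (x + y) \<le> gauge x + gauge y" if "x \<in> V" "y \<in> V" for x y
  proof -
    have *: "gauge (x + y) \<le> s + t" if "s *\<^sub>R e - x \<in> C" "t *\<^sub>R e - y \<in> C" for s t
      using C_add[OF that] \<open>x \<in> V\<close> \<open>y \<in> V\<close> by (intro gauge_le V_add) (simp_all add: algebra_simps)
    have "gauge (x + y) - s \<le> gauge y" if "s *\<^sub>R e - x \<in> C" for s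
      using *[OF that] \<open>y \<in> V\<close> by (intro gauge_greatest) (simp_all add: diff_le_eq add.commute)
    then have "gauge (x + y) - gauge y \<le> gauge x"
      using \<open>x \<in> V\<close> by (intro gauge_greatest) (simp_all add: diff_le_eq add.commute)
    then show ?thesis
      by simp
  qed
  have le: "gauge (r *\<^sub>R x) \<le> r * gauge x" if "x \<in> V" "r > 0" for r x
  proof -
    have "gauge (r *\<^sub>R x) / r \<le> gauge x"
    proof (rule gauge_greatest[OF \<open>x \<in> V\<close>])
      fix t assume "t *\<^sub>R e - x \<in> C"
      from C_scale[OF _ this, of r] have "(r * t) *\<^sub>R e - r *\<^sub>R x \<in> C"
        using that by (simp add: algebra_simps)
      then have "gauge (r *\<^sub>R x) \<le> r * t"
        by (intro gauge_le V_scale that)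
      then show "gauge (r *\<^sub>R x) / r \<le> t"
        using that by (simp add: field_simps)
    qed
    then show ?thesis
      using that by (simp add: field_simps)
  qed
  have "gauge (r *\<^sub>R x) = r * gauge x" if "x \<in> V" "r > 0" for r x
    using le[OF that] le[of "r *\<^sub>R x" "1 / r"] that
    by (simp add: V_scale field_simps)
  moreover have "gauge 0 = 0"
  proof (rule antisym)
    show "gauge 0 \<le> 0"
      using C_scale[OF _ e_C, of 0] by (intro gauge_le V_0) simp
    show "0 \<le> gauge 0"
      by (intro gauge_greatest V_0) (simp add: C_multiple_e)
  qed
  ultimately show ?thesis
    unfolding sublinear_on_def using add by (metis less_eq_real_def mult_zero_left scaleR_zero_left)
qed

definition positive_functional :: "('v \<Rightarrow> real) \<Rightarrow> bool" where
  "positive_functional g \<longleftrightarrow> linear_functional_on V g \<and> (\<forall>x\<in>C. 0 \<le> g x)"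

lemma positive_le_gauge:
  assumes "positive_functional g" "x \<in> V"
  shows "g x \<le> g e * gauge x"
proof -
  have lin: "linear_functional_on V g"
    using assms by (simp add: positive_functional_def)
  have le: "g x \<le> t * g e" if "t *\<^sub>R e - x \<in> C" for t
  proof -
    have "0 \<le> g (t *\<^sub>R e + (- x))"
      using that assms by (auto simp: positive_functional_def)
    also have "\<dots> = t * g e - g x"
      using assms(2) by (simp add: linear_functional_onD[OF lin] V_scale V_neg e_V del: add_uminus_conv_diff)
    finally show ?thesis
      by simp
  qed
  have "0 \<le> g e"
    using assms e_C by (auto simp: positive_functional_def)
  show ?thesis
  proof (cases "g e = 0")
    case True
    then show ?thesis
      using order_unit[OF assms(2)] le by force
  next
    case False
    then have "g x / g e \<le> gauge x"
      using \<open>0 \<le> g e\<close> le assms(2) by (intro gauge_greatest) (auto simp: field_simps)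
    then show ?thesis
      using False \<open>0 \<le> g e\<close> by (simp add: field_simps)
  qed
qed

text \<open>The positive functionals below \<open>q\<close> form a face of the state space.\<close>
definition facial :: "('v \<Rightarrow> real) \<Rightarrow> bool" where
  "facial q \<longleftrightarrow> (\<forall>g h. positive_functional g \<longrightarrow> positive_functional h \<longrightarrow>
     (\<forall>x\<in>V. g x + h x \<le> q x) \<longrightarrow> (\<forall>x\<in>V. g x \<le> g e * q x))"

lemma facialD:
  assumes "facial q" "positive_functional g" "positive_functional h"
    "\<And>x. x \<in> V \<Longrightarrow> g x + h x \<le> q x" "x \<in> V"
  shows "g x \<le> g e * q x" "h x \<le> h e * q x"
  using assms unfolding facial_def by (blast, metis add.commute)

lemma facial_gauge: "facial gauge"
  by (simp add: facial_def positive_le_gauge)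

text \<open>The bound does not depend on \<open>t\<close>, so the infimum in \<open>exposed\<close>
  is finite.\<close>

lemma exposed_bound:
  assumes "sublinear_on V q" "x \<in> V" "y \<in> V" "0 \<le> t"
  shows "- q (- y) \<le> q (y + t *\<^sub>R x) - t * q x"
proof -
  have "q (t *\<^sub>R x) \<le> q (y + t *\<^sub>R x) + q (- y)"
    using sublinear_onD(1)[OF assms(1), of "y + t *\<^sub>R x" "- y"] assms
    by (simp add: V_add V_scale V_neg)
  then show ?thesis
    using sublinear_onD(2)[OF assms(1,2,4)] by simp
qed

lemma exposed_le:
  assumes "sublinear_on V q" "x \<in> V" "y \<in> V" "0 \<le> t"
  shows "exposed V q x y \<le> q (y + t *\<^sub>R x) - t * q x"
  unfolding exposed_def using assms
  by (auto intro!: cINF_lower bdd_belowI2[of _ "- q (- y)"] exposed_bound)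

lemma exposed_greatest:
  "y \<in> V \<Longrightarrow> (\<And>t. 0 \<le> t \<Longrightarrow> z \<le> q (y + t *\<^sub>R x) - t * q x) \<Longrightarrow> z \<le> exposed V q x y"
  unfolding exposed_def by (auto intro!: cINF_greatest)

lemma exposed_le_self:
  "sublinear_on V q \<Longrightarrow> x \<in> V \<Longrightarrow> y \<in> V \<Longrightarrow> exposed V q x y \<le> q y"
  using exposed_le[of q x y 0] by simp

text \<open>Applied to a linear functional below \<open>exposed V q x\<close>, this forces the value
  at \<open>x\<close> up to \<open>q x\<close>.\<close>

lemma exposed_neg:
  "sublinear_on V q \<Longrightarrow> x \<in> V \<Longrightarrow> exposed V q x (- x) \<le> - q x"
  using exposed_le[of q x "- x" 1] by (simp add: V_neg sublinear_0)

lemma exposed_sublinear: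
  assumes "sublinear_on V q" "x \<in> V"
  shows "sublinear_on V (exposed V q x)"
proof -
  let ?D = "exposed V q x"
  have add: "?D (y + z) \<le> ?D y + ?D z" if "y \<in> V" "z \<in> V" for y z
  proof -
    have *: "?D (y + z) \<le> (q (y + s *\<^sub>R x) - s * q x) + (q (z + t *\<^sub>R x) - t * q x)"
      if "0 \<le> s" "0 \<le> t" for s t
    proof -
      have "?D (y + z) \<le> q ((y + z) + (s + t) *\<^sub>R x) - (s + t) * q x"
        using that \<open>y \<in> V\<close> \<open>z \<in> V\<close> assms by (intro exposed_le) (simp_all add: V_add)
      also have "(y + z) + (s + t) *\<^sub>R x = (y + s *\<^sub>R x) + (z + t *\<^sub>R x)"
        by (simp add: algebra_simps)
      also have "q \<dots> \<le> q (y + s *\<^sub>R x) + q (z + t *\<^sub>R x)"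
        using that \<open>y \<in> V\<close> \<open>z \<in> V\<close> assms by (intro sublinear_onD(1)[OF assms(1)]) (simp_all add: V_add V_scale)
      finally show ?thesis
        by (simp add: algebra_simps)
    qed
    have "?D (y + z) - (q (y + s *\<^sub>R x) - s * q x) \<le> ?D z" if "0 \<le> s" for s
      using *[OF that] \<open>z \<in> V\<close> by (intro exposed_greatest) (simp_all add: algebra_simps)
    then have "?D (y + z) - ?D z \<le> ?D y"
      using \<open>y \<in> V\<close> by (intro exposed_greatest) (simp_all add: algebra_simps)
    then show ?thesis
      by simp
  qed
  have le: "?D (r *\<^sub>R y) \<le> r * ?D y" if "y \<in> V" "r > 0" for r y
  proof -
    have "?D (r *\<^sub>R y) / r \<le> ?D y"
    proof (rule exposed_greatest[OF \<open>y \<in> V\<close>])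
      fix t :: real assume "0 \<le> t"
      then have "?D (r *\<^sub>R y) \<le> q (r *\<^sub>R y + (r * t) *\<^sub>R x) - (r * t) * q x"
        using that assms by (intro exposed_le) (simp_all add: V_scale)
      also have "r *\<^sub>R y + (r * t) *\<^sub>R x = r *\<^sub>R (y + t *\<^sub>R x)"
        by (simp add: algebra_simps)
      also have "q \<dots> = r * q (y + t *\<^sub>R x)"
        using that assms by (intro sublinear_onD(2)[OF assms(1)]) (simp_all add: V_add V_scale)
      finally show "?D (r *\<^sub>R y) / r \<le> q (y + t *\<^sub>R x) - t * q x"
        using that by (simp add: field_simps)
    qed
    then show ?thesis
      using that by (simp add: field_simps)
  qed
  have "?D (r *\<^sub>R y) = r * ?D y" if "y \<in> V" "r > 0" for r y
    using le[OF that] le[of "r *\<^sub>R y" "1 / r"] that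
    by (simp add: V_scale field_simps)
  moreover have "?D 0 = 0"
    using exposed_le_self[OF assms V_0] exposed_greatest[OF V_0, of 0 q x] sublinear_0[OF assms(1)]
      sublinear_onD(2)[OF assms]
    by simp
  ultimately show ?thesis
    unfolding sublinear_on_def using add by (metis less_eq_real_def mult_zero_left scaleR_zero_left)
qed

text \<open>A face of a face is a face. If \<open>g + h\<close> lies below the exposed functional,
  then \<open>g\<close> and \<open>h\<close> lie below \<open>g e * q\<close> and
  \<open>h e * q\<close>. The weights add up to 1, because \<open>q\<close> lies below the gauge,
  and \<open>g + h\<close> attains \<open>q x\<close> at \<open>x\<close>; so both bounds are
  equalities at \<open>x\<close>. Subtracting multiples of \<open>x\<close> then carries the bound
  for \<open>g\<close> over to the infimum.\<close>

lemma exposed_facial: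
  assumes q: "sublinear_on V q" and le: "\<And>y. y \<in> V \<Longrightarrow> q y \<le> gauge y" and f: "facial q"
    and x: "x \<in> V"
  shows "facial (exposed V q x)"
  unfolding facial_def
proof (intro allI impI ballI)
  fix g h y
  assume g: "positive_functional g" and h: "positive_functional h" and y: "y \<in> V"
    and gh: "\<forall>y\<in>V. g y + h y \<le> exposed V q x y"
  have lin: "linear_functional_on V g" "linear_functional_on V h"
    using g h by (auto simp: positive_functional_def)
  have ghq: "g y + h y \<le> q y" if "y \<in> V" for y
    using gh exposed_le_self[OF q x that] that by fastforce
  have fd: "g y \<le> g e * q y" "h y \<le> h e * q y" if "y \<in> V" for y
    using facialD[OF f g h ghq that] by auto
  have "gauge e \<le> 1" "gauge (- e) \<le> -1"
    using C_scale[OF _ e_C, of 0] by (auto intro!: gauge_le e_V V_neg)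
  then have "g e + h e = 1"
    using ghq[OF e_V] ghq[OF V_neg[OF e_V]] le[OF e_V] le[OF V_neg[OF e_V]]
      linear_functional_onD(3)[OF lin(1) e_V] linear_functional_onD(3)[OF lin(2) e_V]
    by linarith
  then have "g e * q x + h e * q x = q x"
    by (metis distrib_right mult_1)
  moreover have "q x \<le> g x + h x"
    using gh[rule_format, OF V_neg[OF x]] exposed_neg[OF q x]
      linear_functional_onD(3)[OF lin(1) x] linear_functional_onD(3)[OF lin(2) x]
    by linarith
  ultimately have gx: "g x = g e * q x"
    using fd[OF x] by linarith
  have *: "g y \<le> g e * (q (y + t *\<^sub>R x) - t * q x)" if "0 \<le> t" for t
  proof -
    have "g y = g (y + t *\<^sub>R x) - t * g x"
      using x y by (simp add: linear_functional_onD[OF lin(1)] V_scale)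
    also have "\<dots> \<le> g e * q (y + t *\<^sub>R x) - t * (g e * q x)"
      using fd(1)[of "y + t *\<^sub>R x"] x y gx by (simp add: V_add V_scale)
    finally show ?thesis
      by (simp add: algebra_simps)
  qed
  show "g y \<le> g e * exposed V q x y"
  proof (cases "g e = 0")
    case True
    then show ?thesis
      using *[of 0] by simp
  next
    case False
    then have "0 < g e"
      using g e_C by (force simp: positive_functional_def)
    then have "g y / g e \<le> exposed V q x y"
      using * y by (intro exposed_greatest) (auto simp: field_simps)
    then show ?thesis
      using \<open>0 < g e\<close> by (simp add: field_simps)
  qed
qed

text \<open>The value 0 outside \<open>V\<close> lets these functionals be compared as total
  functions, so that minimality gives an equality of functions.\<close>

definition facial_below :: "('v \<Rightarrow> real) \<Rightarrow> ('v \<Rightarrow> real) set" where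
  "facial_below q0 = {q. sublinear_on V q \<and> facial q \<and> (\<forall>x\<in>V. q x \<le> q0 x) \<and> (\<forall>x. x \<notin> V \<longrightarrow> q x = 0)}"

text \<open>The lower bound is the pointwise infimum, finite because of the gauge. Its subadditivity
  uses the chain: the values of two members \<open>q\<close> and \<open>r\<close> are replaced by
  those of the smaller one.\<close>

lemma facial_below_chain_INF:
  assumes le: "\<And>x. x \<in> V \<Longrightarrow> q0 x \<le> gauge x"
    and K: "K \<subseteq> facial_below q0" "K \<noteq> {}" and chain: "\<And>q r. q \<in> K \<Longrightarrow> r \<in> K \<Longrightarrow> q \<le> r \<or> r \<le> q"
  obtains u where "u \<in> facial_below q0" "\<And>q. q \<in> K \<Longrightarrow> u \<le> q"
proof -
  define u where "u x = (INF q\<in>K. q x)" for x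
  have Ksub: "sublinear_on V q" "facial q" if "q \<in> K" for q
    using K that by (auto simp: facial_below_def)
  have Kle: "q x \<le> q0 x" if "q \<in> K" "x \<in> V" for q x
    using K that by (auto simp: facial_below_def)
  have K0: "q x = 0" if "q \<in> K" "x \<notin> V" for q x
    using K that by (auto simp: facial_below_def)
  have bdd: "bdd_below ((\<lambda>q. q x) ` K)" for x
  proof (cases "x \<in> V")
    case True
    show ?thesis
    proof (rule bdd_belowI2)
      fix q assume "q \<in> K"
      then show "- gauge (- x) \<le> q x"
        using sublinear_neg[OF Ksub(1) True] Kle[of q "- x"] le[of "- x"] True V_neg by fastforce
    qed
  next
    case False
    then show ?thesis
      by (intro bdd_belowI2[of _ 0]) (simp add: K0)
  qed
  have u_le: "u x \<le> q x" if "q \<in> K" for q x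
    unfolding u_def by (rule cINF_lower[OF bdd that])
  have u_greatest: "z \<le> u x" if "\<And>q. q \<in> K \<Longrightarrow> z \<le> q x" for z x
    unfolding u_def using K(2) that by (rule cINF_greatest)
  have "u (x + y) \<le> u x + u y" if "x \<in> V" "y \<in> V" for x y
  proof -
    have *: "u (x + y) \<le> q x + r y" if qr: "q \<in> K" "r \<in> K" for q r
    proof -
      obtain s where s: "s \<in> K" "s \<le> q" "s \<le> r"
        using chain[OF qr] qr by blast
      have "u (x + y) \<le> s (x + y)"
        by (rule u_le[OF s(1)])
      also have "\<dots> \<le> s x + s y"
        by (rule sublinear_onD(1)[OF Ksub(1)[OF s(1)] \<open>x \<in> V\<close> \<open>y \<in> V\<close>])
      also have "\<dots> \<le> q x + r y"
        using s(2,3) by (simp add: add_mono le_fun_def)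
      finally show ?thesis .
    qed
    have "u (x + y) - q x \<le> u y" if "q \<in> K" for q
      using *[OF that] by (intro u_greatest) (simp add: algebra_simps)
    then have "u (x + y) - u y \<le> u x"
      by (intro u_greatest) (simp add: algebra_simps)
    then show ?thesis
      by simp
  qed
  moreover have "u (r *\<^sub>R x) = r * u x" if "x \<in> V" "0 \<le> r" for r x
  proof (cases "r = 0")
    case True
    obtain q where "q \<in> K"
      using K(2) by auto
    then have "u 0 = 0"
      using u_le[of q 0] u_greatest[of 0 0] sublinear_0[OF Ksub(1)] by fastforce
    with True show ?thesis
      by simp
  next
    case False
    then have "r > 0"
      using that by simp
    have hom: "q (r *\<^sub>R x) = r * q x" if "q \<in> K" for q
      using sublinear_onD(2)[OF Ksub(1)[OF that] \<open>x \<in> V\<close>] \<open>r > 0\<close> by simp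
    show ?thesis
    proof (rule antisym)
      have "u (r *\<^sub>R x) / r \<le> u x"
      proof (rule u_greatest)
        fix q assume "q \<in> K"
        then show "u (r *\<^sub>R x) / r \<le> q x"
          using u_le[of q "r *\<^sub>R x"] hom[of q] \<open>r > 0\<close> by (simp add: field_simps)
      qed
      then show "u (r *\<^sub>R x) \<le> r * u x"
        using \<open>r > 0\<close> by (simp add: field_simps)
      show "r * u x \<le> u (r *\<^sub>R x)"
      proof (rule u_greatest)
        fix q assume "q \<in> K"
        then show "r * u x \<le> q (r *\<^sub>R x)"
          using u_le[of q x] hom[of q] \<open>r > 0\<close> by simp
      qed
    qed
  qed
  ultimately have "sublinear_on V u"
    by (simp add: sublinear_on_def)
  moreover have "facial u"
    unfolding facial_def
  proof (intro allI impI ballI)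
    fix g h x
    assume g: "positive_functional g" and h: "positive_functional h" and x: "x \<in> V"
      and gh: "\<forall>x\<in>V. g x + h x \<le> u x"
    have *: "g x \<le> g e * q x" if "q \<in> K" for q
      using gh u_le[OF that] by (intro facialD(1)[OF Ksub(2)[OF that] g h _ x]) (meson order_trans)
    show "g x \<le> g e * u x"
    proof (cases "g e = 0")
      case True
      then show ?thesis
        using * K(2) by auto
    next
      case False
      then have "0 < g e"
        using g e_C by (force simp: positive_functional_def)
      then have "g x / g e \<le> u x"
        using * by (intro u_greatest) (simp add: field_simps)
      then show ?thesis
        using \<open>0 < g e\<close> by (simp add: field_simps)
    qed
  qed
  moreover have "u x \<le> q0 x" if "x \<in> V" for x
    using K(2) u_le Kle that by (meson all_not_in_conv order_trans)
  moreover have "u x = 0" if "x \<notin> V" for x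
  proof -
    obtain q where "q \<in> K"
      using K(2) by auto
    then show ?thesis
      using u_le[of q x] u_greatest[of 0 x] K0[OF _ that] by fastforce
  qed
  ultimately have "u \<in> facial_below q0"
    by (simp add: facial_below_def)
  then show thesis
    using u_le by (intro that[of u]) (auto simp: le_fun_def)
qed

lemma facial_below_minimal:
  assumes le: "\<And>x. x \<in> V \<Longrightarrow> q0 x \<le> gauge x" and ne: "facial_below q0 \<noteq> {}"
  obtains f where "f \<in> facial_below q0" "\<And>q. q \<in> facial_below q0 \<Longrightarrow> q \<le> f \<Longrightarrow> q = f"
proof -
  have "\<exists>m\<in>facial_below q0. \<forall>a\<in>facial_below q0. a \<le> m \<longrightarrow> a = m"
  proof (rule predicate_Zorn[where P = "\<lambda>q r. r \<le> q"])
    show "partial_order_on (facial_below q0) (relation_of (\<lambda>q r. r \<le> q) (facial_below q0))"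
      by (rule partial_order_on_relation_ofI) auto
  next
    fix K assume K: "K \<in> Chains (relation_of (\<lambda>q r. r \<le> q) (facial_below q0))"
    have sub: "K \<subseteq> facial_below q0"
      using K by (auto simp: Chains_def relation_of_def)
    have chain: "q \<le> r \<or> r \<le> q" if "q \<in> K" "r \<in> K" for q r
      using K that by (auto simp: Chains_def relation_of_def)
    show "\<exists>u\<in>facial_below q0. \<forall>a\<in>K. u \<le> a"
    proof (cases "K = {}")
      case False
      then show ?thesis
        using facial_below_chain_INF[OF le sub False chain] by metis
    qed (use ne in auto)
  qed
  then show thesis
    using that by blast
qed

text \<open>
  A minimal facial functional is linear since it coincides with all its exposed faces. Starting from
  the face exposed by \<open>- v\<close> makes it minimize the value at \<open>v\<close>.
\<close>
theorem pure_state_exists: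
  assumes v: "v \<in> V" and d: "d > 0" "v + d *\<^sub>R e \<notin> C"
  obtains f where "positive_functional f" "f e = 1" "f v < 0"
    "\<And>g h x. positive_functional g \<Longrightarrow> positive_functional h \<Longrightarrow>
       (\<And>x. x \<in> V \<Longrightarrow> g x + h x = f x) \<Longrightarrow> x \<in> V \<Longrightarrow> g x = g e * f x"
proof -
  define q0 where "q0 = exposed V gauge (- v)"
  note nv = V_neg[OF v]
  have q0_le: "q0 x \<le> gauge x" if "x \<in> V" for x
    unfolding q0_def by (rule exposed_le_self[OF gauge_sublinear nv that])
  have "q0 \<in> facial_below q0"
    unfolding facial_below_def
    using exposed_sublinear[OF gauge_sublinear nv]
      exposed_facial[OF gauge_sublinear order.refl facial_gauge nv]
    by (auto simp: q0_def exposed_def)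
  then obtain f where f: "f \<in> facial_below q0" "\<And>q. q \<in> facial_below q0 \<Longrightarrow> q \<le> f \<Longrightarrow> q = f"
    using facial_below_minimal[OF q0_le] by blast
  have sub: "sublinear_on V f" and fac: "facial f" and f_le: "\<And>x. x \<in> V \<Longrightarrow> f x \<le> q0 x"
    and f0: "\<And>x. x \<notin> V \<Longrightarrow> f x = 0"
    using f(1) by (auto simp: facial_below_def)
  have f_gauge: "f x \<le> gauge x" if "x \<in> V" for x
    using f_le q0_le that by (meson order_trans)
  have neg: "f (- x) = - f x" if x: "x \<in> V" for x
  proof -
    have "exposed V f x y \<le> f y" for y
      using exposed_le_self[OF sub x] f0 by (cases "y \<in> V") (auto simp: exposed_def)
    moreover have "exposed V f x \<in> facial_below q0"
      unfolding facial_below_def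
      using exposed_sublinear[OF sub x] exposed_facial[OF sub f_gauge fac x]
        exposed_le_self[OF sub x] f_le by (auto simp: exposed_def intro: order_trans)
    ultimately have "exposed V f x = f"
      by (intro f(2)) (auto simp: le_fun_def)
    then have "f (- x) \<le> - f x"
      using exposed_neg[OF sub x] by simp
    then show ?thesis
      using sublinear_neg[OF sub x] by simp
  qed
  have lin: "linear_functional_on V f"
    unfolding linear_functional_on_def
  proof (intro conjI ballI allI)
    fix x y assume xy: "x \<in> V" "y \<in> V"
    have "f ((x + y) + (- y)) \<le> f (x + y) + f (- y)"
      using xy by (intro sublinear_onD(1)[OF sub] V_add V_neg)
    then show "f (x + y) = f x + f y"
      using sublinear_onD(1)[OF sub xy] neg[OF xy(2)] by simp
  next
    fix r x assume x: "x \<in> V"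
    show "f (r *\<^sub>R x) = r * f x"
    proof (cases "0 \<le> r")
      case False
      then have "f ((- r) *\<^sub>R x) = - r * f x"
        using x by (intro sublinear_onD(2)[OF sub]) auto
      then show ?thesis
        using neg[OF V_scale[OF x, of r]] by simp
    qed (use sublinear_onD(2)[OF sub x] in auto)
  qed
  have "f x \<ge> 0" if "x \<in> C" for x
  proof -
    have "x \<in> V" using that C_sub by auto
    then have "f (- x) \<le> 0"
      using gauge_le[of "- x" 0] f_gauge[of "- x"] that V_neg by fastforce
    then show ?thesis
      using neg[OF \<open>x \<in> V\<close>] by simp
  qed
  then have pos: "positive_functional f"
    using lin by (simp add: positive_functional_def)
  have "gauge e \<le> 1" "gauge (- e) \<le> -1"
    using C_scale[OF _ e_C, of 0] by (auto intro!: gauge_le e_V V_neg)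
  then have fe: "f e = 1"
    using f_gauge[OF e_V] f_gauge[OF V_neg[OF e_V]] neg[OF e_V] by linarith
  \<comment> \<open>Here the margin \<open>d\<close> enters: from \<open>v\<close> lying outside the
    cone alone the gauge of \<open>- v\<close> would only be known to be nonnegative.\<close>
  have "d \<le> gauge (- v)"
  proof (rule gauge_greatest[OF nv], rule ccontr)
    fix t assume t: "t *\<^sub>R e - (- v) \<in> C" "\<not> d \<le> t"
    have "(t *\<^sub>R e - (- v)) + (d - t) *\<^sub>R e \<in> C"
      using t by (intro C_add C_scale e_C) auto
    then show False
      using d(2) by (simp add: algebra_simps)
  qed
  moreover have "f v \<le> - gauge (- v)"
    using f_le[OF v] exposed_neg[OF gauge_sublinear nv] by (simp add: q0_def)
  ultimately have fv: "f v < 0"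
    using d(1) by linarith
  show thesis
  proof (rule that[OF pos fe fv])
    fix g h x
    assume g: "positive_functional g" and h: "positive_functional h" and x: "x \<in> V"
      and gh: "\<And>x. x \<in> V \<Longrightarrow> g x + h x = f x"
    have le: "g y \<le> g e * f y" if "y \<in> V" for y
      using gh that by (intro facialD(1)[OF fac g h]) auto
    have "g (- x) = - g x"
      using g x by (intro linear_functional_onD(3)) (auto simp: positive_functional_def)
    then show "g x = g e * f x"
      using le[OF x] le[OF V_neg[OF x]] neg[OF x] by simp
  qed
qed

end

subsection \<open>Matrices over an operator system\<close>

lemma operator_systemD:
  assumes "operator_system S"
  shows "1 \<in> S" "0 \<in> S" "x \<in> S \<Longrightarrow> y \<in> S \<Longrightarrow> x + y \<in> S" "x \<in> S \<Longrightarrow> c *\<^sub>C x \<in> S"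
    "x \<in> S \<Longrightarrow> r *\<^sub>R x \<in> S" "x \<in> S \<Longrightarrow> star x \<in> S" "x \<in> S \<Longrightarrow> - x \<in> S"
    "x \<in> S \<Longrightarrow> y \<in> S \<Longrightarrow> x - y \<in> S"
proof -
  have c: "c *\<^sub>C x \<in> S" if "x \<in> S" for c x
    using assms that by (auto simp: operator_system_def)
  have a: "x + y \<in> S" if "x \<in> S" "y \<in> S" for x y
    using assms that by (auto simp: operator_system_def)
  have n: "- x \<in> S" if "x \<in> S" for x
    using c[OF that, of "-1"] by (simp add: scaleC_minus_left)
  show "1 \<in> S" "x \<in> S \<Longrightarrow> star x \<in> S"
    using assms by (auto simp: operator_system_def)
  then show "0 \<in> S"
    using c[of 1 0] by simp
  show "x \<in> S \<Longrightarrow> r *\<^sub>R x \<in> S"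
    using c[of x "complex_of_real r"] by (simp add: scaleC_complex_of_real)
  show "x \<in> S \<Longrightarrow> y \<in> S \<Longrightarrow> x - y \<in> S"
    using a[of x "- y"] n by simp
  show "x \<in> S \<Longrightarrow> y \<in> S \<Longrightarrow> x + y \<in> S" "x \<in> S \<Longrightarrow> c *\<^sub>C x \<in> S" "x \<in> S \<Longrightarrow> - x \<in> S"
    using a c n by auto
qed

lemma operator_system_sum:
  assumes "operator_system S" "\<And>i. i \<in> A \<Longrightarrow> f i \<in> S"
  shows "sum f A \<in> S"
  using assms(2) by (induction A rule: infinite_finite_induct) (auto simp: operator_systemD[OF assms(1)])

text \<open>Every skew-adjoint matrix satisfies this, so a real-linear functional that is
  nonnegative on such matrices vanishes on the skew-adjoint ones, as the real part of a positive
  complex functional must.\<close>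

definition re_pos :: "nat \<Rightarrow> (nat \<Rightarrow> nat \<Rightarrow> 'a::unital_cstar_algebra) \<Rightarrow> bool" where
  "re_pos n X \<longleftrightarrow> (\<forall>a. cstar_pos (qform n X a + star (qform n X a)))"

text \<open>Zero entries outside the \<open>n \<times> n\<close> corner make equality of functions
  the same as equality of matrices.\<close>

definition mat_space :: "nat \<Rightarrow> 'a::unital_cstar_algebra set \<Rightarrow> (nat \<Rightarrow> nat \<Rightarrow> 'a) set" where
  "mat_space n S = {X. (\<forall>i j. X i j \<in> S) \<and> (\<forall>i j. \<not> (i < n \<and> j < n) \<longrightarrow> X i j = 0)}"

definition mat_cone :: "nat \<Rightarrow> 'a::unital_cstar_algebra set \<Rightarrow> (nat \<Rightarrow> nat \<Rightarrow> 'a) set" where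
  "mat_cone n S = {X \<in> mat_space n S. re_pos n X}"

definition mat_unit :: "nat \<Rightarrow> nat \<Rightarrow> nat \<Rightarrow> 'a::unital_cstar_algebra" where
  "mat_unit n = (\<lambda>i j. if i = j \<and> i < n then 1 else 0)"

lemma qform_add: "qform n (X + Y) a = qform n X a + qform n Y a"
  by (simp add: qform_def algebra_simps sum.distrib)

lemma qform_diff: "qform n (X - Y) a = qform n X a - qform n Y a"
  by (simp add: qform_def algebra_simps sum_subtractf)

lemma qform_scaleR: "qform n (r *\<^sub>R X) a = r *\<^sub>R qform n X a"
  by (simp add: qform_def scaleR_sum_right)

lemma qform_uminus: "qform n (- X) a = - qform n X a"
  by (simp add: qform_def sum_negf)

lemma qform_scaleC: "qform n (\<lambda>i j. c *\<^sub>C X i j) a = c *\<^sub>C qform n X a"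
  by (simp add: qform_def scaleC_sum_right mult_scaleC_left mult_scaleC_right)

lemma qform_cong: "(\<And>i j. i < n \<Longrightarrow> j < n \<Longrightarrow> X i j = Y i j) \<Longrightarrow> qform n X a = qform n Y a"
  by (simp add: qform_def)

lemma qform_star: "qform n (\<lambda>i j. star (X j i)) a = star (qform n X a)"
proof -
  have "qform n (\<lambda>i j. star (X j i)) a = (\<Sum>j<n. \<Sum>i<n. star (a i) * star (X j i) * a j)"
    unfolding qform_def by (rule sum.swap)
  then show ?thesis
    by (simp add: qform_def star_sum star_mult star_star mult.assoc)
qed

lemma qform_mat_unit: "qform n (mat_unit n) a = ip n a a"
proof -
  have "(\<Sum>j<n. star (a i) * mat_unit n i j * a j) = star (a i) * a i" if "i < n" for i
    using that by (simp add: mat_unit_def if_distrib if_distribR sum.delta cong: if_cong)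
  then show ?thesis
    by (simp add: qform_def ip_def)
qed

lemma star_ip_self: "star (ip n a a) = ip n a a"
  by (rule cstar_pos_star) (rule cstar_pos_ip_self)

lemma mpos_cong: "(\<And>i j. i < n \<Longrightarrow> j < n \<Longrightarrow> X i j = Y i j) \<Longrightarrow> mpos n X \<longleftrightarrow> mpos n Y"
  unfolding mpos_def using qform_cong[of n X Y] by simp

lemma re_pos_of_mpos: "mpos n X \<Longrightarrow> re_pos n X"
  unfolding re_pos_def mpos_def by (auto intro: cstar_pos_add simp: cstar_pos_star)

lemma re_pos_of_mpos_ii:
  assumes "mpos n X" "c = \<i> \<or> c = - \<i>"
  shows "re_pos n (\<lambda>i j. c *\<^sub>C X i j)"
proof -
  have "star (qform n X a) = qform n X a" for a
    using assms by (simp add: mpos_def cstar_pos_star)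
  then show ?thesis
    using assms(2) by (auto simp: re_pos_def qform_scaleC star_scaleC scaleC_minus_left star_minus)
qed

lemma mpos_of_re_pos:
  assumes "re_pos n X" "re_pos n (\<lambda>i j. \<i> *\<^sub>C X i j)" "re_pos n (\<lambda>i j. (- \<i>) *\<^sub>C X i j)"
  shows "mpos n X"
  unfolding mpos_def
proof
  fix a
  define q where "q = qform n X a"
  have 1: "cstar_pos (q + star q)" and 2: "cstar_pos (\<i> *\<^sub>C (q - star q))"
    and 3: "cstar_pos (- (\<i> *\<^sub>C (q - star q)))"
    using assms unfolding re_pos_def qform_scaleC q_def
    by (auto simp: star_scaleC scaleC_minus_left scaleC_diff_right add.commute star_minus dest!: spec[of _ a])
  have "q - star q = 0"
    using cstar_pos_antisym[OF 2 3] by (metis neg_0_equal_iff_equal scaleC_ii_scaleC_ii scaleC_zero_right)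
  then have "q + star q = 2 *\<^sub>R q"
    by (simp add: scaleR_2)
  then have "cstar_pos ((1/2) *\<^sub>R (2 *\<^sub>R q))"
    using cstar_pos_scaleR[OF 1, of "1/2"] by simp
  then show "cstar_pos (qform n X a)"
    by (simp add: q_def)
qed

lemma order_unit_cone_mat_cone:
  assumes S: "operator_system S" and n: "0 < n"
  shows "order_unit_cone (mat_space n S) (mat_cone n S) (mat_unit n)"
proof
  note S = operator_systemD[OF S]
  show "subspace (mat_space n S)"
    by (auto simp: subspace_def mat_space_def S)
  show "mat_cone n S \<subseteq> mat_space n S"
    by (auto simp: mat_cone_def)
  show unit: "mat_unit n \<in> mat_cone n S"
    by (auto simp: mat_cone_def mat_space_def mat_unit_def S re_pos_def qform_mat_unit[unfolded mat_unit_def]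
        star_ip_self intro!: cstar_pos_add cstar_pos_ip_self)
  show "X + Y \<in> mat_cone n S" if "X \<in> mat_cone n S" "Y \<in> mat_cone n S" for X Y
  proof -
    have "cstar_pos (qform n (X + Y) a + star (qform n (X + Y) a))" for a
      using that cstar_pos_add[of "qform n X a + star (qform n X a)" "qform n Y a + star (qform n Y a)"]
      by (simp add: mat_cone_def re_pos_def qform_add star_add add_ac)
    then show ?thesis
      using that by (auto simp: mat_cone_def mat_space_def re_pos_def S)
  qed
  show "r *\<^sub>R X \<in> mat_cone n S" if "0 \<le> r" "X \<in> mat_cone n S" for r X
    using that by (auto simp: mat_cone_def mat_space_def re_pos_def S qform_scaleR star_scaleR
        simp flip: scaleR_add_right intro!: cstar_pos_scaleR)
  show "\<exists>t. t *\<^sub>R mat_unit n - X \<in> mat_cone n S" if "X \<in> mat_space n S" for X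
  proof -
    obtain t where t: "\<And>a. cstar_pos (t *\<^sub>R ip n a a - (qform n X a + star (qform n X a)))"
      using matrix_order_unit[of n X] by blast
    \<comment> \<open>Half of \<open>t\<close> suffices because \<open>re_pos\<close> counts the
      unit twice, once for its adjoint.\<close>
    have "re_pos n ((t/2) *\<^sub>R mat_unit n - X)"
      using t by (simp add: re_pos_def qform_diff qform_scaleR qform_mat_unit star_diff star_scaleR
          star_ip_self algebra_simps flip: scaleR_add_left)
    then show ?thesis
      using that unit by (intro exI[of _ "t/2"]) (auto simp: mat_cone_def mat_space_def S)
  qed
  show "- mat_unit n \<notin> mat_cone n S"
  proof
    assume "- mat_unit n \<in> mat_cone n S"
    then have "cstar_pos (qform n (- mat_unit n) (unit_fun 0) + star (qform n (- mat_unit n) (unit_fun 0 :: nat \<Rightarrow> 'a)))"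
      by (simp add: mat_cone_def re_pos_def)
    moreover have "qform n (mat_unit n) (unit_fun 0) = (1::'a)"
      using qform_single[OF n, of "mat_unit n :: nat \<Rightarrow> nat \<Rightarrow> 'a"] n by (simp add: mat_unit_def)
    ultimately have "cstar_pos (- ((2::real) *\<^sub>R (1::'a)))"
      by (simp add: qform_uminus star_minus scaleR_2)
    moreover have "cstar_pos ((2::real) *\<^sub>R (1::'a))"
      using cstar_pos_star_mult_self[of "1::'a"] by (intro cstar_pos_scaleR) auto
    ultimately have "(2::real) *\<^sub>R (1::'a) = 0"
      using cstar_pos_antisym by blast
    then show False
      by simp
  qed
qed

text \<open>\<open>W* X W\<close> for the scalar matrix \<open>W\<close> with entries
  \<open>w p r\<close>, padded with zeros so as to lie in \<open>mat_space k\<close>.\<close>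

definition compress ::
    "nat \<Rightarrow> nat \<Rightarrow> (nat \<Rightarrow> nat \<Rightarrow> complex) \<Rightarrow> (nat \<Rightarrow> nat \<Rightarrow> 'a::unital_cstar_algebra) \<Rightarrow> nat \<Rightarrow> nat \<Rightarrow> 'a" where
  "compress n k w X = (\<lambda>r s. if r < k \<and> s < k
     then \<Sum>p<n. \<Sum>q<n. (cnj (w p r) * w q s) *\<^sub>C X p q else 0)"

lemma compress_mat_space:
  assumes "operator_system S" "\<And>p q. p < n \<Longrightarrow> q < n \<Longrightarrow> X p q \<in> S"
  shows "compress n k w X \<in> mat_space k S"
  using assms by (auto simp: compress_def mat_space_def operator_systemD intro!: operator_system_sum)

lemma qform_compress:
  "qform k (compress n k w X) a = qform n X (\<lambda>p. \<Sum>r<k. w p r *\<^sub>C a r)"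
proof -
  have "qform k (compress n k w X) a
     = (\<Sum>r<k. \<Sum>s<k. \<Sum>p<n. \<Sum>q<n. star (w p r *\<^sub>C a r) * X p q * (w q s *\<^sub>C a s))"
    by (simp add: qform_def compress_def sum_distrib_left sum_distrib_right mult_scaleC_left
        mult_scaleC_right star_scaleC scaleC_scaleC mult.commute)
  also have "\<dots> = (\<Sum>r<k. \<Sum>p<n. \<Sum>s<k. \<Sum>q<n. star (w p r *\<^sub>C a r) * X p q * (w q s *\<^sub>C a s))"
    by (intro sum.cong refl sum.swap)
  also have "\<dots> = (\<Sum>p<n. \<Sum>r<k. \<Sum>s<k. \<Sum>q<n. star (w p r *\<^sub>C a r) * X p q * (w q s *\<^sub>C a s))"
    by (rule sum.swap)
  also have "\<dots> = (\<Sum>p<n. \<Sum>r<k. \<Sum>q<n. \<Sum>s<k. star (w p r *\<^sub>C a r) * X p q * (w q s *\<^sub>C a s))"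
    by (intro sum.cong refl sum.swap)
  also have "\<dots> = (\<Sum>p<n. \<Sum>q<n. \<Sum>r<k. \<Sum>s<k. star (w p r *\<^sub>C a r) * X p q * (w q s *\<^sub>C a s))"
    by (intro sum.cong refl sum.swap)
  also have "\<dots> = qform n X (\<lambda>p. \<Sum>r<k. w p r *\<^sub>C a r)"
    unfolding qform_def
  proof (intro sum.cong refl)
    fix p q
    show "(\<Sum>r<k. \<Sum>s<k. star (w p r *\<^sub>C a r) * X p q * (w q s *\<^sub>C a s))
        = star (\<Sum>r<k. w p r *\<^sub>C a r) * X p q * (\<Sum>r<k. w q r *\<^sub>C a r)"
      by (subst star_sum, subst sum_distrib_right, subst sum_product, rule refl)
  qed
  finally show ?thesis .
qed

lemma re_pos_compress: "re_pos n X \<Longrightarrow> re_pos k (compress n k w X)"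
  by (simp add: re_pos_def qform_compress)

lemma mpos_compress: "mpos n X \<Longrightarrow> mpos k (compress n k w X)"
  by (simp add: mpos_def qform_compress)

section \<open>Quadratic forms of amplified matrix-valued maps\<close>

lemma cstar_pos_complex: "cstar_pos (z :: complex) \<longleftrightarrow> Im z = 0 \<and> 0 \<le> Re z"
proof -
  have "(\<exists>y. z = cnj y * y) \<longleftrightarrow> Im z = 0 \<and> 0 \<le> Re z"
  proof
    assume "Im z = 0 \<and> 0 \<le> Re z"
    then have "z = cnj (complex_of_real (sqrt (Re z))) * complex_of_real (sqrt (Re z))"
      by (simp add: complex_eq_iff)
    then show "\<exists>y. z = cnj y * y"
      by blast
  qed auto
  then show ?thesis
    by (simp add: cstar_pos_iff star_complex_def)
qed

definition sform :: "nat \<Rightarrow> complex mat \<Rightarrow> (nat \<Rightarrow> complex) \<Rightarrow> (nat \<Rightarrow> complex) \<Rightarrow> complex" where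
  "sform k M u v = (\<Sum>r<k. \<Sum>s<k. cnj (u r) * M $$ (r, s) * v s)"

text \<open>The quadratic form of \<open>amplify m k \<phi> X\<close> at a vector of length
  \<open>m * k\<close>, read as \<open>m\<close> blocks \<open>w p\<close> of length
  \<open>k\<close>; this keeps \<open>div\<close> and \<open>mod\<close> out of the later
  arguments.\<close>

definition block_form ::
    "nat \<Rightarrow> nat \<Rightarrow> ('a \<Rightarrow> complex mat) \<Rightarrow> (nat \<Rightarrow> nat \<Rightarrow> 'a) \<Rightarrow> (nat \<Rightarrow> nat \<Rightarrow> complex) \<Rightarrow> complex" where
  "block_form m k \<phi> X w = (\<Sum>p<m. \<Sum>q<m. sform k (\<phi> (X p q)) (w p) (w q))"

lemma qform_complex: "qform k (\<lambda>i j. M $$ (i, j)) a = sform k M a a"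
  by (simp add: qform_def sform_def star_complex_def)

lemma sum_lessThan_mult:
  fixes h :: "nat \<Rightarrow> 'a::comm_monoid_add"
  shows "(\<Sum>i<m * k. h i) = (\<Sum>p<m. \<Sum>r<k. h (p * k + r))"
proof -
  have "sum h {p * k..<p * k + k} = (\<Sum>r<k. h (p * k + r))" for p
    using sum.shift_bounds_nat_ivl[of h 0 "p * k" k] by (simp add: atLeast0LessThan add.commute)
  then show ?thesis
    using sum.nat_group[of h k m] by simp
qed

lemma qform_amplify:
  "qform (m * k) (\<lambda>i j. amplify m k \<phi> X $$ (i, j)) a
     = block_form m k \<phi> (\<lambda>p q. X $$ (p, q)) (\<lambda>p r. a (p * k + r))"
proof -
  have lt: "p * k + r < m * k" if "p < m" "r < k" for p r
  proof -
    have "p * k + r < Suc p * k" using that by simp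
    also have "\<dots> \<le> m * k" using that by (intro mult_le_mono1) simp
    finally show ?thesis .
  qed
  have "qform (m * k) (\<lambda>i j. amplify m k \<phi> X $$ (i, j)) a
     = (\<Sum>p<m. \<Sum>r<k. \<Sum>q<m. \<Sum>s<k. cnj (a (p * k + r)) * \<phi> (X $$ (p, q)) $$ (r, s) * a (q * k + s))"
    using lt by (simp add: qform_def sum_lessThan_mult star_complex_def amplify_def)
  also have "\<dots> = (\<Sum>p<m. \<Sum>q<m. \<Sum>r<k. \<Sum>s<k. cnj (a (p * k + r)) * \<phi> (X $$ (p, q)) $$ (r, s) * a (q * k + s))"
    by (intro sum.cong refl sum.swap)
  finally show ?thesis
    by (simp add: block_form_def sform_def)
qed

lemma mat_positive_amplify_iff:
  "mat_positive (m * k) (amplify m k \<phi> X) \<longleftrightarrow>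
     (\<forall>w. Im (block_form m k \<phi> (\<lambda>p q. X $$ (p, q)) w) = 0 \<and>
          0 \<le> Re (block_form m k \<phi> (\<lambda>p q. X $$ (p, q)) w))"
proof -
  have "amplify m k \<phi> X \<in> carrier_mat (m * k) (m * k)"
    by (simp add: amplify_def)
  then have iff: "mat_positive (m * k) (amplify m k \<phi> X) \<longleftrightarrow>
     (\<forall>a. cstar_pos (block_form m k \<phi> (\<lambda>p q. X $$ (p, q)) (\<lambda>p r. a (p * k + r))))"
    by (simp add: mat_positive_iff_mpos mpos_def qform_amplify)
  have *: "block_form m k \<phi> Y (\<lambda>p r. w ((p * k + r) div k) ((p * k + r) mod k)) = block_form m k \<phi> Y w" for w Y
    by (simp add: block_form_def sform_def)
  show ?thesis
    unfolding iff cstar_pos_complex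
  proof (intro iffI allI)
    fix w
    assume "\<forall>a. Im (block_form m k \<phi> (\<lambda>p q. X $$ (p, q)) (\<lambda>p r. a (p * k + r))) = 0 \<and>
      0 \<le> Re (block_form m k \<phi> (\<lambda>p q. X $$ (p, q)) (\<lambda>p r. a (p * k + r)))"
    from this[rule_format, of "\<lambda>i. w (i div k) (i mod k)"]
    show "Im (block_form m k \<phi> (\<lambda>p q. X $$ (p, q)) w) = 0 \<and>
      0 \<le> Re (block_form m k \<phi> (\<lambda>p q. X $$ (p, q)) w)"
      unfolding * .
  qed blast
qed

lemma block_form_real:
  assumes \<phi>: "\<phi> \<in> UCP S k" and X: "\<And>p q. p < m \<Longrightarrow> q < m \<Longrightarrow> X p q \<in> S" and pos: "mpos m X"
  shows "Im (block_form m k \<phi> X w) = 0" "0 \<le> Re (block_form m k \<phi> X w)"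
proof -
  define M where "M = mat m m (\<lambda>(p, q). X p q)"
  have "M \<in> mats_over m S"
    using X by (auto simp: M_def mats_over_def)
  moreover have "mpos m (\<lambda>i j. M $$ (i, j)) \<longleftrightarrow> mpos m X"
    by (rule mpos_cong) (simp add: M_def)
  then have "mat_positive m M"
    using pos by (subst mat_positive_iff_mpos) (auto simp: M_def)
  ultimately have "mat_positive (m * k) (amplify m k \<phi> M)"
    using \<phi> unfolding UCP_def by blast
  moreover have "block_form m k \<phi> (\<lambda>p q. M $$ (p, q)) w = block_form m k \<phi> X w"
    by (simp add: block_form_def M_def)
  ultimately show "Im (block_form m k \<phi> X w) = 0" "0 \<le> Re (block_form m k \<phi> X w)"
    unfolding mat_positive_amplify_iff by metis+
qed

definition mat_linear_on :: "'a::unital_cstar_algebra set \<Rightarrow> nat \<Rightarrow> ('a \<Rightarrow> complex mat) \<Rightarrow> bool" where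
  "mat_linear_on S k \<phi> \<longleftrightarrow> (\<forall>x\<in>S. \<phi> x \<in> carrier_mat k k) \<and>
     (\<forall>x\<in>S. \<forall>y\<in>S. \<phi> (x + y) = \<phi> x + \<phi> y) \<and> (\<forall>c. \<forall>x\<in>S. \<phi> (c *\<^sub>C x) = c \<cdot>\<^sub>m \<phi> x)"

lemma UCP_mat_linear_on: "\<phi> \<in> UCP S k \<Longrightarrow> mat_linear_on S k \<phi>"
  by (simp add: UCP_def mat_linear_on_def)

lemma sform_add:
  "M \<in> carrier_mat k k \<Longrightarrow> M' \<in> carrier_mat k k \<Longrightarrow> sform k (M + M') u v = sform k M u v + sform k M' u v"
  by (simp add: sform_def algebra_simps sum.distrib)

lemma sform_smult: "M \<in> carrier_mat k k \<Longrightarrow> sform k (c \<cdot>\<^sub>m M) u v = c * sform k M u v"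
  by (simp add: sform_def sum_distrib_left mult_ac)

lemma block_form_add:
  assumes "mat_linear_on S k \<phi>" "\<And>p q. p < m \<Longrightarrow> q < m \<Longrightarrow> X p q \<in> S"
    "\<And>p q. p < m \<Longrightarrow> q < m \<Longrightarrow> Y p q \<in> S"
  shows "block_form m k \<phi> (\<lambda>p q. X p q + Y p q) w = block_form m k \<phi> X w + block_form m k \<phi> Y w"
  using assms by (simp add: block_form_def mat_linear_on_def sform_add sum.distrib)

lemma block_form_scaleC:
  assumes "mat_linear_on S k \<phi>" "\<And>p q. p < m \<Longrightarrow> q < m \<Longrightarrow> X p q \<in> S"
  shows "block_form m k \<phi> (\<lambda>p q. c *\<^sub>C X p q) w = c * block_form m k \<phi> X w"
  using assms by (simp add: block_form_def mat_linear_on_def sform_smult sum_distrib_left)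

text \<open>
  \<open>2 X = (X + X\<^sup>*) - i (i (X - X\<^sup>*))\<close>; the form is nonnegative at the first summand and real at the
  self-adjoint matrix \<open>i (X - X\<^sup>*)\<close>, as some multiple of the unit dominates the latter.
\<close>
lemma UCP_re_pos:
  assumes S: "operator_system S" and \<phi>: "\<phi> \<in> UCP S k"
    and X: "\<And>p q. p < m \<Longrightarrow> q < m \<Longrightarrow> X p q \<in> S" and pos: "re_pos m X"
  shows "0 \<le> Re (block_form m k \<phi> X w)"
proof -
  note S' = operator_systemD[OF S] and lin = UCP_mat_linear_on[OF \<phi>]
  define H K where "H p q = X p q + star (X q p)" and "K p q = \<i> *\<^sub>C (X p q - star (X q p))" for p q
  have HS: "H p q \<in> S" "K p q \<in> S" if "p < m" "q < m" for p q
    using X that by (simp_all add: H_def K_def S')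
  have "qform m H a = qform m X a + star (qform m X a)" for a
    using qform_add[of m X "\<lambda>p q. star (X q p)" a] qform_star[of m X a]
    by (simp add: H_def[abs_def] plus_fun_def)
  then have "mpos m H"
    using pos by (simp add: mpos_def re_pos_def)
  from block_form_real[OF \<phi> HS(1) this, of w]
  have H: "0 \<le> Re (block_form m k \<phi> H w)"
    by simp
  have qK: "qform m K a = \<i> *\<^sub>C (qform m X a - star (qform m X a))" for a
    using qform_scaleC[of m \<i> "\<lambda>p q. X p q - star (X q p)" a]
      qform_diff[of m X "\<lambda>p q. star (X q p)" a] qform_star[of m X a]
    by (simp add: K_def[abs_def] fun_diff_def)
  obtain t where t: "\<And>a. cstar_pos (t *\<^sub>R ip m a a - (qform m K a + star (qform m K a)))"
    using matrix_order_unit[of m K] by blast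
  have unitS: "mat_unit m p q \<in> S" for p q
    by (simp add: mat_unit_def S')
  \<comment> \<open>\<open>K\<close> is self-adjoint, so the bound \<open>t\<close> for
    \<open>K\<close> plus its adjoint makes \<open>t - 2 K\<close> positive.\<close>
  define D where "D p q = (complex_of_real t) *\<^sub>C mat_unit m p q + (-2) *\<^sub>C K p q" for p q
  have DS: "D p q \<in> S" if "p < m" "q < m" for p q
    using that HS unitS by (simp add: D_def S')
  have "qform m D a = t *\<^sub>R ip m a a - (qform m K a + star (qform m K a))" for a
  proof -
    have "qform m D a = (complex_of_real t) *\<^sub>C qform m (mat_unit m) a + (-2) *\<^sub>C qform m K a"
      using qform_add[of m "\<lambda>p q. (complex_of_real t) *\<^sub>C mat_unit m p q" "\<lambda>p q. (-2) *\<^sub>C K p q" a]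
      by (simp only: D_def[abs_def] plus_fun_def qform_scaleC)
    moreover have "star (qform m K a) = qform m K a"
      by (simp add: qK star_scaleC star_diff star_star scaleC_minus_left scaleC_diff_right)
    moreover have "2 *\<^sub>C qform m K a = qform m K a + qform m K a"
      using scaleC_add_left[of 1 1 "qform m K a"] by simp
    ultimately show ?thesis
      by (simp add: qform_mat_unit scaleC_complex_of_real scaleC_minus_left)
  qed
  then have "mpos m D"
    using t by (simp add: mpos_def)
  from block_form_real(1)[OF \<phi> DS this, of w]
  have "Im (block_form m k \<phi> D w) = 0" .
  moreover have "block_form m k \<phi> D w
      = complex_of_real t * block_form m k \<phi> (mat_unit m) w + (-2) * block_form m k \<phi> K w"
    unfolding D_def
    by (subst block_form_add[OF lin]) (simp_all only: block_form_scaleC[OF lin] HS unitS S')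
  moreover have "mpos m (mat_unit m :: nat \<Rightarrow> nat \<Rightarrow> 'a)"
    by (simp add: mpos_def qform_mat_unit cstar_pos_ip_self)
  then have "Im (block_form m k \<phi> (mat_unit m) w) = 0"
    by (rule block_form_real(1)[OF \<phi> unitS])
  ultimately have K: "Im (block_form m k \<phi> K w) = 0"
    by simp
  have "2 *\<^sub>C X p q = H p q + (- \<i>) *\<^sub>C K p q" for p q
    using scaleC_add_left[of 1 1 "X p q"] by (simp add: H_def K_def scaleC_minus_left)
  then have "block_form m k \<phi> (\<lambda>p q. 2 *\<^sub>C X p q) w
      = block_form m k \<phi> (\<lambda>p q. H p q + (- \<i>) *\<^sub>C K p q) w"
    by simp
  also have "\<dots> = block_form m k \<phi> H w + (- \<i>) * block_form m k \<phi> K w"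
    by (subst block_form_add[OF lin]) (simp_all only: block_form_scaleC[OF lin] HS S')
  finally have "2 * block_form m k \<phi> X w = block_form m k \<phi> H w + (- \<i>) * block_form m k \<phi> K w"
    using block_form_scaleC[OF lin X, where c = 2] by simp
  then have "2 * Re (block_form m k \<phi> X w) = Re (block_form m k \<phi> H w)"
    using K by (simp add: complex_eq_iff)
  then show ?thesis
    using H by simp
qed

definition mat_app :: "nat \<Rightarrow> complex mat \<Rightarrow> (nat \<Rightarrow> complex) \<Rightarrow> nat \<Rightarrow> complex" where
  "mat_app k Z v = (\<lambda>r. \<Sum>s<k. Z $$ (r, s) * v s)"

lemma mat_star_carrier [simp]: "Z \<in> carrier_mat m k \<Longrightarrow> mat_star Z \<in> carrier_mat k m"
  by (simp add: mat_star_def)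

lemma mat_star_index: "Z \<in> carrier_mat m k \<Longrightarrow> r < k \<Longrightarrow> a < m \<Longrightarrow> mat_star Z $$ (r, a) = star (Z $$ (a, r))"
  by (simp add: mat_star_def)

lemma mult_mat_index:
  "A \<in> carrier_mat m l \<Longrightarrow> B \<in> carrier_mat l k \<Longrightarrow> r < m \<Longrightarrow> s < k \<Longrightarrow>
     (A * B) $$ (r, s) = (\<Sum>b<l. A $$ (r, b) * B $$ (b, s))"
  by (simp add: scalar_prod_def atLeast0LessThan)

lemma mat_star_mult:
  fixes A B :: "complex mat"
  assumes "A \<in> carrier_mat m l" "B \<in> carrier_mat l k"
  shows "mat_star (A * B) = mat_star B * mat_star A"
proof (rule eq_matI)
  fix i j assume "i < dim_row (mat_star B * mat_star A)" "j < dim_col (mat_star B * mat_star A)"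
  then have ij: "i < k" "j < m"
    using assms by (auto simp: mat_star_def)
  then show "mat_star (A * B) $$ (i, j) = (mat_star B * mat_star A) $$ (i, j)"
    using assms mult_mat_index[of "mat_star B" k l "mat_star A" m i j] mult_mat_index[OF assms ij(2,1)]
    by (simp add: mat_star_index[of _ m k] mat_star_index[of _ m l] mat_star_index[of _ l k]
        star_complex_def mult.commute)
qed (use assms in \<open>auto simp: mat_star_def\<close>)

lemma sform_conj:
  assumes Z: "Z \<in> carrier_mat m k" and M: "M \<in> carrier_mat m m"
  shows "sform k (mat_star Z * M * Z) u v = sform m M (mat_app k Z u) (mat_app k Z v)"
proof -
  have ZM: "mat_star Z * M \<in> carrier_mat k m"
    by (rule mult_carrier_mat[OF mat_star_carrier[OF Z] M])
  have "(\<Sum>s<k. (mat_star Z * M * Z) $$ (r, s) * v s) = (\<Sum>b<m. (mat_star Z * M) $$ (r, b) * mat_app k Z v b)"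
    if "r < k" for r
  proof -
    have "(\<Sum>s<k. (mat_star Z * M * Z) $$ (r, s) * v s)
        = (\<Sum>s<k. \<Sum>b<m. (mat_star Z * M) $$ (r, b) * (Z $$ (b, s) * v s))"
      using that by (simp add: mult_mat_index[OF ZM Z] sum_distrib_right mult.assoc del: index_mult_mat)
    also have "\<dots> = (\<Sum>b<m. \<Sum>s<k. (mat_star Z * M) $$ (r, b) * (Z $$ (b, s) * v s))"
      by (rule sum.swap)
    finally show ?thesis
      by (simp add: mat_app_def sum_distrib_left)
  qed
  then have "sform k (mat_star Z * M * Z) u v
      = (\<Sum>r<k. \<Sum>b<m. cnj (u r) * (mat_star Z * M) $$ (r, b) * mat_app k Z v b)"
    by (simp add: sform_def mult.assoc flip: sum_distrib_left del: index_mult_mat)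
  also have "\<dots> = (\<Sum>b<m. \<Sum>r<k. cnj (u r) * (mat_star Z * M) $$ (r, b) * mat_app k Z v b)"
    by (rule sum.swap)
  also have "\<dots> = (\<Sum>b<m. \<Sum>a<m. cnj (mat_app k Z u a) * M $$ (a, b) * mat_app k Z v b)"
  proof (rule sum.cong[OF refl])
    fix b assume "b \<in> {..<m}"
    then have b: "b < m" by simp
    have "(\<Sum>r<k. cnj (u r) * (mat_star Z * M) $$ (r, b))
        = (\<Sum>r<k. \<Sum>a<m. cnj (Z $$ (a, r) * u r) * M $$ (a, b))"
      using Z M b by (simp add: mult_mat_index[of "mat_star Z" k m M m] mat_star_index[OF Z]
          star_complex_def sum_distrib_left mult_ac del: index_mult_mat)
    also have "\<dots> = (\<Sum>a<m. \<Sum>r<k. cnj (Z $$ (a, r) * u r) * M $$ (a, b))"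
      by (rule sum.swap)
    also have "\<dots> = (\<Sum>a<m. cnj (mat_app k Z u a) * M $$ (a, b))"
      by (simp add: mat_app_def sum_distrib_right del: complex_cnj_mult)
    finally show "(\<Sum>r<k. cnj (u r) * (mat_star Z * M) $$ (r, b) * mat_app k Z v b)
        = (\<Sum>a<m. cnj (mat_app k Z u a) * M $$ (a, b) * mat_app k Z v b)"
      by (simp flip: sum_distrib_right)
  qed
  also have "\<dots> = sform m M (mat_app k Z u) (mat_app k Z v)"
    unfolding sform_def by (rule sum.swap)
  finally show ?thesis .
qed

subsection \<open>Functionals and matrix-valued maps\<close>

lemma sform_unit_fun: "r < k \<Longrightarrow> s < k \<Longrightarrow> sform k M (unit_fun r) (unit_fun s) = M $$ (r, s)"
proof -
  assume rs: "r < k" "s < k"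
  have "(\<Sum>b<k. cnj (unit_fun r a) * M $$ (a, b) * unit_fun s b) = (if a = r then M $$ (r, s) else 0)" for a
  proof -
    have "(\<Sum>b<k. cnj (unit_fun r a) * M $$ (a, b) * unit_fun s b)
        = (\<Sum>b<k. if b = s then cnj (unit_fun r a) * M $$ (a, b) else 0)"
      by (intro sum.cong) (auto simp: unit_fun_def)
    then show ?thesis
      using rs by (simp add: sum.delta) (simp add: unit_fun_def)
  qed
  then show ?thesis
    using rs by (simp add: sform_def sum.delta)
qed

lemma sform_add_left: "sform k M (\<lambda>r. u r + c * u' r) v = sform k M u v + cnj c * sform k M u' v"
  by (simp add: sform_def algebra_simps sum.distrib sum_distrib_left)

lemma sform_add_right: "sform k M u (\<lambda>s. v s + c * v' s) = sform k M u v + c * sform k M u v'"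
  by (simp add: sform_def algebra_simps sum.distrib sum_distrib_left)

lemma sform_scale_left: "sform k M (\<lambda>r. c * u r) v = cnj c * sform k M u v"
  using sform_add_left[of k M "\<lambda>_. 0" c u v] by (simp add: sform_def)

lemma sform_scale_right: "sform k M u (\<lambda>s. c * v s) = c * sform k M u v"
  using sform_add_right[of k M u "\<lambda>_. 0" c v] by (simp add: sform_def)

lemma mat_linear_onD:
  assumes "mat_linear_on S k \<phi>"
  shows "x \<in> S \<Longrightarrow> \<phi> x \<in> carrier_mat k k" "x \<in> S \<Longrightarrow> y \<in> S \<Longrightarrow> \<phi> (x + y) = \<phi> x + \<phi> y"
    "x \<in> S \<Longrightarrow> \<phi> (c *\<^sub>C x) = c \<cdot>\<^sub>m \<phi> x"
  using assms by (auto simp: mat_linear_on_def)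

lemma mat_linear_on_zero:
  assumes "operator_system S" "mat_linear_on S k \<phi>"
  shows "\<phi> 0 = 0\<^sub>m k k"
proof -
  have "\<phi> 0 = 0 \<cdot>\<^sub>m \<phi> 0"
    using mat_linear_onD(3)[OF assms(2) operator_systemD(2)[OF assms(1)], of 0] by simp
  also have "\<dots> = 0\<^sub>m k k"
    using mat_linear_onD(1)[OF assms(2) operator_systemD(2)[OF assms(1)]] by (intro eq_matI) auto
  finally show ?thesis .
qed

lemma mat_linear_on_sum:
  assumes S: "operator_system S" and \<phi>: "mat_linear_on S k \<phi>" and rs: "r < k" "s < k"
    and x: "\<And>i. i \<in> A \<Longrightarrow> x i \<in> S"
  shows "\<phi> (sum x A) $$ (r, s) = (\<Sum>i\<in>A. \<phi> (x i) $$ (r, s))"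
  using x
proof (induction A rule: infinite_finite_induct)
  case (insert i A)
  have "\<phi> (x i + sum x A) = \<phi> (x i) + \<phi> (sum x A)"
    using insert by (intro mat_linear_onD[OF \<phi>] operator_system_sum[OF S]) auto
  moreover have "\<phi> (sum x A) \<in> carrier_mat k k"
    using insert by (intro mat_linear_onD[OF \<phi>] operator_system_sum[OF S]) auto
  ultimately show ?case
    using insert rs by simp
qed (simp_all add: mat_linear_on_zero[OF S \<phi>] rs)

text \<open>The reduction behind Choi's theorem: the form at any family \<open>w\<close>, for any
  \<open>n\<close>, is the form of a \<open>k \<times> k\<close> matrix at the standard unit
  vectors.\<close>

lemma block_form_compress:
  assumes S: "operator_system S" and \<phi>: "mat_linear_on S k \<phi>"
    and X: "\<And>p q. p < n \<Longrightarrow> q < n \<Longrightarrow> X p q \<in> S"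
  shows "block_form k k \<phi> (compress n k w X) unit_fun = block_form n k \<phi> X w"
proof -
  have *: "\<phi> (\<Sum>p<n. \<Sum>q<n. (cnj (w p r) * w q s) *\<^sub>C X p q) $$ (r, s)
      = (\<Sum>p<n. \<Sum>q<n. cnj (w p r) * \<phi> (X p q) $$ (r, s) * w q s)" if "r < k" "s < k" for r s
  proof -
    have "\<phi> (\<Sum>p<n. \<Sum>q<n. (cnj (w p r) * w q s) *\<^sub>C X p q) $$ (r, s)
        = (\<Sum>p<n. \<Sum>q<n. \<phi> ((cnj (w p r) * w q s) *\<^sub>C X p q) $$ (r, s))"
      using X that
      by (subst mat_linear_on_sum[OF S \<phi> that])
        (auto intro!: operator_system_sum[OF S] sum.cong mat_linear_on_sum[OF S \<phi> that]
          operator_systemD[OF S])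
    also have "\<dots> = (\<Sum>p<n. \<Sum>q<n. cnj (w p r) * \<phi> (X p q) $$ (r, s) * w q s)"
    proof (intro sum.cong refl)
      fix p q assume "p \<in> {..<n}" "q \<in> {..<n}"
      then have "X p q \<in> S" using X by simp
      then show "\<phi> ((cnj (w p r) * w q s) *\<^sub>C X p q) $$ (r, s) = cnj (w p r) * \<phi> (X p q) $$ (r, s) * w q s"
        using mat_linear_onD(1,3)[OF \<phi> \<open>X p q \<in> S\<close>] that by (simp add: mult_ac)
    qed
    finally show ?thesis .
  qed
  have "block_form k k \<phi> (compress n k w X) unit_fun
      = (\<Sum>r<k. \<Sum>s<k. \<Sum>p<n. \<Sum>q<n. cnj (w p r) * \<phi> (X p q) $$ (r, s) * w q s)"
    by (simp add: block_form_def sform_unit_fun compress_def *)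
  also have "\<dots> = (\<Sum>r<k. \<Sum>p<n. \<Sum>s<k. \<Sum>q<n. cnj (w p r) * \<phi> (X p q) $$ (r, s) * w q s)"
    by (intro sum.cong refl sum.swap)
  also have "\<dots> = (\<Sum>p<n. \<Sum>r<k. \<Sum>s<k. \<Sum>q<n. cnj (w p r) * \<phi> (X p q) $$ (r, s) * w q s)"
    by (rule sum.swap)
  also have "\<dots> = (\<Sum>p<n. \<Sum>r<k. \<Sum>q<n. \<Sum>s<k. cnj (w p r) * \<phi> (X p q) $$ (r, s) * w q s)"
    by (intro sum.cong refl sum.swap)
  also have "\<dots> = (\<Sum>p<n. \<Sum>q<n. \<Sum>r<k. \<Sum>s<k. cnj (w p r) * \<phi> (X p q) $$ (r, s) * w q s)"
    by (intro sum.cong refl sum.swap)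
  finally show ?thesis
    by (simp add: block_form_def sform_def)
qed

definition elem :: "nat \<Rightarrow> nat \<Rightarrow> 'a::zero \<Rightarrow> nat \<Rightarrow> nat \<Rightarrow> 'a" where
  "elem r s x = (\<lambda>i j. if i = r \<and> j = s then x else 0)"

text \<open>
  The map into the matrices that corresponds to the functional \<open>f\<close> on matrices over \<open>S\<close>; \<open>f\<close> is
  only real-linear and plays the role of the real part of a complex-linear functional.
\<close>
definition dual_map :: "nat \<Rightarrow> ((nat \<Rightarrow> nat \<Rightarrow> 'a::unital_cstar_algebra) \<Rightarrow> real) \<Rightarrow> 'a \<Rightarrow> complex mat" where
  "dual_map k f x = mat k k (\<lambda>(r, s). Complex (f (elem r s x)) (- f (elem r s (\<i> *\<^sub>C x))))"

lemma elem_mat_space: "operator_system S \<Longrightarrow> x \<in> S \<Longrightarrow> r < k \<Longrightarrow> s < k \<Longrightarrow> elem r s x \<in> mat_space k S"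
  by (auto simp: elem_def mat_space_def operator_systemD)

lemma subspace_mat_space: "operator_system S \<Longrightarrow> subspace (mat_space k S)"
  by (auto simp: subspace_def mat_space_def operator_systemD)

lemma linear_functional_on_sum:
  assumes V: "subspace V" and f: "linear_functional_on V f" and x: "\<And>i. i \<in> A \<Longrightarrow> x i \<in> V"
  shows "f (sum x A) = (\<Sum>i\<in>A. f (x i))"
  using x
proof (induction A rule: infinite_finite_induct)
  case (insert i A)
  then show ?case
    using subspace_sum[OF V, of A x] linear_functional_onD(1)[OF f, of "x i" "sum x A"] by simp
qed (use linear_functional_onD(2)[OF f subspace_0[OF V], of 0] in auto)

lemma scaleC_split:
  fixes x :: "'a::unital_cstar_algebra"
  shows "c *\<^sub>C x = Re c *\<^sub>R x + Im c *\<^sub>R (\<i> *\<^sub>C x)"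
proof -
  have "c = complex_of_real (Re c) + complex_of_real (Im c) * \<i>"
    by (simp add: complex_eq_iff)
  then have "c *\<^sub>C x = complex_of_real (Re c) *\<^sub>C x + complex_of_real (Im c) *\<^sub>C \<i> *\<^sub>C x"
    by (metis scaleC_add_left scaleC_scaleC)
  then show ?thesis
    by (simp add: scaleC_complex_of_real)
qed

lemma dual_map_linear:
  assumes S: "operator_system S" and f: "linear_functional_on (mat_space k S) f"
  shows "mat_linear_on S k (dual_map k f)"
  unfolding mat_linear_on_def
proof (intro conjI ballI allI)
  note S' = operator_systemD[OF S]
  have lin: "f (elem r s (a *\<^sub>R x + b *\<^sub>R y)) = a * f (elem r s x) + b * f (elem r s y)"
    if "r < k" "s < k" "x \<in> S" "y \<in> S" for r s x y a b
  proof -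
    have eq: "elem r s (a *\<^sub>R x + b *\<^sub>R y) = a *\<^sub>R elem r s x + b *\<^sub>R elem r s y"
      by (simp add: elem_def fun_eq_iff)
    show ?thesis
      unfolding eq using that elem_mat_space[OF S] subspace_scale[OF subspace_mat_space[OF S]]
      by (simp add: linear_functional_onD[OF f])
  qed
  show "dual_map k f x \<in> carrier_mat k k" for x
    by (simp add: dual_map_def)
  fix x assume x: "x \<in> S"
  show "dual_map k f (x + y) = dual_map k f x + dual_map k f y" if "y \<in> S" for y
    using lin[of _ _ x y 1 1] lin[of _ _ "\<i> *\<^sub>C x" "\<i> *\<^sub>C y" 1 1] x that
    by (intro eq_matI) (auto simp: dual_map_def scaleC_add_right S' complex_eq_iff)
  show "dual_map k f (c *\<^sub>C x) = c \<cdot>\<^sub>m dual_map k f x" for c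
  proof (rule eq_matI)
    fix r s assume "r < dim_row (c \<cdot>\<^sub>m dual_map k f x)" "s < dim_col (c \<cdot>\<^sub>m dual_map k f x)"
    then have rs: "r < k" "s < k"
      by (auto simp: dual_map_def)
    have 1: "f (elem r s (c *\<^sub>C x)) = Re c * f (elem r s x) + Im c * f (elem r s (\<i> *\<^sub>C x))"
      unfolding scaleC_split[of c x] using rs x by (intro lin) (auto simp: S')
    have "\<i> *\<^sub>C c *\<^sub>C x = Re c *\<^sub>R (\<i> *\<^sub>C x) + (- Im c) *\<^sub>R x"
      using scaleC_split[of "\<i> * c" x] by (simp add: scaleC_scaleC)
    then have 2: "f (elem r s (\<i> *\<^sub>C c *\<^sub>C x)) = Re c * f (elem r s (\<i> *\<^sub>C x)) + (- Im c) * f (elem r s x)"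
      using rs x by (simp only: lin S')
    show "dual_map k f (c *\<^sub>C x) $$ (r, s) = (c \<cdot>\<^sub>m dual_map k f x) $$ (r, s)"
      using rs by (simp add: dual_map_def 1 2 complex_eq_iff algebra_simps)
  qed (auto simp: dual_map_def)
qed

lemma sum_fun_apply:
  fixes f :: "'i \<Rightarrow> 'a \<Rightarrow> 'b::comm_monoid_add"
  shows "sum f A x = (\<Sum>i\<in>A. f i x)"
  by (induction A rule: infinite_finite_induct) auto

text \<open>One half of the duality: splitting \<open>Y\<close> into elementary matrices recovers
  \<open>f\<close> from its map.\<close>

lemma Re_block_form_dual_map:
  assumes S: "operator_system S" and f: "linear_functional_on (mat_space k S) f" and Y: "Y \<in> mat_space k S"
  shows "Re (block_form k k (dual_map k f) Y unit_fun) = f Y"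
proof -
  have V: "subspace (mat_space k S)"
    by (rule subspace_mat_space[OF S])
  have YS: "elem r s (Y r s) \<in> mat_space k S" if "r < k" "s < k" for r s
    using Y that by (intro elem_mat_space[OF S]) (auto simp: mat_space_def)
  have Y_entry: "Y i j = (\<Sum>r<k. \<Sum>s<k. elem r s (Y r s) i j)" for i j
  proof -
    have *: "(\<Sum>s<k. elem r s (Y r s) i j) = (if r = i \<and> j < k then Y i j else 0)" for r
      by (auto simp: elem_def sum.delta')
    show ?thesis
      using Y unfolding * by (cases "j < k") (auto simp: mat_space_def sum.delta)
  qed
  have "Y = (\<Sum>r<k. \<Sum>s<k. elem r s (Y r s))"
    by (intro ext) (simp only: sum_fun_apply Y_entry[symmetric])
  then have "f Y = f (\<Sum>r<k. \<Sum>s<k. elem r s (Y r s))"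
    by simp
  also have "\<dots> = (\<Sum>r<k. f (\<Sum>s<k. elem r s (Y r s)))"
    using YS by (intro linear_functional_on_sum[OF V f] subspace_sum[OF V]) auto
  also have "\<dots> = (\<Sum>r<k. \<Sum>s<k. f (elem r s (Y r s)))"
    using YS by (intro sum.cong refl linear_functional_on_sum[OF V f]) auto
  finally show ?thesis
    by (simp add: block_form_def sform_unit_fun dual_map_def)
qed

lemma linear_functional_block_form:
  assumes S: "operator_system S" and \<phi>: "mat_linear_on S k \<phi>"
  shows "linear_functional_on (mat_space k S) (\<lambda>Y. Re (block_form k k \<phi> Y unit_fun))"
  unfolding linear_functional_on_def
proof (intro conjI ballI allI)
  fix X Y r
  assume X: "X \<in> mat_space k S"
  show "Re (block_form k k \<phi> (X + Y) unit_fun)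
      = Re (block_form k k \<phi> X unit_fun) + Re (block_form k k \<phi> Y unit_fun)"
    if "Y \<in> mat_space k S"
  proof -
    have "X + Y = (\<lambda>p q. X p q + Y p q)"
      by (simp add: fun_eq_iff)
    then show ?thesis
      using block_form_add[OF \<phi>, of k X Y] X that by (simp add: mat_space_def)
  qed
  show "Re (block_form k k \<phi> (r *\<^sub>R X) unit_fun) = r * Re (block_form k k \<phi> X unit_fun)"
  proof -
    have "r *\<^sub>R X = (\<lambda>p q. complex_of_real r *\<^sub>C X p q)"
      by (simp add: fun_eq_iff scaleC_complex_of_real)
    then show ?thesis
      using block_form_scaleC[OF \<phi>, of k X "complex_of_real r"] X by (simp add: mat_space_def)
  qed
qed

text \<open>The other half, up to a factor: elementary matrices with entry \<open>x\<close> test the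
  real parts of \<open>\<phi> x\<close>, those with entry \<open>i x\<close> the imaginary
  parts.\<close>

lemma dual_map_unique:
  assumes S: "operator_system S" and \<phi>: "mat_linear_on S k \<phi>"
    and f: "linear_functional_on (mat_space k S) f"
    and eq: "\<And>Y. Y \<in> mat_space k S \<Longrightarrow> Re (block_form k k \<phi> Y unit_fun) = t * f Y"
    and x: "x \<in> S"
  shows "\<phi> x = complex_of_real t \<cdot>\<^sub>m dual_map k f x"
proof (rule eq_matI)
  fix r s assume "r < dim_row (complex_of_real t \<cdot>\<^sub>m dual_map k f x)" "s < dim_col (complex_of_real t \<cdot>\<^sub>m dual_map k f x)"
  then have rs: "r < k" "s < k"
    by (auto simp: dual_map_def)
  have entry: "Re (\<phi> y $$ (r, s)) = t * f (elem r s y)" if "y \<in> S" for y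
  proof -
    have "block_form k k \<phi> (elem r s y) unit_fun = (\<Sum>p<k. \<Sum>q<k. if p = r \<and> q = s then \<phi> y $$ (r, s) else 0)"
      unfolding block_form_def
      by (intro sum.cong refl) (auto simp: sform_unit_fun elem_def mat_linear_on_zero[OF S \<phi>])
    also have "\<dots> = (\<Sum>p<k. if p = r then \<phi> y $$ (r, s) else 0)"
      using rs by (intro sum.cong refl) (auto simp: sum.delta)
    also have "\<dots> = \<phi> y $$ (r, s)"
      using rs by (simp add: sum.delta)
    finally show ?thesis
      using eq[OF elem_mat_space[OF S that rs]] by simp
  qed
  have "\<phi> (\<i> *\<^sub>C x) $$ (r, s) = \<i> * \<phi> x $$ (r, s)"
    using mat_linear_onD(1,3)[OF \<phi> x] rs by simp
  then show "\<phi> x $$ (r, s) = (complex_of_real t \<cdot>\<^sub>m dual_map k f x) $$ (r, s)"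
    using entry[OF x] entry[of "\<i> *\<^sub>C x"] x rs operator_systemD(4)[OF S x, of \<i>]
    by (simp add: dual_map_def complex_eq_iff)
qed (use mat_linear_onD(1)[OF \<phi> x] in \<open>auto simp: dual_map_def\<close>)

text \<open>Complete positivity phrased with real parts, the form in which positive functionals on
  \<open>mat_cone\<close> deliver it; \<open>re_cp_real\<close> and \<open>UCP_re_cp\<close> connect
  it with the usual notion.\<close>

definition re_cp :: "'a::unital_cstar_algebra set \<Rightarrow> nat \<Rightarrow> ('a \<Rightarrow> complex mat) \<Rightarrow> bool" where
  "re_cp S k \<phi> \<longleftrightarrow> (\<forall>m X w. (\<forall>p<m. \<forall>q<m. X p q \<in> S) \<longrightarrow> re_pos m X \<longrightarrow> 0 \<le> Re (block_form m k \<phi> X w))"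

lemma re_cpD:
  assumes "re_cp S k \<phi>" "\<And>p q. p < m \<Longrightarrow> q < m \<Longrightarrow> X p q \<in> S" "re_pos m X"
  shows "0 \<le> Re (block_form m k \<phi> X w)"
  using assms(1)[unfolded re_cp_def, rule_format, of m X w] assms(2,3) by simp

text \<open>For positive \<open>X\<close> both \<open>i X\<close> and \<open>- i X\<close> have real
  part zero, and the condition at these two pins the imaginary part of the form.\<close>

lemma re_cp_real:
  assumes S: "operator_system S" and \<phi>: "mat_linear_on S k \<phi>" and cp: "re_cp S k \<phi>"
    and X: "\<And>p q. p < m \<Longrightarrow> q < m \<Longrightarrow> X p q \<in> S" and pos: "mpos m X"
  shows "Im (block_form m k \<phi> X w) = 0" "0 \<le> Re (block_form m k \<phi> X w)"
proof -
  have "0 \<le> Re (block_form m k \<phi> (\<lambda>p q. c *\<^sub>C X p q) w)" if "c = \<i> \<or> c = - \<i>" for c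
    using X by (intro re_cpD[OF cp] re_pos_of_mpos_ii[OF pos that] operator_systemD(4)[OF S])
  from this[of \<i>] this[of "- \<i>"] show "Im (block_form m k \<phi> X w) = 0"
    by (simp add: block_form_scaleC[OF \<phi> X])
  show "0 \<le> Re (block_form m k \<phi> X w)"
    by (rule re_cpD[OF cp X re_pos_of_mpos[OF pos]])
qed

section \<open>Null vectors, invertible factors and scaled isometries\<close>

lemma nonneg_affine_slope_zero:
  fixes a b :: real
  assumes "\<And>r. 0 \<le> a + r * b" shows "b = 0"
proof (rule ccontr)
  assume "b \<noteq> 0"
  then show False
    using assms[of "- (a + 1) / b"] by simp
qed

text \<open>A Cauchy--Schwarz argument: the 2 x 2 matrix with diagonal \<open>t\<close> and
  off-diagonal entries \<open>- a\<close>, \<open>- b\<close> has positive real part for large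
  \<open>t\<close>. At the blocks \<open>u\<close> and \<open>z v\<close> the quadratic term in
  \<open>z\<close> drops out since \<open>v\<close> is null for \<open>\<phi> 1\<close>, and a form
  that is affine in \<open>z\<close> and bounded below has slope zero.\<close>

lemma null_vector:
  assumes S: "operator_system S" and \<phi>: "mat_linear_on S k \<phi>" and cp: "re_cp S k \<phi>"
    and null: "\<And>r. r < k \<Longrightarrow> mat_app k (\<phi> 1) v r = 0" and x: "x \<in> S"
  shows "sform k (\<phi> x) u v = 0" "sform k (\<phi> x) v u = 0"
proof -
  note S' = operator_systemD[OF S]
  have G: "sform k (\<phi> 1) u' v = 0" for u'
  proof -
    have "sform k (\<phi> 1) u' v = (\<Sum>r<k. cnj (u' r) * mat_app k (\<phi> 1) v r)"
      by (simp add: sform_def mat_app_def sum_distrib_left mult.assoc)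
    then show ?thesis
      by (simp add: null)
  qed
  have key: "\<exists>c. \<forall>z. 0 \<le> c - Re (z * sform k (\<phi> a) u v) - Re (cnj z * sform k (\<phi> b) v u)"
    if ab: "a \<in> S" "b \<in> S" for a b
  proof -
    define X where "X i j = (if i = 0 \<and> j = Suc 0 then a else if i = Suc 0 \<and> j = 0 then b else 0)" for i j :: nat
    have "X \<in> mat_space 2 S"
      using ab by (auto simp: X_def mat_space_def S')
    then obtain t where t: "t *\<^sub>R mat_unit 2 - X \<in> mat_cone 2 S"
      using order_unit_cone.order_unit[OF order_unit_cone_mat_cone[OF S, of 2]] by auto
    show ?thesis
    proof (intro exI allI)
      fix z
      define w where "w p = (if p = 0 then u else (\<lambda>s. z * v s))" for p :: nat
      have "0 \<le> Re (block_form 2 k \<phi> (t *\<^sub>R mat_unit 2 - X) w)"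
        using t by (intro re_cpD[OF cp]) (simp_all add: mat_cone_def mat_space_def)
      also have "block_form 2 k \<phi> (t *\<^sub>R mat_unit 2 - X) w
         = sform k (\<phi> (complex_of_real t *\<^sub>C 1)) u u + sform k (\<phi> ((-1) *\<^sub>C a)) u (\<lambda>s. z * v s)
         + sform k (\<phi> ((-1) *\<^sub>C b)) (\<lambda>s. z * v s) u + sform k (\<phi> (complex_of_real t *\<^sub>C 1)) (\<lambda>s. z * v s) (\<lambda>s. z * v s)"
        by (simp add: block_form_def numeral_2_eq_2 w_def mat_unit_def X_def scaleC_complex_of_real scaleC_minus_left)
      also have "\<dots> = complex_of_real t * sform k (\<phi> 1) u u - z * sform k (\<phi> a) u v - cnj z * sform k (\<phi> b) v u"
        using mat_linear_onD(1)[OF \<phi>] ab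
        by (simp add: mat_linear_onD(3)[OF \<phi>] S' sform_smult sform_scale_left sform_scale_right G)
      finally show "0 \<le> Re (complex_of_real t * sform k (\<phi> 1) u u) - Re (z * sform k (\<phi> a) u v) - Re (cnj z * sform k (\<phi> b) v u)"
        by simp
    qed
  qed
  have z0: "sform k (\<phi> 0) u' v' = 0" for u' v'
    by (simp add: mat_linear_on_zero[OF S \<phi>] sform_def)
  have sq: "z = 0" if "\<And>r. 0 \<le> c - Re (complex_of_real r * cnj z * z)" for z c
  proof -
    have "Re (complex_of_real r * cnj z * z) = r * (cmod z)\<^sup>2" for r
      by (simp only: cmod_power2) (simp add: power2_eq_square algebra_simps)
    then have "- ((cmod z)\<^sup>2) = 0"
      using that by (intro nonneg_affine_slope_zero[of c]) (simp only:, simp)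
    then show ?thesis
      by simp
  qed
  \<comment> \<open>One off-diagonal entry is set to 0, and \<open>z\<close> runs through the real
    multiples of the conjugate of the value that is to vanish.\<close>
  obtain c where c: "\<forall>z. 0 \<le> c - Re (z * sform k (\<phi> x) u v) - Re (cnj z * sform k (\<phi> 0) v u)"
    using key[OF x S'(2)] by blast
  show "sform k (\<phi> x) u v = 0"
  proof (rule sq[of c])
    fix r
    show "0 \<le> c - Re (complex_of_real r * cnj (sform k (\<phi> x) u v) * sform k (\<phi> x) u v)"
      using c[rule_format, of "complex_of_real r * cnj (sform k (\<phi> x) u v)"] by (simp add: z0)
  qed
  obtain c where c: "\<forall>z. 0 \<le> c - Re (z * sform k (\<phi> 0) u v) - Re (cnj z * sform k (\<phi> x) v u)"
    using key[OF S'(2) x] by blast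
  show "sform k (\<phi> x) v u = 0"
  proof (rule sq[of c])
    fix r
    show "0 \<le> c - Re (complex_of_real r * cnj (sform k (\<phi> x) v u) * sform k (\<phi> x) v u)"
      using c[rule_format, of "complex_of_real r * sform k (\<phi> x) v u"] by (simp add: z0)
  qed
qed

lemma sum_drop_index:
  fixes g :: "nat \<Rightarrow> 'a::comm_monoid_add"
  assumes "j < Suc k" "g j = 0"
  shows "(\<Sum>r<k. if r = j then g k else g r) = (\<Sum>r<Suc k. g r)"
proof (cases "j = k")
  case True
  then show ?thesis
    using assms by simp
next
  case False
  then have j: "j \<in> {..<k}"
    using assms by simp
  have "(\<Sum>r<k. if r = j then g k else g r) = g k + (\<Sum>r\<in>{..<k} - {j}. if r = j then g k else g r)"
    using sum.remove[OF finite_lessThan j, of "\<lambda>r. if r = j then g k else g r"] by simp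
  also have "(\<Sum>r\<in>{..<k} - {j}. if r = j then g k else g r) = (\<Sum>r\<in>{..<k} - {j}. g r)"
    by (intro sum.cong) auto
  also have "(\<Sum>r\<in>{..<k} - {j}. g r) = (\<Sum>r<k. g r)"
    using sum.remove[OF finite_lessThan j, of g] assms(2) by simp
  finally show ?thesis
    by (simp add: add.commute)
qed

text \<open>The last column moves into the place of the zero column \<open>j\<close>, both in
  \<open>w\<close> and in the test column \<open>a\<close>; for \<open>j = k\<close> this is mere
  truncation.\<close>

lemma compress_drop_index:
  assumes "j < Suc k" "\<And>p. w p j = 0" "\<not> re_pos (Suc k) (compress n (Suc k) w X)"
  shows "\<exists>w'. \<not> re_pos k (compress n k w' X)"
proof -
  obtain a where a: "\<not> cstar_pos (qform n X (\<lambda>p. \<Sum>r<Suc k. w p r *\<^sub>C a r) + star (qform n X (\<lambda>p. \<Sum>r<Suc k. w p r *\<^sub>C a r)))"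
    using assms(3) unfolding re_pos_def qform_compress by blast
  define w' a' where "w' p r = (if r = j then w p k else w p r)" and "a' r = (if r = j then a k else a r)" for p r
  have "(\<Sum>r<k. w' p r *\<^sub>C a' r) = (\<Sum>r<Suc k. w p r *\<^sub>C a r)" for p
  proof -
    have "(\<Sum>r<k. w' p r *\<^sub>C a' r) = (\<Sum>r<k. if r = j then w p k *\<^sub>C a k else w p r *\<^sub>C a r)"
      by (intro sum.cong) (auto simp: w'_def a'_def)
    also have "\<dots> = (\<Sum>r<Suc k. w p r *\<^sub>C a r)"
      using assms by (intro sum_drop_index) auto
    finally show ?thesis .
  qed
  then have *: "(\<lambda>p. \<Sum>r<k. w' p r *\<^sub>C a' r) = (\<lambda>p. \<Sum>r<Suc k. w p r *\<^sub>C a r)"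
    by (rule ext)
  have "\<not> re_pos k (compress n k w' X)"
  proof
    assume "re_pos k (compress n k w' X)"
    from this[unfolded re_pos_def qform_compress, rule_format, of a']
    show False
      using a unfolding * by contradiction
  qed
  then show ?thesis
    by blast
qed

lemma mat_app_vec:
  assumes "M \<in> carrier_mat k k" "r < k"
  shows "(M *\<^sub>v vec k v) $ r = mat_app k M v r"
  using assms by (simp add: mat_app_def scalar_prod_def atLeast0LessThan)

lemma mat_star_one [simp]: "mat_star (1\<^sub>m k) = (1\<^sub>m k :: complex mat)"
  by (rule eq_matI) (auto simp: mat_star_def star_complex_def)

text \<open>The complex numbers are themselves a C*-algebra, so the factorization
  \<open>Y* Y\<close> comes from \<open>mat_positive_iff_mpos\<close>; a null vector of
  \<open>Y\<close> would be one of \<open>G\<close>.\<close>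

lemma posdef_factor:
  fixes G :: "complex mat"
  assumes G: "G \<in> carrier_mat k k"
    and pos: "\<And>v. Im (sform k G v v) = 0" "\<And>v. 0 \<le> Re (sform k G v v)"
    and inj: "\<forall>v. (\<forall>r<k. mat_app k G v r = 0) \<longrightarrow> (\<forall>r<k. v r = 0)"
  obtains Y Z where "Y \<in> carrier_mat k k" "Z \<in> carrier_mat k k" "G = mat_star Y * Y"
    "Y * Z = 1\<^sub>m k" "Z * Y = 1\<^sub>m k"
proof -
  have "mat_positive k G"
    by (simp add: mat_positive_iff_mpos[OF G] mpos_def cstar_pos_complex qform_complex pos)
  then obtain Y where Y: "Y \<in> carrier_mat k k" "G = mat_star Y * Y"
    by (auto simp: mat_positive_def)
  have "det Y \<noteq> 0"
  proof
    assume "det Y = 0"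
    then obtain v where v: "v \<in> carrier_vec k" "v \<noteq> 0\<^sub>v k" "Y *\<^sub>v v = 0\<^sub>v k"
      using det_0_iff_vec_prod_zero_field[OF Y(1)] by blast
    have "G *\<^sub>v v = mat_star Y *\<^sub>v (Y *\<^sub>v v)"
      unfolding Y(2) by (rule assoc_mult_mat_vec[OF mat_star_carrier[OF Y(1)] Y(1) v(1)])
    also have "\<dots> = 0\<^sub>v k"
      using mat_star_carrier[OF Y(1)] unfolding v(3) by (intro eq_vecI) auto
    finally have Gv: "G *\<^sub>v v = 0\<^sub>v k" .
    have "vec k (vec_index v) = v"
      using v(1) by (intro eq_vecI) auto
    then have "mat_app k G (vec_index v) r = 0" if "r < k" for r
      using mat_app_vec[OF G that, of "vec_index v"] Gv that by simp
    then have "v = 0\<^sub>v k"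
      using inj[rule_format, of "vec_index v"] v(1) by (intro eq_vecI) auto
    then show False
      using v(2) by simp
  qed
  from det_non_zero_imp_unit[OF Y(1) this, of undefined]
  obtain Z where "Z \<in> carrier_mat k k" "Z * Y = 1\<^sub>m k" "Y * Z = 1\<^sub>m k"
    by (auto simp: Units_def ring_mat_def)
  then show thesis
    using Y that by blast
qed

lemma mat_linear_on_conj:
  assumes \<phi>: "mat_linear_on S m \<phi>" and Z: "Z \<in> carrier_mat m k"
  shows "mat_linear_on S k (\<lambda>x. mat_star Z * \<phi> x * Z)"
proof -
  note Z' = mat_star_carrier[OF Z]
  show ?thesis
    unfolding mat_linear_on_def
  proof (intro conjI ballI allI)
    fix x assume x: "x \<in> S"
    note c = mat_linear_onD(1)[OF \<phi>]
    show "mat_star Z * \<phi> x * Z \<in> carrier_mat k k"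
      using Z Z' c[OF x] by (meson mult_carrier_mat)
    show "mat_star Z * \<phi> (x + y) * Z = mat_star Z * \<phi> x * Z + mat_star Z * \<phi> y * Z" if "y \<in> S" for y
      using mult_add_distrib_mat[OF Z' c[OF x] c[OF that]]
        add_mult_distrib_mat[OF mult_carrier_mat[OF Z' c[OF x]] mult_carrier_mat[OF Z' c[OF that]] Z]
      by (simp add: mat_linear_onD(2)[OF \<phi> x that])
    show "mat_star Z * \<phi> (a *\<^sub>C x) * Z = a \<cdot>\<^sub>m (mat_star Z * \<phi> x * Z)" for a
      using mult_smult_distrib[OF Z' c[OF x]] mult_smult_assoc_mat[OF mult_carrier_mat[OF Z' c[OF x]] Z]
      by (simp add: mat_linear_onD(3)[OF \<phi> x])
  qed
qed

lemma block_form_conj: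
  assumes \<phi>: "mat_linear_on S m \<phi>" and Z: "Z \<in> carrier_mat m k"
    and X: "\<And>p q. p < n \<Longrightarrow> q < n \<Longrightarrow> X p q \<in> S"
  shows "block_form n k (\<lambda>x. mat_star Z * \<phi> x * Z) X w = block_form n m \<phi> X (\<lambda>p. mat_app k Z (w p))"
  using X mat_linear_onD(1)[OF \<phi>] by (simp add: block_form_def sform_conj[OF Z])

lemma re_cp_conj:
  assumes "mat_linear_on S m \<phi>" "re_cp S m \<phi>" "Z \<in> carrier_mat m k"
  shows "re_cp S k (\<lambda>x. mat_star Z * \<phi> x * Z)"
  unfolding re_cp_def
proof (intro allI impI)
  fix n w and X :: "nat \<Rightarrow> nat \<Rightarrow> 'a"
  assume X: "\<forall>p<n. \<forall>q<n. X p q \<in> S" and pos: "re_pos n X"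
  then show "0 \<le> Re (block_form n k (\<lambda>x. mat_star Z * \<phi> x * Z) X w)"
    using block_form_conj[OF assms(1,3), of n X w] re_cpD[OF assms(2), of n X] by simp
qed

lemma UCP_of_re_cp:
  assumes S: "operator_system S" and \<phi>: "mat_linear_on S k \<phi>" "re_cp S k \<phi>" "\<phi> 1 = 1\<^sub>m k"
  shows "\<phi> \<in> UCP S k"
proof -
  have "mat_positive (n * k) (amplify n k \<phi> X)" if "X \<in> mats_over n S" "mat_positive n X" for n X
  proof -
    have "mpos n (\<lambda>i j. X $$ (i, j))"
      using that mat_positive_iff_mpos by (auto simp: mats_over_def)
    then show ?thesis
      unfolding mat_positive_amplify_iff
      using re_cp_real[OF S \<phi>(1,2), of n "\<lambda>i j. X $$ (i, j)"] that(1) by (auto simp: mats_over_def)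
  qed
  then show ?thesis
    using \<phi> unfolding UCP_def mat_linear_on_def by blast
qed

text \<open>Surjectivity gives a right inverse \<open>D\<close>, and
  \<open>mat_star \<gamma> = t D\<close> follows, so the rows of \<open>\<gamma>\<close> are
  orthogonal with squared length \<open>t\<close> as well. Summing all squared entries by columns
  and by rows gives \<open>k t = m t\<close>. If \<open>t\<close> were 0, \<open>\<gamma>\<close>
  would vanish, against \<open>\<gamma> D = 1\<close>.\<close>

lemma surjective_scaled_isometry:
  assumes \<gamma>: "surjective_mat m k \<gamma>" and iso: "mat_star \<gamma> * \<gamma> = complex_of_real t \<cdot>\<^sub>m 1\<^sub>m k"
    and mk: "0 < m" "0 < k"
  shows "m = k" "0 < t" "\<gamma> * mat_star \<gamma> = complex_of_real t \<cdot>\<^sub>m 1\<^sub>m k"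
proof -
  have G: "\<gamma> \<in> carrier_mat m k" and surj: "(\<lambda>v. \<gamma> *\<^sub>v v) ` carrier_vec k = carrier_vec m"
    using \<gamma> by (auto simp: surjective_mat_def)
  note G' = mat_star_carrier[OF G]
  have "\<exists>v. v \<in> carrier_vec k \<and> \<gamma> *\<^sub>v v = unit_vec m b" for b
  proof -
    have "unit_vec m b \<in> (\<lambda>v. \<gamma> *\<^sub>v v) ` carrier_vec k"
      unfolding surj by simp
    then show ?thesis by auto
  qed
  then obtain c where c: "\<And>b. c b \<in> carrier_vec k" "\<And>b. \<gamma> *\<^sub>v c b = unit_vec m b"
    by metis
  define D where "D = mat k m (\<lambda>(a, b). c b $ a)"
  have D: "D \<in> carrier_mat k m"
    by (simp add: D_def)
  have GD: "\<gamma> * D = 1\<^sub>m m"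
  proof (rule eq_matI)
    fix a b assume "a < dim_row (1\<^sub>m m)" "b < dim_col (1\<^sub>m m)"
    then have ab: "a < m" "b < m" by auto
    have "col D b = c b"
      using c(1)[of b] ab by (intro eq_vecI) (auto simp: D_def)
    then have "(\<gamma> * D) $$ (a, b) = (\<gamma> *\<^sub>v c b) $ a"
      using G D ab by simp
    then show "(\<gamma> * D) $$ (a, b) = 1\<^sub>m m $$ (a, b)"
      using c(2)[of b] ab by simp
  qed (use G D in auto)
  have "mat_star \<gamma> = mat_star \<gamma> * (\<gamma> * D)"
    using G' by (simp add: GD)
  also have "\<dots> = mat_star \<gamma> * \<gamma> * D"
    by (rule assoc_mult_mat[OF G' G D, symmetric])
  also have "\<dots> = complex_of_real t \<cdot>\<^sub>m D"
    unfolding iso using mult_smult_assoc_mat[OF one_carrier_mat D] D by simp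
  finally have sD: "mat_star \<gamma> = complex_of_real t \<cdot>\<^sub>m D" .
  have coiso: "\<gamma> * mat_star \<gamma> = complex_of_real t \<cdot>\<^sub>m 1\<^sub>m m"
    unfolding sD using mult_smult_distrib[OF G D] by (simp add: GD)
  have t_col: "t = (\<Sum>a<m. (cmod (\<gamma> $$ (a, b)))\<^sup>2)" if "b < k" for b
  proof -
    have "complex_of_real t = (mat_star \<gamma> * \<gamma>) $$ (b, b)"
      unfolding iso using that by simp
    also have "\<dots> = (\<Sum>a<m. complex_of_real ((cmod (\<gamma> $$ (a, b)))\<^sup>2))"
      using that complex_norm_square
      by (simp add: mult_mat_index[OF G' G] mat_star_index[OF G] star_complex_def mult.commute del: index_mult_mat)
    finally show ?thesis
      by (metis of_real_eq_iff of_real_sum)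
  qed
  have t_row: "t = (\<Sum>b<k. (cmod (\<gamma> $$ (a, b)))\<^sup>2)" if "a < m" for a
  proof -
    have "complex_of_real t = (\<gamma> * mat_star \<gamma>) $$ (a, a)"
      unfolding coiso using that by simp
    also have "\<dots> = (\<Sum>b<k. complex_of_real ((cmod (\<gamma> $$ (a, b)))\<^sup>2))"
      using that complex_norm_square
      by (simp add: mult_mat_index[OF G G'] mat_star_index[OF G] star_complex_def mult.commute del: index_mult_mat)
    finally show ?thesis
      by (metis of_real_eq_iff of_real_sum)
  qed
  have "t \<noteq> 0"
  proof
    assume "t = 0"
    then have "(1\<^sub>m m :: complex mat) $$ (0, 0) = (\<gamma> * D) $$ (0, 0)"
      by (simp add: GD)
    also have "\<dots> = (\<Sum>b<k. \<gamma> $$ (0, b) * D $$ (b, 0))"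
      using mk by (intro mult_mat_index[OF G D]) auto
    also have "\<dots> = 0"
    proof (rule sum.neutral, rule ballI)
      fix b assume "b \<in> {..<k}"
      then have "(cmod (\<gamma> $$ (0, b)))\<^sup>2 = 0"
        using t_row[OF mk(1)] \<open>t = 0\<close> sum_nonneg_eq_0_iff[of "{..<k}" "\<lambda>b. (cmod (\<gamma> $$ (0, b)))\<^sup>2"] by simp
      then show "\<gamma> $$ (0, b) * D $$ (b, 0) = 0"
        by simp
    qed
    finally show False
      using mk by simp
  qed
  moreover have "0 \<le> t"
    unfolding t_col[OF mk(2)] by (intro sum_nonneg) simp
  ultimately show "0 < t"
    by simp
  have "real k * t = (\<Sum>b<k. t)"
    by simp
  also have "\<dots> = (\<Sum>b<k. \<Sum>a<m. (cmod (\<gamma> $$ (a, b)))\<^sup>2)"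
    by (intro sum.cong refl t_col) simp
  also have "\<dots> = (\<Sum>a<m. \<Sum>b<k. (cmod (\<gamma> $$ (a, b)))\<^sup>2)"
    by (rule sum.swap)
  also have "\<dots> = (\<Sum>a<m. t)"
    by (intro sum.cong refl t_row[symmetric]) simp
  also have "\<dots> = real m * t"
    by simp
  finally show "m = k"
    using \<open>0 < t\<close> by simp
  then show "\<gamma> * mat_star \<gamma> = complex_of_real t \<cdot>\<^sub>m 1\<^sub>m k"
    using coiso by simp
qed

subsection \<open>Matrix extreme points\<close>

text \<open>Supplies the margin \<open>d\<close> that \<open>pure_state_exists\<close> asks
  for.\<close>

lemma not_re_pos_archimedean:
  assumes "\<not> re_pos n X"
  shows "\<exists>d>0. \<not> re_pos n (X + d *\<^sub>R mat_unit n)"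
proof (rule ccontr)
  assume "\<not> (\<exists>d>0. \<not> re_pos n (X + d *\<^sub>R mat_unit n))"
  then have *: "re_pos n (X + d *\<^sub>R mat_unit n)" if "d > 0" for d
    using that by blast
  have "cstar_pos (qform n X a + star (qform n X a))" for a
  proof (rule cstar_pos_archimedean)
    fix d :: real assume "d > 0"
    from *[OF this] have "cstar_pos (qform n (X + d *\<^sub>R mat_unit n) a + star (qform n (X + d *\<^sub>R mat_unit n) a))"
      unfolding re_pos_def by blast
    then show "cstar_pos (qform n X a + star (qform n X a) + d *\<^sub>R (2 *\<^sub>R ip n a a))"
      by (simp add: qform_add qform_scaleR qform_mat_unit star_add star_scaleR star_ip_self scaleR_2
          scaleR_add_right add_ac)
  qed
  then show False
    using assms by (simp add: re_pos_def)
qed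

lemma conj_cancel:
  fixes A :: "complex mat"
  assumes A: "A \<in> carrier_mat k k" and Y: "Y \<in> carrier_mat k k" and Z: "Z \<in> carrier_mat k k"
    and ZY: "Z * Y = 1\<^sub>m k"
  shows "mat_star Y * (mat_star Z * A * Z) * Y = A"
proof -
  note Y' = mat_star_carrier[OF Y] and Z' = mat_star_carrier[OF Z]
  note ZA = mult_carrier_mat[OF Z' A]
  have "mat_star Y * (mat_star Z * A * Z) * Y = mat_star Y * (mat_star Z * A * Z * Y)"
    by (rule assoc_mult_mat[OF Y' mult_carrier_mat[OF ZA Z] Y])
  also have "mat_star Z * A * Z * Y = mat_star Z * A * (Z * Y)"
    by (rule assoc_mult_mat[OF ZA Z Y])
  also have "mat_star Z * A * (Z * Y) = mat_star Z * A"
    unfolding ZY by (rule right_mult_one_mat[OF ZA])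
  also have "mat_star Y * (mat_star Z * A) = (mat_star Y * mat_star Z) * A"
    by (rule assoc_mult_mat[OF Y' Z' A, symmetric])
  also have "mat_star Y * mat_star Z = 1\<^sub>m k"
    using mat_star_mult[OF Z Y] by (simp add: ZY)
  finally show ?thesis
    using A by simp
qed

lemma mat_star_smult:
  fixes A :: "complex mat"
  assumes "A \<in> carrier_mat m k"
  shows "mat_star (c \<cdot>\<^sub>m A) = cnj c \<cdot>\<^sub>m mat_star A"
  using assms by (intro eq_matI) (auto simp: mat_star_def star_complex_def)

lemma smult_smult_mat: "a \<cdot>\<^sub>m (b \<cdot>\<^sub>m A) = (a * b) \<cdot>\<^sub>m (A :: complex mat)"
  by (intro eq_matI) auto

lemma one_smult_mat: "1 \<cdot>\<^sub>m A = (A :: complex mat)"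
  by (intro eq_matI) auto

lemma unitary_of_scaled:
  assumes \<gamma>: "\<gamma> \<in> carrier_mat k k" and t: "0 < t"
    and iso: "mat_star \<gamma> * \<gamma> = complex_of_real t \<cdot>\<^sub>m 1\<^sub>m k" "\<gamma> * mat_star \<gamma> = complex_of_real t \<cdot>\<^sub>m 1\<^sub>m k"
  defines "u \<equiv> complex_of_real (1 / sqrt t) \<cdot>\<^sub>m \<gamma>"
  shows "unitary_mat k u"
    and "A \<in> carrier_mat k k \<Longrightarrow> mat_star u * A * u = complex_of_real (1 / t) \<cdot>\<^sub>m (mat_star \<gamma> * A * \<gamma>)"
proof -
  define c where "c = complex_of_real (1 / sqrt t)"
  have cc: "c * c = complex_of_real (1 / t)"
    using t by (simp add: c_def flip: of_real_mult)
  note \<gamma>' = mat_star_carrier[OF \<gamma>]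
  have u: "u = c \<cdot>\<^sub>m \<gamma>" and su: "mat_star u = c \<cdot>\<^sub>m mat_star \<gamma>"
    by (simp_all add: u_def c_def mat_star_smult[OF \<gamma>])
  have conj: "mat_star u * A * u = complex_of_real (1 / t) \<cdot>\<^sub>m (mat_star \<gamma> * A * \<gamma>)"
    if "A \<in> carrier_mat k k" for A
    unfolding su unfolding u
    using mult_smult_assoc_mat[OF \<gamma>' that, of c] mult_carrier_mat[OF \<gamma>' that] \<gamma>
      mult_smult_distrib[of "c \<cdot>\<^sub>m (mat_star \<gamma> * A)" k k \<gamma> k c]
      mult_smult_assoc_mat[OF mult_carrier_mat[OF \<gamma>' that] \<gamma>, of c]
    by (simp add: smult_smult_mat cc)
  then show "A \<in> carrier_mat k k \<Longrightarrow> mat_star u * A * u = complex_of_real (1 / t) \<cdot>\<^sub>m (mat_star \<gamma> * A * \<gamma>)"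
    by blast
  have uk: "u \<in> carrier_mat k k"
    using \<gamma> by (simp add: u)
  have "mat_star u * u = complex_of_real (1 / t) \<cdot>\<^sub>m (mat_star \<gamma> * \<gamma>)"
    using conj[OF one_carrier_mat]
    by (simp only: right_mult_one_mat[OF \<gamma>'] right_mult_one_mat[OF mat_star_carrier[OF uk]])
  also have "\<dots> = 1\<^sub>m k"
    unfolding iso(1) smult_smult_mat using t by (intro eq_matI) (auto simp flip: of_real_mult)
  finally have 1: "mat_star u * u = 1\<^sub>m k" .
  from uk show "unitary_mat k u"
    unfolding unitary_mat_def using 1 mat_mult_left_right_inverse[OF mat_star_carrier _ 1] by blast
qed

lemma sform_msum: "sform k (msum k l F) u v = (\<Sum>j<l. sform k (F j) u v)"
proof -
  have "sform k (msum k l F) u v = (\<Sum>r<k. \<Sum>s<k. \<Sum>j<l. cnj (u r) * F j $$ (r, s) * v s)"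
    by (simp add: sform_def msum_def sum_distrib_left sum_distrib_right)
  also have "\<dots> = (\<Sum>r<k. \<Sum>j<l. \<Sum>s<k. cnj (u r) * F j $$ (r, s) * v s)"
    by (intro sum.cong refl sum.swap)
  also have "\<dots> = (\<Sum>j<l. \<Sum>r<k. \<Sum>s<k. cnj (u r) * F j $$ (r, s) * v s)"
    by (rule sum.swap)
  finally show ?thesis
    by (simp add: sform_def)
qed

lemma block_form_cong:
  assumes "\<And>p q. p < n \<Longrightarrow> q < n \<Longrightarrow> \<phi> (X p q) = \<psi> (X p q)"
  shows "block_form n k \<phi> X w = block_form n k \<psi> X w"
  using assms by (simp add: block_form_def)

lemma block_form_msum:
  assumes "\<And>p q. p < n \<Longrightarrow> q < n \<Longrightarrow> \<phi> (X p q) = msum k l (\<lambda>j. \<psi> j (X p q))"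
  shows "block_form n k \<phi> X w = (\<Sum>j<l. block_form n k (\<psi> j) X w)"
proof -
  have "block_form n k \<phi> X w = (\<Sum>p<n. \<Sum>q<n. \<Sum>j<l. sform k (\<psi> j (X p q)) (w p) (w q))"
    using assms by (simp add: block_form_def sform_msum)
  also have "\<dots> = (\<Sum>p<n. \<Sum>j<l. \<Sum>q<n. sform k (\<psi> j (X p q)) (w p) (w q))"
    by (intro sum.cong refl sum.swap)
  also have "\<dots> = (\<Sum>j<l. \<Sum>p<n. \<Sum>q<n. sform k (\<psi> j (X p q)) (w p) (w q))"
    by (rule sum.swap)
  finally show ?thesis
    by (simp add: block_form_def)
qed

lemma UCP_re_cp: "operator_system S \<Longrightarrow> \<phi> \<in> UCP S k \<Longrightarrow> re_cp S k \<phi>"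
  unfolding re_cp_def using UCP_re_pos[of S \<phi> k] by blast

text \<open>
  A pure functional on \<open>k \<times> k\<close> matrices over \<open>S\<close> corresponds to \<open>x \<mapsto> Y\<^sup>* \<theta> x Y\<close> with \<open>\<theta>\<close> matrix
  extreme: a matrix convex decomposition of \<open>\<theta>\<close> decomposes \<open>f\<close>, whence every summand is a multiple
  of \<open>\<theta>\<close>.
\<close>
lemma matrix_extreme_of_pure:
  fixes S :: "'a::unital_cstar_algebra set"
  assumes S: "operator_system S" and k: "0 < k"
    and f: "order_unit_cone.positive_functional (mat_space k S) (mat_cone k S) f"
    and pure: "\<And>g h V. order_unit_cone.positive_functional (mat_space k S) (mat_cone k S) g \<Longrightarrow>
        order_unit_cone.positive_functional (mat_space k S) (mat_cone k S) h \<Longrightarrow>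
        (\<And>V. V \<in> mat_space k S \<Longrightarrow> g V + h V = f V) \<Longrightarrow> V \<in> mat_space k S \<Longrightarrow> g V = g (mat_unit k) * f V"
    and Y: "Y \<in> carrier_mat k k" and Z: "Z \<in> carrier_mat k k" and ZY: "Z * Y = 1\<^sub>m k" and YZ: "Y * Z = 1\<^sub>m k"
    and \<theta>: "\<theta> \<in> UCP S k" and D: "\<And>x. x \<in> S \<Longrightarrow> dual_map k f x = mat_star Y * \<theta> x * Y"
  shows "matrix_extreme S k \<theta>"
proof -
  interpret order_unit_cone "mat_space k S" "mat_cone k S" "mat_unit k"
    by (rule order_unit_cone_mat_cone[OF S k])
  have flin: "linear_functional_on (mat_space k S) f"
    using f by (simp add: positive_functional_def)
  note \<theta>lin = UCP_mat_linear_on[OF \<theta>]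
  have main: "m i = k \<and> (\<exists>u. unitary_mat k u \<and> (\<forall>x\<in>S. \<theta> x = mat_star u * \<psi> i x * u))"
    if a: "\<And>i. i < l \<Longrightarrow> 0 < m i" "\<And>i. i < l \<Longrightarrow> \<psi> i \<in> UCP S (m i)"
      "\<And>i. i < l \<Longrightarrow> surjective_mat (m i) k (\<gamma> i)"
      and dec: "\<And>x. x \<in> S \<Longrightarrow> \<theta> x = msum k l (\<lambda>i. mat_star (\<gamma> i) * \<psi> i x * \<gamma> i)" and i: "i < l"
    for l i and m :: "nat \<Rightarrow> nat" and \<psi> \<gamma>
  proof -
    have \<gamma>: "\<gamma> j \<in> carrier_mat (m j) k" if "j < l" for j
      using a(3)[OF that] by (simp add: surjective_mat_def)
    define \<Phi> where "\<Phi> j x = mat_star (\<gamma> j) * \<psi> j x * \<gamma> j" for j x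
    \<comment> \<open>\<open>\<Phi> j\<close> are the summands of the unital map; conjugation by
      \<open>Y\<close> undoes the normalization, so that the functionals of the
      \<open>\<Psi> j\<close> add up to \<open>f\<close>.\<close>
    define \<Psi> where "\<Psi> j x = mat_star Y * \<Phi> j x * Y" for j x
    have lin\<Phi>: "mat_linear_on S k (\<Phi> j)" if "j < l" for j
      unfolding \<Phi>_def by (rule mat_linear_on_conj[OF UCP_mat_linear_on[OF a(2)[OF that]] \<gamma>[OF that]])
    have lin\<Psi>: "mat_linear_on S k (\<Psi> j)" if "j < l" for j
      unfolding \<Psi>_def by (rule mat_linear_on_conj[OF lin\<Phi>[OF that] Y])
    have cp: "re_cp S k (\<Psi> j)" if "j < l" for j
    proof -
      have "re_cp S k (\<Phi> j)"
        unfolding \<Phi>_def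
        by (rule re_cp_conj[OF UCP_mat_linear_on[OF a(2)[OF that]] UCP_re_cp[OF S a(2)[OF that]] \<gamma>[OF that]])
      then show ?thesis
        unfolding \<Psi>_def by (rule re_cp_conj[OF lin\<Phi>[OF that] _ Y])
    qed
    define g where "g j V = Re (block_form k k (\<Psi> j) V unit_fun)" for j V
    have g_lin: "linear_functional_on (mat_space k S) (g j)" if "j < l" for j
      unfolding g_def by (rule linear_functional_block_form[OF S lin\<Psi>[OF that]])
    have g_nonneg: "0 \<le> g j V" if "j < l" "V \<in> mat_cone k S" for j V
      unfolding g_def using that(2) by (intro re_cpD[OF cp[OF that(1)]]) (auto simp: mat_cone_def mat_space_def)
    have g_sum: "f V = (\<Sum>j<l. g j V)" if V: "V \<in> mat_space k S" for V
    proof -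
      have VS: "V p q \<in> S" for p q
        using V by (simp add: mat_space_def)
      have "f V = Re (block_form k k (dual_map k f) V unit_fun)"
        by (rule Re_block_form_dual_map[OF S flin V, symmetric])
      also have "block_form k k (dual_map k f) V unit_fun
          = block_form k k (\<lambda>x. mat_star Y * \<theta> x * Y) V unit_fun"
        by (intro block_form_cong D VS)
      also have "\<dots> = block_form k k \<theta> V (\<lambda>p. mat_app k Y (unit_fun p))"
        by (rule block_form_conj[OF \<theta>lin Y VS])
      also have "\<dots> = (\<Sum>j<l. block_form k k (\<Phi> j) V (\<lambda>p. mat_app k Y (unit_fun p)))"
        by (rule block_form_msum) (simp add: \<Phi>_def dec[OF VS])
      also have "\<dots> = (\<Sum>j<l. block_form k k (\<Psi> j) V unit_fun)"
        unfolding \<Psi>_def by (intro sum.cong refl block_form_conj[OF lin\<Phi> Y VS, symmetric]) simp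
      finally show ?thesis
        by (simp add: g_def)
    qed
    define t where "t = g i (mat_unit k)"
    have g_eq: "g i V = t * f V" if V: "V \<in> mat_space k S" for V
      unfolding t_def
    proof (rule pure[OF _ _ _ V])
      show "positive_functional (g i)"
        using g_lin[OF i] g_nonneg[OF i] by (simp add: positive_functional_def)
      \<comment> \<open>The remainder is the sum of the functionals belonging to the other
        summands.\<close>
      show "positive_functional (\<lambda>V. f V - g i V)"
        unfolding positive_functional_def
      proof (intro conjI ballI)
        show "linear_functional_on (mat_space k S) (\<lambda>V. f V - g i V)"
          using flin g_lin[OF i] by (simp add: linear_functional_on_def algebra_simps)
        fix V assume V: "V \<in> mat_cone k S"
        then have "f V - g i V = (\<Sum>j\<in>{..<l} - {i}. g j V)"
          using g_sum[of V] i sum.remove[of "{..<l}" i "\<lambda>j. g j V"] by (simp add: mat_cone_def)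
        then show "0 \<le> f V - g i V"
          by (simp only:) (intro sum_nonneg g_nonneg[OF _ V], simp)
      qed
    qed simp
    have \<Psi>_eq: "\<Psi> i x = complex_of_real t \<cdot>\<^sub>m dual_map k f x" if "x \<in> S" for x
      using g_eq by (intro dual_map_unique[OF S lin\<Psi>[OF i] flin _ that]) (simp add: g_def)
    have \<Phi>_eq: "\<Phi> i x = complex_of_real t \<cdot>\<^sub>m \<theta> x" if x: "x \<in> S" for x
    proof -
      have \<theta>x: "\<theta> x \<in> carrier_mat k k" and \<Phi>x: "\<Phi> i x \<in> carrier_mat k k"
        using mat_linear_onD(1)[OF \<theta>lin x] mat_linear_onD(1)[OF lin\<Phi>[OF i] x] by auto
      note Y' = mat_star_carrier[OF Y]
      have "\<Psi> i x = mat_star Y * (complex_of_real t \<cdot>\<^sub>m \<theta> x) * Y"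
        unfolding \<Psi>_eq[OF x] D[OF x] mult_smult_distrib[OF Y' \<theta>x]
        by (rule mult_smult_assoc_mat[OF mult_carrier_mat[OF Y' \<theta>x] Y, symmetric])
      then have "mat_star Z * \<Psi> i x * Z = mat_star Z * (mat_star Y * (complex_of_real t \<cdot>\<^sub>m \<theta> x) * Y) * Z"
        by simp
      then show ?thesis
        using conj_cancel[OF \<Phi>x Z Y YZ] conj_cancel[of "complex_of_real t \<cdot>\<^sub>m \<theta> x", OF _ Z Y YZ] \<theta>x
        by (simp add: \<Psi>_def)
    qed
    have one: "\<theta> 1 = 1\<^sub>m k" "\<psi> i 1 = 1\<^sub>m (m i)"
      using \<theta> a(2)[OF i] by (auto simp: UCP_def)
    \<comment> \<open>Evaluation at 1, where both maps are unital, makes the coefficient a scaled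
      isometry; surjectivity then forces it to be a scaled unitary.\<close>
    have "mat_star (\<gamma> i) * \<gamma> i = complex_of_real t \<cdot>\<^sub>m 1\<^sub>m k"
      using \<Phi>_eq[OF operator_systemD(1)[OF S]] mat_star_carrier[OF \<gamma>[OF i]] by (simp add: \<Phi>_def one)
    note iso = this surjective_scaled_isometry[OF a(3)[OF i] this a(1)[OF i] k]
    have \<gamma>k: "\<gamma> i \<in> carrier_mat k k"
      using \<gamma>[OF i] iso(2) by simp
    note u = unitary_of_scaled[OF \<gamma>k iso(3) iso(1) iso(4)]
    have "\<theta> x = mat_star (complex_of_real (1 / sqrt t) \<cdot>\<^sub>m \<gamma> i) * \<psi> i x * (complex_of_real (1 / sqrt t) \<cdot>\<^sub>m \<gamma> i)"
      if x: "x \<in> S" for x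
    proof -
      have "\<psi> i x \<in> carrier_mat k k"
        using mat_linear_onD(1)[OF UCP_mat_linear_on[OF a(2)[OF i]] x] iso(2) by simp
      note u(2)[OF this]
      also have "complex_of_real (1 / t) \<cdot>\<^sub>m (mat_star (\<gamma> i) * \<psi> i x * \<gamma> i) = \<theta> x"
        using \<Phi>_eq[OF x] iso(3) mat_linear_onD(1)[OF \<theta>lin x]
        by (simp add: \<Phi>_def smult_smult_mat one_smult_mat flip: of_real_mult of_real_divide)
      finally show ?thesis
        by simp
    qed
    then show ?thesis
      using iso(2) u(1) by blast
  qed
  show ?thesis
    unfolding matrix_extreme_def
  proof (intro conjI allI impI \<theta>, goal_cases)
    case (1 l m \<psi> \<gamma> i)
    then show ?case using main[of l m \<psi> \<gamma> i] by blast
  next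
    case (2 l m \<psi> \<gamma> i)
    then show ?case using main[of l m \<psi> \<gamma> i] by blast
  qed
qed

subsection \<open>Order isomorphisms of subhomogeneous operator systems\<close>

text \<open>
  \<open>k\<close> is chosen minimal such that \<open>W\<^sup>* X W\<close> fails to be positive for some scalar \<open>n \<times> k\<close> matrix \<open>W\<close>.
  A null vector of \<open>dual_map k f 1\<close> would allow one to delete a column of \<open>W\<close>, so that
  \<open>dual_map k f 1\<close> is invertible.
\<close>
lemma not_re_pos_witness:
  assumes S: "operator_system S" and bound: "subhomogeneity_bound S N"
    and X: "\<And>p q. p < n \<Longrightarrow> q < n \<Longrightarrow> X p q \<in> S" and X_neg: "\<not> re_pos n X"
  obtains k \<theta> w where "0 < k" "k \<le> N" "\<theta> \<in> UCP S k" "Re (block_form n k \<theta> X w) < 0"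
proof -
  define P where "P k \<longleftrightarrow> (\<exists>w. \<not> re_pos k (compress n k w X))" for k
  have "P n"
  proof -
    have "(\<Sum>r<n. unit_fun p r *\<^sub>C a r) = a p" if "p < n" for p and a :: "nat \<Rightarrow> 'a"
    proof -
      have "(\<Sum>r<n. unit_fun p r *\<^sub>C a r) = (\<Sum>r<n. if r = p then a r else 0)"
        by (intro sum.cong) (auto simp: unit_fun_def)
      then show ?thesis
        using that by (simp add: sum.delta)
    qed
    then have "qform n X (\<lambda>p. \<Sum>r<n. unit_fun p r *\<^sub>C a r) = qform n X a" for a
      by (simp add: qform_def)
    then have "\<not> re_pos n (compress n n unit_fun X)"
      using X_neg by (simp add: re_pos_def qform_compress)
    then show ?thesis
      unfolding P_def by blast
  qed
  define k where "k = (LEAST k. P k)"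
  have Pk: "P k"
    unfolding k_def using \<open>P n\<close> by (rule LeastI)
  have min: "\<not> P j" if "j < k" for j
    using that not_less_Least unfolding k_def by blast
  obtain w where w: "\<not> re_pos k (compress n k w X)"
    using Pk by (auto simp: P_def)
  have k: "0 < k"
  proof (rule ccontr)
    assume "\<not> 0 < k"
    then show False
      using w by (simp add: re_pos_def qform_def)
  qed
  interpret order_unit_cone "mat_space k S" "mat_cone k S" "mat_unit k"
    by (rule order_unit_cone_mat_cone[OF S k])
  have X_mat_space: "compress n k w X \<in> mat_space k S" for w
    by (rule compress_mat_space[OF S X])
  obtain d where d: "d > 0" "compress n k w X + d *\<^sub>R mat_unit k \<notin> mat_cone k S"
    using not_re_pos_archimedean[OF w] by (auto simp: mat_cone_def)
  obtain f where f: "positive_functional f" "f (mat_unit k) = 1" "f (compress n k w X) < 0"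
    and pure: "\<And>g h V. positive_functional g \<Longrightarrow> positive_functional h \<Longrightarrow>
       (\<And>V. V \<in> mat_space k S \<Longrightarrow> g V + h V = f V) \<Longrightarrow> V \<in> mat_space k S \<Longrightarrow> g V = g (mat_unit k) * f V"
    using pure_state_exists[OF X_mat_space d] by blast
  define D where "D = dual_map k f"
  have flin: "linear_functional_on (mat_space k S) f"
    using f(1) by (simp add: positive_functional_def)
  have Dlin: "mat_linear_on S k D"
    unfolding D_def by (rule dual_map_linear[OF S flin])
  have fD: "Re (block_form m k D V w) = f (compress m k w V)" if "\<And>p q. p < m \<Longrightarrow> q < m \<Longrightarrow> V p q \<in> S" for m V w
    using block_form_compress[OF S Dlin that] Re_block_form_dual_map[OF S flin compress_mat_space[OF S that]]
    by (simp add: D_def)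
  have Dcp: "re_cp S k D"
    unfolding re_cp_def
  proof (intro allI impI)
    fix m w and V :: "nat \<Rightarrow> nat \<Rightarrow> 'a"
    assume V: "\<forall>p<m. \<forall>q<m. V p q \<in> S" and pos: "re_pos m V"
    then have "compress m k w V \<in> mat_cone k S"
      using compress_mat_space[OF S, of m V k w] re_pos_compress[OF pos] by (simp add: mat_cone_def)
    then show "0 \<le> Re (block_form m k D V w)"
      using fD[of m V w] V f(1) by (simp add: positive_functional_def)
  qed
  note S1 = operator_systemD(1)[OF S]
  have G: "D 1 \<in> carrier_mat k k"
    by (rule mat_linear_onD(1)[OF Dlin S1])
  have inj: "v j = 0" if null: "\<And>r. r < k \<Longrightarrow> mat_app k (D 1) v r = 0" and j: "j < k" for v j
  proof (rule ccontr)
    assume vj: "v j \<noteq> 0"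
    \<comment> \<open>A multiple of the null vector \<open>v\<close> is added to each row of
      \<open>W\<close> so as to clear its column \<open>j\<close>; by \<open>null_vector\<close> the
      form of \<open>D\<close> does not change.\<close>
    define w' where "w' p r = w p r + (- (w p j / v j)) * v r" for p r
    have "sform k (D (X p q)) (w p) (w q) = sform k (D (X p q)) (w' p) (w' q)" if "p < n" "q < n" for p q
      using null_vector[OF S Dlin Dcp null X[OF that]]
      unfolding w'_def[abs_def] sform_add_left sform_add_right by simp
    then have "block_form n k D X w = block_form n k D X w'"
      by (simp add: block_form_def)
    then have "f (compress n k w' X) < 0"
      using f(3) fD[of n X w, OF X] fD[of n X w', OF X] by simp
    then have "compress n k w' X \<notin> mat_cone k S"
      using f(1) unfolding positive_functional_def by force
    then have "\<not> re_pos k (compress n k w' X)"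
      using X_mat_space by (simp add: mat_cone_def)
    moreover obtain k' where k': "k = Suc k'"
      using k by (cases k) auto
    ultimately have "P k'"
      using compress_drop_index[of j k' w' n X] j vj by (simp add: P_def w'_def)
    then show False
      using min[of k'] k' by simp
  qed
  \<comment> \<open>The 1 x 1 matrix with entry 1 tests \<open>D\<close> at level one, so
    \<open>D 1\<close> is positive semidefinite.\<close>
  have "mpos 1 (mat_unit 1 :: nat \<Rightarrow> nat \<Rightarrow> 'a)"
    by (simp add: mpos_def qform_mat_unit cstar_pos_ip_self)
  from re_cp_real[OF S Dlin Dcp _ this, of "\<lambda>_. v" for v]
  have "Im (sform k (D 1) v v) = 0" "0 \<le> Re (sform k (D 1) v v)" for v
    using operator_systemD[OF S] by (simp_all add: block_form_def mat_unit_def)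
  then obtain Y Z where Y: "Y \<in> carrier_mat k k" and Z: "Z \<in> carrier_mat k k"
    and GY: "D 1 = mat_star Y * Y" and YZ: "Y * Z = 1\<^sub>m k" and ZY: "Z * Y = 1\<^sub>m k"
    using posdef_factor[OF G] inj by blast
  define \<theta> where "\<theta> x = mat_star Z * D x * Z" for x
  have D_eq: "D x = mat_star Y * \<theta> x * Y" if "x \<in> S" for x
    unfolding \<theta>_def by (rule conj_cancel[OF mat_linear_onD(1)[OF Dlin that] Y Z ZY, symmetric])
  have "\<theta> 1 = 1\<^sub>m k"
    using conj_cancel[OF one_carrier_mat Z Y YZ] right_mult_one_mat[OF mat_star_carrier[OF Y]]
    by (simp add: \<theta>_def GY)
  then have \<theta>: "\<theta> \<in> UCP S k"
    unfolding \<theta>_def using mat_linear_on_conj[OF Dlin Z] re_cp_conj[OF Dlin Dcp Z]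
    by (intro UCP_of_re_cp[OF S]) simp_all
  have "matrix_extreme S k \<theta>"
  proof (rule matrix_extreme_of_pure[OF S k f(1) _ Y Z ZY YZ \<theta>])
    show "g V = g (mat_unit k) * f V"
      if "positive_functional g" "positive_functional h" "\<And>V. V \<in> mat_space k S \<Longrightarrow> g V + h V = f V"
        "V \<in> mat_space k S" for g h V
      by (rule pure[OF that])
    show "dual_map k f x = mat_star Y * \<theta> x * Y" if "x \<in> S" for x
      using D_eq[OF that] by (simp add: D_def)
  qed
  then have "k \<le> N"
    using bound unfolding subhomogeneity_bound_def matrix_extreme_points_def by (metis empty_iff mem_Collect_eq not_le)
  moreover have "block_form n k \<theta> X (\<lambda>p. mat_app k Y (w p)) = block_form n k D X w"
  proof -
    have "block_form n k D X w = block_form n k (\<lambda>x. mat_star Y * \<theta> x * Y) X w"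
      by (rule block_form_cong) (rule D_eq[OF X])
    also have "\<dots> = block_form n k \<theta> X (\<lambda>p. mat_app k Y (w p))"
      by (rule block_form_conj[OF UCP_mat_linear_on[OF \<theta>] Y X])
    finally show ?thesis ..
  qed
  then have "Re (block_form n k \<theta> X (\<lambda>p. mat_app k Y (w p))) < 0"
    using fD[of n X w, OF X] f(3) by simp
  ultimately show thesis
    using that k \<theta> by blast
qed

section \<open>Transfer of positivity along linear maps between operator systems\<close>

lemma linear_map_on_zero:
  assumes "operator_system S" "linear_map_on S h"
  shows "h 0 = 0"
proof -
  have "h (0 *\<^sub>C 0) = 0 *\<^sub>C h 0"
    using assms unfolding linear_map_on_def by (meson operator_systemD(2))
  then show ?thesis
    by simp
qed

lemma linear_map_on_sum:
  assumes S: "operator_system S" and h: "linear_map_on S h" and x: "\<And>i. i \<in> A \<Longrightarrow> x i \<in> S"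
  shows "h (sum x A) = (\<Sum>i\<in>A. h (x i))"
  using x
proof (induction A rule: infinite_finite_induct)
  case (insert i A)
  have "h (x i + sum x A) = h (x i) + h (sum x A)"
    using h insert.prems operator_system_sum[OF S, of A x] unfolding linear_map_on_def by simp
  then show ?case
    using insert by simp
qed (simp_all add: linear_map_on_zero[OF S h])

lemma compress_map:
  assumes S: "operator_system S" and h: "linear_map_on S h"
    and X: "\<And>p q. p < n \<Longrightarrow> q < n \<Longrightarrow> X p q \<in> S"
  shows "compress n k w (\<lambda>p q. h (X p q)) r s = h (compress n k w X r s)"
proof (cases "r < k \<and> s < k")
  case True
  note S' = operator_systemD[OF S]
  have "h (\<Sum>p<n. \<Sum>q<n. (cnj (w p r) * w q s) *\<^sub>C X p q)
      = (\<Sum>p<n. h (\<Sum>q<n. (cnj (w p r) * w q s) *\<^sub>C X p q))"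
    by (rule linear_map_on_sum[OF S h]) (auto intro!: operator_system_sum[OF S] S' X)
  also have "\<dots> = (\<Sum>p<n. \<Sum>q<n. h ((cnj (w p r) * w q s) *\<^sub>C X p q))"
    by (intro sum.cong refl linear_map_on_sum[OF S h]) (auto intro!: S' X)
  also have "\<dots> = (\<Sum>p<n. \<Sum>q<n. (cnj (w p r) * w q s) *\<^sub>C h (X p q))"
    using h X by (intro sum.cong refl) (simp add: linear_map_on_def)
  finally show ?thesis
    using True by (simp add: compress_def)
next
  case False
  then show ?thesis
    using linear_map_on_zero[OF S h] unfolding compress_def by auto
qed

lemma mpos_map_of_n_positive:
  assumes pos: "n_positive n S h" and X: "\<And>i j. i < n \<Longrightarrow> j < n \<Longrightarrow> X i j \<in> S" and "mpos n X"
  shows "mpos n (\<lambda>i j. h (X i j))"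
proof -
  define M where "M = mat n n (\<lambda>(i, j). X i j)"
  have "M \<in> mats_over n S"
    using X by (auto simp: M_def mats_over_def)
  moreover have "mpos n (\<lambda>i j. M $$ (i, j))"
    using \<open>mpos n X\<close> by (subst mpos_cong[of n _ X]) (auto simp: M_def)
  then have "mat_positive n M"
    by (subst mat_positive_iff_mpos) (auto simp: M_def)
  ultimately have "mat_positive n (map_mat h M)"
    using pos by (auto simp: n_positive_def)
  then have "mpos n (\<lambda>i j. map_mat h M $$ (i, j))"
    by (subst (asm) mat_positive_iff_mpos) (auto simp: M_def)
  then show ?thesis
    by (subst (asm) mpos_cong[of n _ "\<lambda>i j. h (X i j)"]) (auto simp: M_def)
qed

text \<open>
  Choi's theorem for \<open>\<theta> \<circ> h\<close>: the form at \<open>w\<close> only depends on the compression \<open>W\<^sup>* X W\<close>, which after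
  padding with zeros is an \<open>N \<times> N\<close> matrix.
\<close>
lemma block_form_map_real:
  assumes S: "operator_system S" and R: "operator_system R" and h: "linear_map_on S h" "h ` S \<subseteq> R"
    and pos: "n_positive N S h" and kN: "k \<le> N" and \<theta>: "\<theta> \<in> UCP R k"
    and X: "\<And>p q. p < n \<Longrightarrow> q < n \<Longrightarrow> X p q \<in> S" and "mpos n X"
  shows "Im (block_form n k \<theta> (\<lambda>p q. h (X p q)) w) = 0" "0 \<le> Re (block_form n k \<theta> (\<lambda>p q. h (X p q)) w)"
proof -
  note \<theta>lin = UCP_mat_linear_on[OF \<theta>]
  define w' where "w' p r = (if r < k then w p r else 0)" for p r
  define V where "V = compress n N w' X"
  have VS: "V r s \<in> S" for r s
    using compress_mat_space[where n = n and X = X, OF S X] by (simp add: V_def mat_space_def)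
  have hV: "h (V r s) \<in> R" for r s
    using VS h(2) by auto
  have hX: "h (X p q) \<in> R" if "p < n" "q < n" for p q
    using X[OF that] h(2) by auto
  have "mpos N V"
    unfolding V_def by (rule mpos_compress[OF \<open>mpos n X\<close>])
  then have "mpos N (\<lambda>r s. h (V r s))"
    by (rule mpos_map_of_n_positive[OF pos VS])
  note real = block_form_real[OF \<theta> hV this, of "\<lambda>r. if r < k then unit_fun r else (\<lambda>_. 0)"]
  have "block_form n k \<theta> (\<lambda>p q. h (X p q)) w
      = block_form k k \<theta> (compress n k w (\<lambda>p q. h (X p q))) unit_fun"
    by (rule block_form_compress[OF R \<theta>lin hX, symmetric])
  also have "\<dots> = block_form k k \<theta> (\<lambda>r s. h (V r s)) unit_fun"
  proof -
    have "compress n k w (\<lambda>p q. h (X p q)) r s = h (V r s)" if "r < k" "s < k" for r s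
    proof -
      have "compress n k w X r s = V r s"
        using that kN by (simp add: compress_def V_def w'_def)
      then show ?thesis
        using compress_map[where n = n and X = X, OF S h(1) X] by simp
    qed
    then show ?thesis
      by (simp add: block_form_def)
  qed
  also have "\<dots> = block_form N k \<theta> (\<lambda>r s. h (V r s)) (\<lambda>r. if r < k then unit_fun r else (\<lambda>_. 0))"
  proof -
    \<comment> \<open>Blocks from index \<open>k\<close> on are paired with the zero vector, so
      passing from \<open>k\<close> to \<open>N\<close> adds only zero terms.\<close>
    let ?u = "\<lambda>r. if r < k then unit_fun r else (\<lambda>_. 0 :: complex)"
    have 0: "sform k M (?u r) (?u s) = 0" if "\<not> r < k \<or> \<not> s < k" for M r s
      using that by (auto simp: sform_def)
    have "(\<Sum>s<N. sform k (\<theta> (h (V r s))) (?u r) (?u s)) = (\<Sum>s<k. sform k (\<theta> (h (V r s))) (?u r) (?u s))" for r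
      using kN by (intro sum.mono_neutral_right ballI 0) auto
    moreover have "(\<Sum>r<N. \<Sum>s<k. sform k (\<theta> (h (V r s))) (?u r) (?u s)) = (\<Sum>r<k. \<Sum>s<k. sform k (\<theta> (h (V r s))) (?u r) (?u s))"
      using kN by (intro sum.mono_neutral_right ballI sum.neutral 0) auto
    ultimately show ?thesis
      by (simp add: block_form_def)
  qed
  finally show "Im (block_form n k \<theta> (\<lambda>p q. h (X p q)) w) = 0" "0 \<le> Re (block_form n k \<theta> (\<lambda>p q. h (X p q)) w)"
    using real by simp_all
qed

text \<open>If the image of \<open>X\<close> were not positive, one of its multiples by 1, i and - i
  would fail \<open>re_pos\<close>, and \<open>not_re_pos_witness\<close> would yield a unital
  completely positive map on \<open>R\<close>, at a level at most \<open>M\<close>, with negative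
  real part there. But \<open>block_form_map_real\<close> makes the form at the image of
  \<open>X\<close> real and nonnegative, so all three multiples have nonnegative real part.\<close>

lemma n_positive_of_subhomogeneity_bound:
  assumes S: "operator_system S" and R: "operator_system R" and h: "linear_map_on S h" "h ` S \<subseteq> R"
    and pos: "n_positive N S h" and bound: "subhomogeneity_bound R M" "M \<le> N"
  shows "n_positive n S h"
  unfolding n_positive_def
proof (intro ballI impI)
  fix X assume X: "X \<in> mats_over n S" and Xpos: "mat_positive n X"
  define X' where "X' p q = X $$ (p, q)" for p q
  have Xn: "X \<in> carrier_mat n n"
    using X by (simp add: mats_over_def)
  have XS: "X' p q \<in> S" if "p < n" "q < n" for p q
    using X that by (simp add: mats_over_def X'_def)
  have X'pos: "mpos n X'"
    using Xpos mat_positive_iff_mpos[OF Xn] by (simp add: X'_def[abs_def])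
  have hR: "h (X' p q) \<in> R" if "p < n" "q < n" for p q
    using XS[OF that] h(2) by auto
  have re: "re_pos n (\<lambda>p q. c *\<^sub>C h (X' p q))" if c: "c = 1 \<or> c = \<i> \<or> c = - \<i>" for c
  proof (rule ccontr)
    assume "\<not> re_pos n (\<lambda>p q. c *\<^sub>C h (X' p q))"
    then obtain k \<theta> w where k: "k \<le> M" and \<theta>: "\<theta> \<in> UCP R k"
      and neg: "Re (block_form n k \<theta> (\<lambda>p q. c *\<^sub>C h (X' p q)) w) < 0"
      using not_re_pos_witness[OF R bound(1), of n "\<lambda>p q. c *\<^sub>C h (X' p q)"] operator_systemD(4)[OF R hR]
      by metis
    have "block_form n k \<theta> (\<lambda>p q. c *\<^sub>C h (X' p q)) w = c * block_form n k \<theta> (\<lambda>p q. h (X' p q)) w"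
      by (rule block_form_scaleC[OF UCP_mat_linear_on[OF \<theta>] hR])
    then show False
      using neg c block_form_map_real[OF S R h pos le_trans[OF k bound(2)] \<theta> XS X'pos, of w]
      by auto
  qed
  have "mpos n (\<lambda>p q. h (X' p q))"
    using re[of 1] re[of \<i>] re[of "- \<i>"] by (intro mpos_of_re_pos) simp_all
  moreover have "mpos n (\<lambda>i j. map_mat h X $$ (i, j)) \<longleftrightarrow> mpos n (\<lambda>p q. h (X' p q))"
    using Xn by (intro mpos_cong) (simp add: X'_def)
  ultimately show "mat_positive n (map_mat h X)"
    using mat_positive_iff_mpos[of "map_mat h X" n] Xn by simp
qed

lemma linear_map_on_inv_into:
  assumes S: "operator_system S" and h: "linear_map_on S h" and bij: "bij_betw h S R"
  shows "linear_map_on R (inv_into S h)"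
proof -
  note S' = operator_systemD[OF S]
  have inv: "inv_into S h y \<in> S" "h (inv_into S h y) = y" if "y \<in> R" for y
    using bij that by (auto simp: bij_betw_def inv_into_into f_inv_into_f)
  have eq: "inv_into S h y = x" if "x \<in> S" "h x = y" for x y
    using bij that by (auto simp: bij_betw_def)
  have "inv_into S h (x + y) = inv_into S h x + inv_into S h y" if "x \<in> R" "y \<in> R" for x y
    using h inv[OF that(1)] inv[OF that(2)] by (intro eq) (auto simp: S' linear_map_on_def)
  moreover have "inv_into S h (c *\<^sub>C x) = c *\<^sub>C inv_into S h x" if "x \<in> R" for c x
    using h inv[OF that] by (intro eq) (auto simp: S' linear_map_on_def)
  ultimately show ?thesis
    by (simp add: linear_map_on_def)
qed

theorem theorem4p2:
  fixes S :: "'a::unital_cstar_algebra set" and R :: "'b::unital_cstar_algebra set"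
    and N_S N_R N :: nat
  assumes "operator_system S" and "N_subhomogeneous N_S S"
    and "operator_system R" and "N_subhomogeneous N_R R"
    and "N = max N_S N_R"
  shows "completely_order_isomorphic S R \<longleftrightarrow> n_order_isomorphic N S R"
proof
  show "completely_order_isomorphic S R \<Longrightarrow> n_order_isomorphic N S R"
    by (auto simp: completely_order_isomorphic_def complete_order_isomorphism_def n_order_isomorphic_def)
next
  assume "n_order_isomorphic N S R"
  then obtain h where h: "linear_map_on S h" "h 1 = 1" "bij_betw h S R"
    and pos: "n_positive N S h" "n_positive N R (inv_into S h)"
    by (auto simp: n_order_isomorphic_def n_order_isomorphism_def)
  have bound: "subhomogeneity_bound S N_S" "subhomogeneity_bound R N_R"
    using assms by (auto simp: N_subhomogeneous_def)
  \<comment> \<open>Each direction uses the bound of its target: \<open>h\<close> that of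
    \<open>R\<close>, its inverse that of \<open>S\<close>. Hence the maximum.\<close>
  have "n_positive n S h" for n
    using h(3) assms(5) by (intro n_positive_of_subhomogeneity_bound[OF assms(1,3) h(1) _ pos(1) bound(2)])
      (auto simp: bij_betw_def)
  moreover have "n_positive n R (inv_into S h)" for n
    using bij_betw_inv_into[OF h(3)] assms(5)
    by (intro n_positive_of_subhomogeneity_bound[OF assms(3,1) linear_map_on_inv_into[OF assms(1) h(1,3)] _
          pos(2) bound(1)]) (auto simp: bij_betw_def)
  ultimately have "complete_order_isomorphism S R h"
    using h by (simp add: complete_order_isomorphism_def n_order_isomorphism_def)
  then show "completely_order_isomorphic S R"
    by (auto simp: completely_order_isomorphic_def)
qed

end
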